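(* Let $p_n$ denote the $n$th prime and $d_n=p_{n+1}-p_n$, and for $k\ge1$ let $R_k=\limsup_{n\to\infty}\frac{\min(d_{n+1},\dots,d_{n+k})}{\log^2(p_n)}$. Assume that $0<R_1<\infty$ and $0<R_2<\infty$. Let $\delta=\delta_P$ and $\mu=\mu_P$ be the conformal measure on $\Lambda_P$. Then $0<\mathcal P^\psi(\mu)<\infty$ for $\psi(r)=r^\delta(\log\log(1/r))^{-2\delta}$.
   Context: For $E\subset\mathbb N$ and $a\in E$ let $\phi_a(x)=1/(a+x)$; for finite words $\omega$ put $\phi_\omega=\phi_{\omega_1}\circ\cdots\circ\phi_{\omega_{|\omega|}}$ and $\|\phi_\omega'\|=\sup_{[0,1]}|\phi_\omega'|$. $\Lambda_P$ is the set of irrationals in $(0,1)$ with all continued fraction entries prime. $\delta_P$ is the zero of the pressure $s\mapsto\lim_n\frac1n\log\sum_{\omega\in P^n}\|\phi_\omega'\|^s$ ($1/2<\delta_P<1$), and $\mu_P$ is the unique Borel probability measure on $\Lambda_P$ with $\mu_P(A)=\sum_{p\in P}\int_{\phi_p^{-1}(A)}|\phi_p'|^{\delta_P}d\mu_P$. For a dimension function $\psi$, $\mathcal P^\psi$ is the $\psi$-dimensional packing measure (defined from the packing premeasure $\widetilde{\mathcal P}^\psi(A)=\lim_{\epsilon\to0}\sup\sum_j\psi(\mathrm{diam}B_j)$ over disjoint balls centered in $A$ of diameter $\le\epsilon$, by $\mathcal P^\psi(A)=\inf\{\sum_i\widetilde{\mathcal P}^\psi(A_i):A\subset\bigcup A_i\}$),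 and $\mathcal P^\psi(\mu)=\inf\{\mathcal P^\psi(A):\mu(\mathbb R\setminus A)=0\}$. *)

theory Defs
  imports "HOL-Analysis.Analysis" "HOL-Probability.Probability" "HOL-Computational_Algebra.Primes"
begin

text \<open>p n is the n-th prime, indexed from 0 (p 0 = 2); the indexing shift is irrelevant for limsups.\<close>
definition nthp :: "nat \<Rightarrow> nat" where
  "nthp n = enumerate {q::nat. prime q} n"

definition gap :: "nat \<Rightarrow> nat" where
  "gap n = nthp (Suc n) - nthp n"

definition Rk :: "nat \<Rightarrow> ereal" where
  "Rk k = limsup (\<lambda>n. ereal (real (Min ((\<lambda>i. gap (n + i)) ` {1..k})) / (ln (real (nthp n)))\<^sup>2))"

definition gauss_map :: "real \<Rightarrow> real" where
  "gauss_map x = 1 / x - of_int \<lfloor>1 / x\<rfloor>"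

definition cf_entry :: "real \<Rightarrow> nat \<Rightarrow> int" where
  "cf_entry x n = \<lfloor>1 / (gauss_map ^^ n) x\<rfloor>"

definition Lambda_P :: "real set" where
  "Lambda_P = {x. 0 < x \<and> x < 1 \<and> x \<notin> \<rat> \<and> (\<forall>n. prime (nat (cf_entry x n)) \<and> cf_entry x n \<ge> 0)}"

definition phi :: "nat \<Rightarrow> real \<Rightarrow> real" where
  "phi a x = 1 / (real a + x)"

definition phi_word :: "nat list \<Rightarrow> real \<Rightarrow> real" where
  "phi_word w = foldr (\<lambda>a f. phi a \<circ> f) w id"

definition dnorm :: "nat list \<Rightarrow> real" where
  "dnorm w = (SUP x\<in>{0..1}. \<bar>deriv (phi_word w) x\<bar>)"

definition prime_words :: "nat \<Rightarrow> nat list set" where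
  "prime_words n = {w. length w = n \<and> (\<forall>a\<in>set w. prime a)}"

definition Zsum :: "nat \<Rightarrow> real \<Rightarrow> ennreal" where
  "Zsum n s = (\<integral>\<^sup>+ w. ennreal (dnorm w powr s) \<partial>count_space (prime_words n))"

definition pressure_zero :: "real \<Rightarrow> bool" where
  "pressure_zero s \<longleftrightarrow> (\<forall>n. Zsum n s < \<top>) \<and>
     ((\<lambda>n. ln (enn2real (Zsum n s)) / real n) \<longlonglongrightarrow> 0)"

definition conformal_measure :: "real \<Rightarrow> real measure \<Rightarrow> bool" where
  "conformal_measure s \<mu> \<longleftrightarrow> prob_space \<mu> \<and> sets \<mu> = sets borel \<and>
     UNIV - Lambda_P \<in> sets \<mu> \<and> emeasure \<mu> (UNIV - Lambda_P) = 0 \<and>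
     (\<forall>A\<in>sets borel. emeasure \<mu> A =
        (\<integral>\<^sup>+ q. (\<integral>\<^sup>+ x. indicator (phi q -` A) x * ennreal (\<bar>deriv (phi q) x\<bar> powr s) \<partial>\<mu>)
          \<partial>count_space {q. prime q}))"

definition packings :: "real set \<Rightarrow> real \<Rightarrow> (real \<times> real) set set" where
  "packings A \<epsilon> = {B. countable B \<and> (\<forall>(x,r)\<in>B. x \<in> A \<and> 0 < r \<and> 2 * r \<le> \<epsilon>) \<and>
      (\<forall>b\<in>B. \<forall>b'\<in>B. b \<noteq> b' \<longrightarrow> cball (fst b) (snd b) \<inter> cball (fst b') (snd b') = {})}"

definition packing_premeasure :: "(real \<Rightarrow> real) \<Rightarrow> real set \<Rightarrow> ennreal" where
  "packing_premeasure \<psi> A = (INF \<epsilon>\<in>{0<..}. SUP B\<in>packings A \<epsilon>.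
      (\<integral>\<^sup>+ b. ennreal (\<psi> (diameter (cball (fst b) (snd b)))) \<partial>count_space B))"

definition packing_measure :: "(real \<Rightarrow> real) \<Rightarrow> real set \<Rightarrow> ennreal" where
  "packing_measure \<psi> A = (INF F\<in>{F::nat \<Rightarrow> real set. A \<subseteq> (\<Union>i. F i)}.
      (\<Sum>i. packing_premeasure \<psi> (F i)))"

definition packing_measure_of :: "(real \<Rightarrow> real) \<Rightarrow> real measure \<Rightarrow> ennreal" where
  "packing_measure_of \<psi> \<mu> = (INF A\<in>{A. UNIV - A \<in> sets \<mu> \<and> emeasure \<mu> (UNIV - A) = 0}.
      packing_measure \<psi> A)"

definition psi_loglog :: "real \<Rightarrow> real \<Rightarrow> real" where
  "psi_loglog \<delta> r = r powr \<delta> * (ln (ln (1 / r))) powr (- 2 * \<delta>)"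

end

theory Submission
  imports Defs "HOL-Real_Asymp.Real_Asymp"
begin

text \<open>By the density theorems for packing measures it suffices that, for \<open>\<mu>\<close>-almost every \<open>x\<close>, the upper limit
  of \<open>\<psi>(2r) / \<mu>(B(x, r))\<close> as \<open>r\<close> tends to \<open>0\<close> lies between two positive constants. Rescaling by the inverse
  branch given by the first \<open>n\<close> digits turns a small ball around \<open>x\<close> into a ball of radius \<open>\<rho>\<close> around a point
  close to \<open>1/a\<close>, where \<open>a\<close> is the next digit; its mass is about \<open>a\<close> to the power \<open>-2\<delta>\<close> times the number of primes
  within \<open>a\<^sup>2\<rho>\<close> of \<open>a\<close>. Since \<open>R\<^sub>1\<close> is finite, gaps are at most a constant times \<open>ln\<^sup>2 a\<close>, and by
  Borel-Cantelli \<open>ln a\<close> is at most a constant times \<open>ln n\<close>, hence times \<open>ln (ln (1/r))\<close>: this bounds the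
  upper limit from above. Since \<open>R\<^sub>2\<close> is positive, infinitely many primes \<open>p\<close> are isolated by about \<open>ln\<^sup>2 p\<close> on
  both sides, and almost surely infinitely many of them occur among the first \<open>p\<^sup>3\<close> digits; the corresponding
  balls have exceptionally small mass and bound the upper limit from below.

  Comparing total masses in the conformality relation gives \<open>1/2 < \<delta> \<le> 1\<close>.\<close>

subsection \<open>Continued fraction digits and inverse branches\<close>

text \<open>The exponents in \<open>psi_loglog\<close> come from one computation. If the digit
  \<open>p\<close> is isolated by \<open>h\<close>, about \<open>ln\<^sup>2 p\<close>, and
  \<open>Q\<close> is the denominator of the word before it, a ball of radius \<open>r\<close> of
  order \<open>h / (Q * p)\<^sup>2\<close> meets a single cylinder. Its mass is about
  \<open>Q * p\<close> to the power \<open>-2 * \<delta>\<close>, which is \<open>r / h\<close> to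
  the power \<open>\<delta>\<close>. When \<open>p\<close> occurs before time
  \<open>p\<^sup>3\<close>, \<open>ln (ln (1/r))\<close> is at most a constant times
  \<open>ln p\<close>. The obstacle is that \<open>\<mu>\<close> is only conformal: neither
  invariance under the Gauss map nor independence of the digits is available. A Harnack inequality
  for iterates of the transfer operator replaces both, at the cost of factors
  \<open>4 powr \<delta>\<close>. The two bounds on \<open>\<delta>\<close> enter separately. From
  \<open>\<delta> > 1/2\<close> the tail of the first digit decays like a power, as Borel-Cantelli
  requires. From \<open>\<delta> \<le> 1\<close> a count of primes, being at least \<open>1\<close>,
  dominates its own power \<open>\<delta>\<close>, and a digit \<open>p\<close> has mass at least of
  order \<open>p\<close> to the power \<open>-2\<close>, so that \<open>p\<^sup>3\<close> trials
  suffice.\<close>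

definition digit :: "real \<Rightarrow> nat \<Rightarrow> nat" where
  "digit x n = nat (cf_entry x n)"

lemma digit_funpow: "digit ((gauss_map ^^ n) x) m = digit x (n + m)"
proof -
  have "(gauss_map ^^ m) ((gauss_map ^^ n) x) = (gauss_map ^^ (n + m)) x"
    by (simp only: add.commute[of n m] funpow_add comp_apply)
  then show ?thesis by (simp add: digit_def cf_entry_def)
qed

lemma gauss_digit:
  assumes "0 < z" "z < 1"
  shows "gauss_map (1 / (real a + z)) = z" "digit (1 / (real a + z)) 0 = a"
proof -
  have "\<lfloor>real a + z\<rfloor> = int a" using assms by linarith
  then show "gauss_map (1 / (real a + z)) = z" "digit (1 / (real a + z)) 0 = a"
    by (simp_all add: gauss_map_def digit_def cf_entry_def)
qed

lemma Lambda_P_digit: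
  assumes "x \<in> Lambda_P"
  shows "prime (digit x n)" "1 < x * (real (digit x 0) + 1)" "x = 1 / (real (digit x 0) + gauss_map x)"
    "0 < x" "x \<le> 1/2" "gauss_map x \<in> Lambda_P"
proof -
  have x: "0 < x" "x < 1" "x \<notin> \<rat>" and p: "\<And>n. prime (nat (cf_entry x n))"
    and nn: "\<And>n. cf_entry x n \<ge> 0"
    using assms by (auto simp: Lambda_P_def)
  show "prime (digit x n)" unfolding digit_def by (rule p)
  show "0 < x" by fact
  have d: "real (digit x 0) = of_int \<lfloor>1 / x\<rfloor>"
    using nn[of 0] by (simp add: digit_def cf_entry_def)
  show eq: "x = 1 / (real (digit x 0) + gauss_map x)"
    using x by (simp add: d gauss_map_def)
  have "1 / x < of_int \<lfloor>1 / x\<rfloor> + 1" by linarith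
  then show "1 < x * (real (digit x 0) + 1)" using x d by (simp add: field_simps)
  have "2 \<le> real (digit x 0)" using p[of 0] prime_ge_2_nat unfolding digit_def by fastforce
  then have "2 \<le> 1 / x" using d by linarith
  then show "x \<le> 1/2" using x by (simp add: field_simps)
  have g0: "0 \<le> gauss_map x" "gauss_map x < 1" unfolding gauss_map_def by linarith+
  have gq: "gauss_map x \<notin> \<rat>"
  proof
    assume "gauss_map x \<in> \<rat>"
    then have "1 / (real (digit x 0) + gauss_map x) \<in> \<rat>"
      by (intro Rats_divide Rats_add) auto
    then show False using eq x by simp
  qed
  then have "gauss_map x \<noteq> 0" by (metis Rats_0)
  then have "0 < gauss_map x" using g0 by simp
  moreover have "cf_entry (gauss_map x) n = cf_entry x (Suc n)" for n
    by (simp add: cf_entry_def funpow_swap1)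
  ultimately show "gauss_map x \<in> Lambda_P"
    using g0 gq p nn by (simp add: Lambda_P_def)
qed

lemma Lambda_P_funpow: "x \<in> Lambda_P \<Longrightarrow> (gauss_map ^^ n) x \<in> Lambda_P"
  by (induction n) (auto dest: Lambda_P_digit)

lemma Lambda_P_bounds:
  assumes "x \<in> Lambda_P" shows "1 / (real (digit x 0) + 1) < x" "x < 1 / real (digit x 0)"
proof -
  have p: "real (digit x 0) \<ge> 2" using Lambda_P_digit(1)[OF assms] prime_ge_2_nat
    by (metis numeral_le_real_of_nat_iff)
  show "1 / (real (digit x 0) + 1) < x" using Lambda_P_digit(2)[OF assms] p by (simp add: field_simps)
  have "0 < gauss_map x" using Lambda_P_digit(4)[OF Lambda_P_digit(6)[OF assms]] .
  then show "x < 1 / real (digit x 0)"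
    using p by (subst Lambda_P_digit(3)[OF assms]) (auto simp: field_simps)
qed

text \<open>The map \<open>branch a n\<close> is \<open>\<phi>\<close> of the word \<open>a 0, \<dots>, a (n - 1)\<close>, and \<open>den a n x\<close> is the denominator
  \<open>Q + Q' x\<close> of this fractional linear map, so its derivative has absolute value \<open>(den a n x)\<^sup>-\<^sup>2\<close>.\<close>

primrec branch :: "(nat \<Rightarrow> nat) \<Rightarrow> nat \<Rightarrow> real \<Rightarrow> real" where
  "branch a 0 x = x"
| "branch a (Suc n) x = branch a n (1 / (real (a n) + x))"

primrec den :: "(nat \<Rightarrow> nat) \<Rightarrow> nat \<Rightarrow> real \<Rightarrow> real" where
  "den a 0 x = 1"
| "den a (Suc n) x = den a n (1 / (real (a n) + x)) * (real (a n) + x)"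

lemma branch_digit:
  assumes "x \<in> Lambda_P" shows "branch (digit x) n ((gauss_map ^^ n) x) = x"
proof (induction n)
  case (Suc n)
  have "1 / (real (digit x n) + gauss_map ((gauss_map ^^ n) x)) = (gauss_map ^^ n) x"
    using Lambda_P_digit(3)[OF Lambda_P_funpow[OF assms, of n]] digit_funpow[of n x 0] by simp
  then show ?case using Suc by simp
qed simp

lemma inv_shift_unit: "1 \<le> a \<Longrightarrow> 0 < z \<Longrightarrow> z < 1 \<Longrightarrow> 0 < 1 / (real a + z) \<and> 1 / (real a + z) < 1"
  using of_nat_mono[of 1 a, where ?'a = real] by (simp add: field_simps)

lemma digit_branch:
  assumes "\<And>i. i < n \<Longrightarrow> 1 \<le> a i" "0 < z" "z < 1"
  shows "(gauss_map ^^ n) (branch a n z) = z" "i < n \<Longrightarrow> digit (branch a n z) i = a i"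
    "0 < branch a n z \<and> branch a n z < 1"
proof -
  have "(gauss_map ^^ n) (branch a n z) = z \<and> (\<forall>i<n. digit (branch a n z) i = a i)
      \<and> 0 < branch a n z \<and> branch a n z < 1"
    using assms
  proof (induction n arbitrary: z)
    case (Suc n)
    let ?y = "1 / (real (a n) + z)"
    have y: "0 < ?y" "?y < 1" using inv_shift_unit[of "a n" z] Suc.prems(1)[of n] Suc.prems(2,3) by auto
    have IH: "(gauss_map ^^ n) (branch a n ?y) = ?y" "\<forall>i<n. digit (branch a n ?y) i = a i"
      "0 < branch a n ?y" "branch a n ?y < 1"
      using Suc.IH[OF _ y] Suc.prems by auto
    have "digit (branch a n ?y) n = a n"
      using digit_funpow[of n "branch a n ?y" 0] gauss_digit(2)[of z "a n"] IH(1) Suc.prems by simp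
    then have "\<forall>i<Suc n. digit (branch a n ?y) i = a i" using IH(2) less_Suc_eq by auto
    moreover have "(gauss_map ^^ Suc n) (branch a n ?y) = z"
      using gauss_digit(1)[of z "a n"] Suc.prems by (simp only: funpow.simps comp_apply IH(1))
    ultimately show ?case using IH(3,4) by (simp only: branch.simps)
  qed auto
  then show "(gauss_map ^^ n) (branch a n z) = z" "i < n \<Longrightarrow> digit (branch a n z) i = a i"
    "0 < branch a n z \<and> branch a n z < 1" by blast+
qed

text \<open>The coefficients follow the continuant recursion from \<open>(Q, Q')\<close> to
  \<open>(Q * a n + Q', Q)\<close>. Carrying \<open>Q' \<le> Q\<close> through the induction is the
  whole distortion estimate: on the unit interval the denominator then varies by a factor of at most
  \<open>2\<close>.\<close>

lemma den_affine:
  assumes "\<And>i. i < n \<Longrightarrow> 1 \<le> a i"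
  shows "\<exists>Q Q'. 0 \<le> Q' \<and> Q' \<le> Q \<and> 1 \<le> Q \<and> (\<forall>x\<ge>0. den a n x = Q + Q' * x)"
  using assms
proof (induction n)
  case (Suc n)
  then obtain Q Q' where Q: "0 \<le> Q'" "Q' \<le> Q" "1 \<le> Q"
    "\<And>x. x \<ge> 0 \<Longrightarrow> den a n x = Q + Q' * x" by auto
  have a: "real (a n) \<ge> 1" using Suc.prems[of n] by simp
  have *: "den a (Suc n) x = (Q * real (a n) + Q') + Q * x" if "x \<ge> 0" for x
  proof -
    have "den a (Suc n) x = (Q + Q' * (1 / (real (a n) + x))) * (real (a n) + x)"
      using that by (simp add: Q(4))
    also have "\<dots> = (Q * real (a n) + Q') + Q * x" using that a by (simp add: field_simps)
    finally show ?thesis .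
  qed
  have "Q * 1 \<le> Q * real (a n)" using a Q by (intro mult_left_mono) auto
  then have "0 \<le> Q \<and> Q \<le> Q * real (a n) + Q' \<and> 1 \<le> Q * real (a n) + Q'"
    using Q(1-3) by linarith
  then show ?case using * by blast
qed (rule exI[of _ 1], rule exI[of _ 0], simp)

lemma den_bounds:
  assumes "\<And>i. i < n \<Longrightarrow> 1 \<le> a i" "0 \<le> x" "x \<le> 1"
  shows "den a n 0 \<le> den a n x" "den a n x \<le> 2 * den a n 0" "1 \<le> den a n 0"
proof -
  obtain Q Q' where Q: "0 \<le> Q'" "Q' \<le> Q" "1 \<le> Q"
    "\<And>x. x \<ge> 0 \<Longrightarrow> den a n x = Q + Q' * x" using den_affine[of n a] assms(1) by blast
  have "0 \<le> Q' * x" "Q' * x \<le> Q * 1" using Q(1-3) assms by (simp, intro mult_mono) auto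
  then show "den a n 0 \<le> den a n x" "den a n x \<le> 2 * den a n 0" "1 \<le> den a n 0"
    using Q assms by auto
qed

lemma den_Suc_bounds:
  assumes "\<And>i. i \<le> n \<Longrightarrow> 1 \<le> a i"
  shows "den a n 0 * real (a n) \<le> den a (Suc n) 0" "den a (Suc n) 0 \<le> den a n 0 * (real (a n) + 1)"
proof -
  have a: "real (a n) \<ge> 1" using assms[of n] by simp
  obtain Q Q' where Q: "0 \<le> Q'" "Q' \<le> Q" "1 \<le> Q"
    "\<And>x. x \<ge> 0 \<Longrightarrow> den a n x = Q + Q' * x" using den_affine[of n a] assms less_imp_le by blast
  have "den a (Suc n) 0 = Q * real (a n) + Q'"
    using a by (simp add: Q(4) distrib_right)
  moreover have "den a n 0 = Q" by (simp add: Q(4))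
  ultimately show "den a n 0 * real (a n) \<le> den a (Suc n) 0"
    "den a (Suc n) 0 \<le> den a n 0 * (real (a n) + 1)"
    using Q(1-3) by (auto simp: distrib_left)
qed

lemma den_ge_power:
  assumes "\<And>i. i < n \<Longrightarrow> 2 \<le> a i" shows "2 ^ n \<le> den a n 0"
  using assms
proof (induction n)
  case (Suc n)
  have "2 ^ Suc n \<le> den a n 0 * real (a n)"
    using Suc.IH Suc.prems order.trans[OF zero_le_power Suc.IH]
    by (subst power_Suc2) (intro mult_mono, auto)
  also have "\<dots> \<le> den a (Suc n) 0" proof (rule den_Suc_bounds)
    fix i assume "i \<le> n" then show "1 \<le> a i" using Suc.prems[of i] by simp
  qed
  finally show ?case .
qed simp

lemma den_le_power:
  assumes "\<And>i. i < n \<Longrightarrow> 1 \<le> a i" "\<And>i. i < n \<Longrightarrow> real (a i) + 1 \<le> b" "0 \<le> b"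
  shows "den a n 0 \<le> b ^ n"
  using assms(1,2)
proof (induction n)
  case (Suc n)
  have "den a (Suc n) 0 \<le> den a n 0 * (real (a n) + 1)"
    using Suc.prems by (intro den_Suc_bounds) auto
  also have "\<dots> \<le> b ^ n * b"
    using Suc.IH Suc.prems assms(3) by (intro mult_mono) auto
  finally show ?case by (simp add: mult.commute)
qed simp

text \<open>Exact because the branch is fractional linear with determinant 1 or -1. It plays the
  role of a mean value estimate, with the denominators at both points in place of the derivative at
  an intermediate one.\<close>

lemma branch_diff:
  assumes "\<And>i. i < n \<Longrightarrow> 1 \<le> a i" "0 \<le> x" "0 \<le> y"
  shows "\<bar>branch a n x - branch a n y\<bar> = \<bar>x - y\<bar> / (den a n x * den a n y)"
  using assms
proof (induction n arbitrary: x y)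
  case (Suc n)
  have a: "real (a n) \<ge> 1" using Suc.prems(1)[of n] by simp
  have "\<bar>branch a (Suc n) x - branch a (Suc n) y\<bar> = \<bar>1 / (real (a n) + x) - 1 / (real (a n) + y)\<bar> /
      (den a n (1 / (real (a n) + x)) * den a n (1 / (real (a n) + y)))"
    using Suc.IH[of "1 / (real (a n) + x)" "1 / (real (a n) + y)"] Suc.prems by simp
  also have "1 / (real (a n) + x) - 1 / (real (a n) + y) = (y - x) / ((real (a n) + x) * (real (a n) + y))"
  proof -
    have "0 < real (a n) + x" "0 < real (a n) + y" using a Suc.prems by linarith+
    then show ?thesis by (simp add: field_simps)
  qed
  also have "\<bar>(y - x) / ((real (a n) + x) * (real (a n) + y))\<bar> = \<bar>x - y\<bar> / ((real (a n) + x) * (real (a n) + y))"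
    using a Suc.prems by (simp add: abs_mult abs_minus_commute)
  finally show ?case by (simp add: mult_ac)
qed auto

lemma branch_diff_bounds:
  assumes "\<And>i. i < n \<Longrightarrow> 1 \<le> a i" "0 \<le> x" "x \<le> 1" "0 \<le> y" "y \<le> 1"
  shows "\<bar>branch a n x - branch a n y\<bar> \<le> \<bar>x - y\<bar> / (den a n 0)\<^sup>2"
    "\<bar>x - y\<bar> / (4 * (den a n 0)\<^sup>2) \<le> \<bar>branch a n x - branch a n y\<bar>"
proof -
  note dx = den_bounds[of n a x] note dy = den_bounds[of n a y]
  have 1: "(den a n 0)\<^sup>2 \<le> den a n x * den a n y"
    unfolding power2_eq_square using assms dx dy by (intro mult_mono) auto
  have "den a n x * den a n y \<le> (2 * den a n 0) * (2 * den a n 0)"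
    using assms dx dy by (intro mult_mono) auto
  then have 2: "den a n x * den a n y \<le> 4 * (den a n 0)\<^sup>2" by (simp add: power2_eq_square)
  have 3: "0 < (den a n 0)\<^sup>2" "0 < den a n x" "0 < den a n y" using dx dy assms by fastforce+
  show "\<bar>branch a n x - branch a n y\<bar> \<le> \<bar>x - y\<bar> / (den a n 0)\<^sup>2"
    using branch_diff[of n a x y] assms 1 3 by (auto intro!: divide_left_mono mult_pos_pos)
  show "\<bar>x - y\<bar> / (4 * (den a n 0)\<^sup>2) \<le> \<bar>branch a n x - branch a n y\<bar>"
    using branch_diff[of n a x y] assms 1 2 3 by (auto intro!: divide_left_mono mult_pos_pos)
qed

lemma branch_continuous:
  assumes "\<And>i. i < n \<Longrightarrow> 1 \<le> a i" shows "continuous_on {0..1} (branch a n)"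
proof -
  have "1-lipschitz_on {0..1} (branch a n)"
  proof (rule lipschitz_onI)
    fix x y :: real assume xy: "x \<in> {0..1}" "y \<in> {0..1}"
    have "\<bar>branch a n x - branch a n y\<bar> \<le> \<bar>x - y\<bar> / (den a n 0)\<^sup>2"
      using branch_diff_bounds(1)[of n a x y] assms xy by auto
    also have "\<dots> \<le> \<bar>x - y\<bar> / 1"
      using den_bounds(3)[of n a 0] assms by (intro divide_left_mono) (auto simp: one_le_power)
    finally show "dist (branch a n x) (branch a n y) \<le> 1 * dist x y" by (simp add: dist_real_def)
  qed simp
  then show ?thesis by (rule lipschitz_on_continuous_on)
qed

text \<open>Bounded distortion keeps \<open>x\<close> away from both ends of the image of the unit
  interval under its branch. A point \<open>x'\<close> closer than that has a preimage in the open
  interval, hence the same first \<open>n\<close> digits. The second claim is the lower distortion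
  bound read backwards.\<close>

lemma same_digits:
  assumes x: "x \<in> Lambda_P" and x': "x' \<in> Lambda_P"
    and close: "\<bar>x - x'\<bar> < (gauss_map ^^ n) x / (4 * (den (digit x) n 0)\<^sup>2)"
  shows "\<forall>i<n. digit x' i = digit x i"
    "\<bar>(gauss_map ^^ n) x - (gauss_map ^^ n) x'\<bar> \<le> 4 * (den (digit x) n 0)\<^sup>2 * \<bar>x - x'\<bar>"
proof -
  define f where "f = branch (digit x) n"
  define y where "y = (gauss_map ^^ n) x"
  define D where "D = den (digit x) n 0"
  have d1: "1 \<le> digit x i" for i using Lambda_P_digit(1)[OF x, of i] prime_ge_1_nat by blast
  have y: "0 < y" "y \<le> 1/2" using Lambda_P_digit[OF Lambda_P_funpow[OF x, of n]] by (auto simp: y_def)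
  have D: "1 \<le> D" unfolding D_def using den_bounds(3)[of n "digit x" 0] d1 by simp
  have fy: "f y = x" unfolding f_def y_def by (rule branch_digit[OF x])
  have cont: "continuous_on {0..1} f" unfolding f_def using d1 by (intro branch_continuous)
  have diff: "\<bar>u - v\<bar> / (4 * D\<^sup>2) \<le> \<bar>f u - f v\<bar>" if "u \<in> {0..1}" "v \<in> {0..1}" for u v
    unfolding f_def D_def using that d1 by (intro branch_diff_bounds) auto
  have inj: "inj_on f {0..1}"
  proof (rule inj_onI)
    fix u v assume uv: "u \<in> {0..1}" "v \<in> {0..1}" "f u = f v"
    then show "u = v" using diff[of u v] D by (auto simp: divide_le_0_iff)
  qed
  \<comment> \<open>Distances from \<open>x\<close> to the two ends of its cylinder interval. The
    same bound serves for \<open>f 1\<close> because \<open>y \<le> 1/2\<close> gives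
    \<open>1 - y \<ge> y\<close>.\<close>
  have e: "y / (4 * D\<^sup>2) \<le> \<bar>x - f 0\<bar>" "y / (4 * D\<^sup>2) \<le> \<bar>x - f 1\<bar>"
  proof -
    show "y / (4 * D\<^sup>2) \<le> \<bar>x - f 0\<bar>" using diff[of y 0] y fy by auto
    have "y / (4 * D\<^sup>2) \<le> \<bar>y - 1\<bar> / (4 * D\<^sup>2)" using y D by (intro divide_right_mono) auto
    then show "y / (4 * D\<^sup>2) \<le> \<bar>x - f 1\<bar>" using diff[of y 1] y fy by auto
  qed
  have near: "\<bar>x - x'\<bar> < y / (4 * D\<^sup>2)" using close by (simp add: y_def D_def)
  \<comment> \<open>The orientation of the branch alternates with the parity of \<open>n\<close>.
    Continuity and injectivity give monotonicity without tracking the sign, and both directions are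
    then treated.\<close>
  have "strict_mono_on {0..1} f \<or> strict_antimono_on {0..1} f"
    using injective_eq_monotone_map[of "{0..1::real}" f] cont inj by (auto simp: is_interval_cc)
  then have btw: "(f 0 < x \<and> x < f 1) \<or> (f 1 < x \<and> x < f 0)"
    using y fy unfolding monotone_on_def by fastforce
  have "\<exists>z. 0 \<le> z \<and> z \<le> 1 \<and> f z = x'"
  proof (cases "f 0 < x")
    case True
    then have "f 0 \<le> x'" "x' \<le> f 1" using btw e near by linarith+
    then show ?thesis using IVT'[of f 0 x' 1] cont by auto
  next
    case False
    then have "f 1 \<le> x'" "x' \<le> f 0" using btw e near by linarith+
    then show ?thesis using IVT2'[of f 1 x' 0] cont by auto
  qed
  then obtain z where z: "0 \<le> z" "z \<le> 1" "f z = x'" by blast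
  have "z \<noteq> 0" "z \<noteq> 1" using e near z by auto
  then have z': "0 < z" "z < 1" using z by auto
  note db = digit_branch[of n "digit x" z]
  show "\<forall>i<n. digit x' i = digit x i" using db(2) d1 z' z(3) by (auto simp: f_def)
  have "(gauss_map ^^ n) x' = z" using db(1) d1 z' z(3) by (auto simp: f_def)
  moreover have "\<bar>y - z\<bar> / (4 * D\<^sup>2) \<le> \<bar>x - x'\<bar>" using diff[of y z] y z fy by auto
  ultimately show "\<bar>(gauss_map ^^ n) x - (gauss_map ^^ n) x'\<bar> \<le> 4 * (den (digit x) n 0)\<^sup>2 * \<bar>x - x'\<bar>"
    using D by (simp add: y_def D_def field_simps)
qed

subsection \<open>Gaps between primes\<close>

lemma prime_nthp: "prime (nthp n)"
  using enumerate_in_set[OF primes_infinite, of n] by (simp add: nthp_def)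

lemma strict_mono_nthp: "strict_mono nthp"
  unfolding nthp_def[abs_def] using strict_mono_enumerate[OF primes_infinite] by simp

lemma nthp_surj: "prime p \<Longrightarrow> \<exists>n. nthp n = p"
  using enumerate_Ex[of "{q::nat. prime q}" p] primes_infinite by (auto simp: nthp_def)

lemma nthp_ge: "n \<le> nthp n"
  using strict_mono_nthp by (rule strict_mono_imp_increasing)

lemma nthp_ge2: "2 \<le> nthp n"
  using prime_nthp prime_ge_2_nat by blast

lemma nthp_Suc: "nthp (Suc n) = nthp n + gap n"
  using strict_monoD[OF strict_mono_nthp, of n "Suc n"] by (simp add: gap_def)

lemma ln_nthp_pos: "0 < ln (real (nthp n))"
  using nthp_ge2[of n] by (intro ln_gt_zero) simp

lemma Rk_1: "Rk 1 = limsup (\<lambda>n. ereal (real (gap (Suc n)) / (ln (real (nthp n)))\<^sup>2))"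
  by (simp add: Rk_def)

lemma Rk_2: "Rk 2 = limsup (\<lambda>n. ereal (real (min (gap (Suc n)) (gap (Suc (Suc n)))) / (ln (real (nthp n)))\<^sup>2))"
proof -
  have "{1..2} = {1, 2::nat}" by auto
  then show ?thesis by (simp add: Rk_def)
qed

text \<open>Finiteness of the limsup controls all but finitely many gaps, and a maximum absorbs the
  rest. In \<open>Rk 1\<close> the gap is indexed one step after the prime in the logarithm, so the
  bound for \<open>Suc m\<close> is passed on by monotonicity of \<open>ln\<close>.\<close>

lemma gap_le_ln_sq:
  assumes "Rk 1 < \<infinity>"
  shows "\<exists>C\<ge>1. \<forall>n. real (gap n) \<le> C * (ln (real (nthp n)))\<^sup>2"
proof -
  obtain c where c: "limsup (\<lambda>n. ereal (real (gap (Suc n)) / (ln (real (nthp n)))\<^sup>2)) < ereal c"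
    using assms unfolding Rk_1 by (metis ereal_dense2)
  then have "eventually (\<lambda>n. ereal (real (gap (Suc n)) / (ln (real (nthp n)))\<^sup>2) < ereal c) sequentially"
    by (rule Limsup_lessD)
  then obtain N where N: "\<And>n. n \<ge> N \<Longrightarrow> real (gap (Suc n)) / (ln (real (nthp n)))\<^sup>2 < c"
    by (auto simp: eventually_sequentially)
  define D where "D = Max (insert (max 1 c) ((\<lambda>n. real (gap n) / (ln (real (nthp n)))\<^sup>2) ` {..N}))"
  have D: "max 1 c \<le> D" "n \<le> N \<Longrightarrow> real (gap n) / (ln (real (nthp n)))\<^sup>2 \<le> D" for n
    unfolding D_def by (rule Max_ge; auto)+
  have "real (gap n) \<le> D * (ln (real (nthp n)))\<^sup>2" for n
  proof (cases "n \<le> N")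
    case True
    then show ?thesis using D(2)[of n] ln_nthp_pos[of n] by (simp add: field_simps)
  next
    case False
    then obtain m where m: "n = Suc m" "m \<ge> N" by (cases n) auto
    have "real (gap n) \<le> c * (ln (real (nthp m)))\<^sup>2"
      using N[of m] m ln_nthp_pos[of m] by (simp add: field_simps)
    also have "\<dots> \<le> D * (ln (real (nthp m)))\<^sup>2" using D(1) by (intro mult_right_mono) auto
    also have "\<dots> \<le> D * (ln (real (nthp n)))\<^sup>2"
      using D(1) ln_nthp_pos[of m] nthp_ge2[of m] strict_monoD[OF strict_mono_nthp, of m n] m
      by (intro mult_left_mono power_mono) auto
    finally show ?thesis .
  qed
  then show ?thesis using D(1) by (intro exI[of _ D]) auto
qed

lemma ln_sq_le: "1 \<le> (x::real) \<Longrightarrow> (ln x)\<^sup>2 \<le> 4 * x"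
proof -
  assume x: "1 \<le> x"
  have "ln x = 2 * ln (sqrt x)" using x by (simp add: ln_sqrt)
  also have "\<dots> \<le> 2 * sqrt x" using ln_le_minus_one[of "sqrt x"] x by simp
  finally have "(ln x)\<^sup>2 \<le> (2 * sqrt x)\<^sup>2" using x by (intro power_mono) auto
  then show ?thesis using x by (simp add: power_mult_distrib)
qed

lemma nthp_Suc_le:
  assumes "\<And>n. real (gap n) \<le> C * (ln (real (nthp n)))\<^sup>2" "0 \<le> C"
  shows "real (nthp (Suc n)) \<le> (1 + 4 * C) * real (nthp n)"
proof -
  have "real (nthp (Suc n)) \<le> real (nthp n) + C * (ln (real (nthp n)))\<^sup>2"
    using assms(1)[of n] by (simp add: nthp_Suc)
  also have "\<dots> \<le> real (nthp n) + C * (4 * real (nthp n))"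
    using assms(2) nthp_ge2[of n] by (intro add_left_mono mult_left_mono ln_sq_le) auto
  finally show ?thesis by (simp add: algebra_simps)
qed

text \<open>A Bertrand-type statement, due to the bounded ratio of consecutive primes. It supplies
  the starting digit when a rescaled ball is so large that it reaches \<open>0\<close>.\<close>

lemma next_prime:
  assumes "Rk 1 < \<infinity>"
  shows "\<exists>C\<ge>1. \<forall>M\<ge>1. \<exists>b. prime b \<and> M \<le> real b \<and> real b \<le> C * M \<and> (\<forall>q. prime q \<longrightarrow> M \<le> real q \<longrightarrow> b \<le> q)"
proof -
  obtain C where C: "C \<ge> 1" "\<And>n. real (gap n) \<le> C * (ln (real (nthp n)))\<^sup>2"
    using gap_le_ln_sq[OF assms] by blast
  have "\<exists>b. prime b \<and> M \<le> real b \<and> real b \<le> (1 + 4 * C) * M \<and> (\<forall>q. prime q \<longrightarrow> M \<le> real q \<longrightarrow> b \<le> q)"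
    if M: "1 \<le> M" for M :: real
  proof -
    have ex: "\<exists>n. M \<le> real (nthp n)"
      using real_nat_ceiling_ge[of M] nthp_ge[of "nat \<lceil>M\<rceil>"] by (meson of_nat_mono order.trans)
    define n where "n = (LEAST n. M \<le> real (nthp n))"
    have n: "M \<le> real (nthp n)" unfolding n_def using ex by (rule LeastI_ex)
    have least: "n \<le> m" if "M \<le> real (nthp m)" for m
      unfolding n_def using that by (rule Least_le)
    have "real (nthp n) \<le> (1 + 4 * C) * M"
    proof (cases n)
      case 0
      have "nthp 0 \<le> 2"
      proof -
        obtain m where "nthp m = 2" using nthp_surj[of 2] by auto
        then show ?thesis using strict_mono_less_eq[OF strict_mono_nthp, of 0 m] by simp
      qed
      moreover have "2 * 1 \<le> (1 + 4 * C) * M" using C M by (intro mult_mono) auto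
      ultimately show ?thesis using 0 by simp
    next
      case (Suc m)
      have "real (nthp m) < M" using least[of m] Suc by force
      then show ?thesis using nthp_Suc_le[of C m] C Suc
        by (smt (verit) mult_left_mono)
    qed
    moreover have "nthp n \<le> q" if "prime q" "M \<le> real q" for q
    proof -
      obtain m where "nthp m = q" using nthp_surj \<open>prime q\<close> by blast
      then show ?thesis using least[of m] that strict_mono_less_eq[OF strict_mono_nthp, of n m] by simp
    qed
    ultimately show ?thesis using n prime_nthp by blast
  qed
  then show ?thesis using C by (intro exI[of _ "1 + 4 * C"]) auto
qed

lemma half_lt_ln2: "1/2 < ln (2::real)"
proof -
  have "exp (1/2::real) ^ 2 = exp 1" by (simp flip: exp_of_nat_mult)
  then have "exp (1/2::real) ^ 2 < 2 ^ 2" using e_less_272 by simp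
  then have "exp (1/2::real) < 2" by (rule power_less_imp_less_base) simp
  then show ?thesis by (metis exp_less_cancel_iff exp_ln zero_less_numeral)
qed

text \<open>Walking up from \<open>a\<close> by gaps of order \<open>ln\<^sup>2 a\<close> finds
  about \<open>t / ln\<^sup>2 a\<close> primes, and \<open>a\<close> itself always counts. A number
  that is at least \<open>1\<close> dominates its power \<open>d \<le> 1\<close>, so one formula
  covers small and large \<open>t\<close>. The \<open>+ 1\<close> in the distance condition
  anticipates that digit \<open>b\<close> occupies the interval from \<open>1 / (b + 1)\<close> to
  \<open>1 / b\<close>.\<close>

lemma prime_count:
  assumes "Rk 1 < \<infinity>" and d: "0 \<le> d" "d \<le> 1"
  shows "\<exists>c>0. \<forall>a t. prime a \<longrightarrow> 0 \<le> t \<longrightarrow> t \<le> real a \<longrightarrow>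
    (\<exists>B. finite B \<and> (\<forall>b\<in>B. prime b \<and> a \<le> b \<and> b \<le> 2 * a \<and> (b = a \<or> real b - real a + 1 \<le> t)) \<and>
      c * (t / (ln (real a))\<^sup>2) powr d \<le> real (card B))"
proof -
  obtain C where C: "C \<ge> 1" "\<And>n. real (gap n) \<le> C * (ln (real (nthp n)))\<^sup>2"
    using gap_le_ln_sq[OF assms(1)] by blast
  \<comment> \<open>A factor \<open>4\<close> comes from \<open>ln (2 * a) \<le> 2 * ln a\<close>
    under the square, and a factor \<open>2\<close> absorbs the additive \<open>1\<close> in
    \<open>t1\<close>.\<close>
  define C' where "C' = 8 * C"
  show ?thesis
  proof (intro exI[of _ "(1 / C') powr d"] conjI allI impI)
    show "0 < (1 / C') powr d" using C by (simp add: C'_def)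
    fix a and t :: real
    assume a: "prime a" and t: "0 \<le> t" "t \<le> real a"
    obtain m where m: "nthp m = a" using nthp_surj a by blast
    have a2: "2 \<le> a" using a by (rule prime_ge_2_nat)
    \<comment> \<open>Bounds every gap met on the walk, since \<open>t \<le> a\<close> keeps the
      walk below \<open>2 * a\<close>.\<close>
    define L where "L = C * (ln (real (2 * a)))\<^sup>2"
    have l2: "ln 2 \<le> ln (real a)" using a2 by simp
    have lna: "1/2 < ln (real a)" using half_lt_ln2 l2 by linarith
    have "(ln (real (2 * a)))\<^sup>2 \<le> (2 * ln (real a))\<^sup>2"
      using l2 a2 by (intro power_mono) (auto simp: ln_mult)
    then have L: "L \<le> 4 * C * (ln (real a))\<^sup>2" unfolding L_def using C by (simp add: power_mult_distrib)
    have lsq: "1/4 \<le> (ln (real a))\<^sup>2" using power_mono[of "1/2" "ln (real a)" 2] lna by (simp add: power2_eq_square)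
    have "(ln (real a))\<^sup>2 \<le> (ln (real (2 * a)))\<^sup>2" using a2 by (intro power_mono) auto
    then have "C * (1/4) \<le> L" unfolding L_def using lsq C by (intro mult_left_mono) auto
    then have L0: "0 < L" using C by auto
    define k where "k = nat \<lfloor>(t - 1) / L\<rfloor>"
    have step: "real (nthp (m + j)) \<le> real a + real j * L" if "real j * L \<le> t - 1" for j
      using that
    proof (induction j)
      case (Suc j)
      have jL: "real j * L \<le> t - 1" using Suc.prems L0 by (simp add: algebra_simps)
      have IH: "real (nthp (m + j)) \<le> real a + real j * L" using Suc.IH jL .
      then have "real (nthp (m + j)) \<le> real (2 * a)" using jL t by simp
      then have "(ln (real (nthp (m + j))))\<^sup>2 \<le> (ln (real (2 * a)))\<^sup>2"
        using nthp_ge2[of "m + j"] by (intro power_mono) auto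
      then have "real (gap (m + j)) \<le> L" unfolding L_def using C(1) C(2)[of "m + j"]
        by (meson mult_left_mono order.trans zero_le_one)
      then show ?case using IH by (simp add: nthp_Suc algebra_simps)
    qed (simp add: m)
    define B where "B = nthp ` {m..m + k}"
    have B: "prime b \<and> a \<le> b \<and> b \<le> 2 * a \<and> (b = a \<or> real b - real a + 1 \<le> t)" if bB: "b \<in> B" for b
    proof -
      obtain i where i: "b = nthp i" "m \<le> i" "i \<le> m + k" using bB by (auto simp: B_def)
      define j where "j = i - m"
      have j: "i = m + j" "j \<le> k" using i by (auto simp: j_def)
      have ab: "a \<le> b" using i m strict_mono_less_eq[OF strict_mono_nthp, of m i] by simp
      show ?thesis
      proof (cases "j = 0")
        case True
        then show ?thesis using i j m a by auto
      next
        case False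
        then have "0 < k" using j by simp
        then have "real k \<le> (t - 1) / L" unfolding k_def by linarith
        then have "real k * L \<le> t - 1" using L0 by (simp add: field_simps)
        moreover have "real j * L \<le> real k * L" using j L0 by (intro mult_right_mono) auto
        ultimately have "real j * L \<le> t - 1" by linarith
        then have "real b \<le> real a + (t - 1)" using step[of j] i j by fastforce
        moreover from this have "real b \<le> real (2 * a)" using t by simp
        ultimately show ?thesis using ab i prime_nthp by simp
      qed
    qed
    have card: "card B = k + 1"
      unfolding B_def using strict_mono_imp_inj_on[OF strict_mono_nthp]
      by (subst card_image) (auto intro: inj_on_subset)
    define u where "u = t / (ln (real a))\<^sup>2"
    have u0: "0 \<le> u" using t by (simp add: u_def)
    have "(t - 1) / L \<le> real k + 1" unfolding k_def by linarith
    then have "t \<le> 1 + (real k + 1) * L" using L0 by (simp add: field_simps)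
    also have "\<dots> \<le> 1 + (real k + 1) * (4 * C * (ln (real a))\<^sup>2)"
      using L by (intro add_left_mono mult_left_mono) auto
    finally have t1: "t \<le> 1 + (real k + 1) * (4 * C * (ln (real a))\<^sup>2)" .
    have "1 * (4 * 1 * (1/4)) \<le> (real k + 1) * (4 * C * (ln (real a))\<^sup>2)"
      using C lsq by (intro mult_mono) auto
    then have "t \<le> 2 * ((real k + 1) * (4 * C * (ln (real a))\<^sup>2))" using t1 by linarith
    then have "t \<le> C' * (real k + 1) * (ln (real a))\<^sup>2" by (simp add: C'_def algebra_simps)
    then have u: "1 / C' * u \<le> real (card B)"
    proof -
      have "0 < C' * (ln (real a))\<^sup>2" using lsq C by (intro mult_pos_pos) (auto simp: C'_def)
      then have "t / (C' * (ln (real a))\<^sup>2) \<le> real k + 1"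
        using \<open>t \<le> C' * (real k + 1) * (ln (real a))\<^sup>2\<close> by (subst pos_divide_le_eq) (auto simp: mult_ac)
      then show ?thesis by (simp add: u_def card mult_ac)
    qed
    have "(1 / C') powr d * u powr d = (1 / C' * u) powr d"
      using C u0 by (subst powr_mult) (auto simp: C'_def)
    also have "\<dots> \<le> real (card B) powr d"
      using u u0 d C by (intro powr_mono2) (auto simp: C'_def)
    also have "\<dots> \<le> real (card B) powr 1" using d card by (intro powr_mono) auto
    finally have "(1 / C') powr d * u powr d \<le> real (card B)" using card by simp
    then show "\<exists>B. finite B \<and> (\<forall>b\<in>B. prime b \<and> a \<le> b \<and> b \<le> 2 * a \<and> (b = a \<or> real b - real a + 1 \<le> t)) \<and>
      (1 / C') powr d * (t / (ln (real a))\<^sup>2) powr d \<le> real (card B)"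
      using B by (intro exI[of _ B]) (auto simp: B_def u_def)
  qed
qed

text \<open>Two consecutive large gaps isolate the prime between them on both sides.\<close>

lemma isolated_primes:
  assumes "Rk 1 < \<infinity>" "0 < Rk 2"
  shows "\<exists>c>0. \<forall>N. \<exists>p>N. prime p \<and>
    (\<forall>q. prime q \<longrightarrow> q \<noteq> p \<longrightarrow> c * (ln (real p))\<^sup>2 \<le> \<bar>real q - real p\<bar>)"
proof -
  obtain C where C: "C \<ge> 1" "\<And>n. real (gap n) \<le> C * (ln (real (nthp n)))\<^sup>2"
    using gap_le_ln_sq[OF assms(1)] by blast
  obtain c where c: "0 < c" "ereal c < Rk 2" using assms(2) ereal_dense2
    by (metis ereal_less(2) zero_ereal_def)
  have freq: "\<exists>n\<ge>N. c * (ln (real (nthp n)))\<^sup>2 < real (min (gap (Suc n)) (gap (Suc (Suc n))))" for N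
  proof (rule ccontr)
    assume neg: "\<not> ?thesis"
    have "Rk 2 \<le> ereal c"
      unfolding Rk_2
    proof (rule Limsup_bounded)
      show "\<forall>\<^sub>F n in sequentially. ereal (real (min (gap (Suc n)) (gap (Suc (Suc n)))) / (ln (real (nthp n)))\<^sup>2) \<le> ereal c"
        using eventually_ge_at_top[of N]
      proof eventually_elim
        case (elim n)
        then have "real (min (gap (Suc n)) (gap (Suc (Suc n)))) \<le> c * (ln (real (nthp n)))\<^sup>2"
          using neg by (meson not_le)
        then show ?case using ln_nthp_pos[of n] by (simp add: divide_le_eq)
      qed
    qed
    then show False using c by simp
  qed
  show ?thesis
  \<comment> \<open>The prime inside the logarithm of \<open>Rk 2\<close> is two places before
    \<open>p\<close>. For large index \<open>p\<close> is at most its square, so \<open>ln p\<close>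
    is at most twice its logarithm, and squaring costs the factor \<open>4\<close>.\<close>
  proof (intro exI[of _ "c / 4"] conjI allI)
    show "0 < c / 4" using c by simp
    fix N :: nat
    define E where "E = 1 + 4 * C"
    obtain n where n: "n \<ge> max N (nat \<lceil>E\<^sup>2\<rceil>)"
      "c * (ln (real (nthp n)))\<^sup>2 < real (min (gap (Suc n)) (gap (Suc (Suc n))))"
      using freq by blast
    define p where "p = nthp (Suc (Suc n))"
    have "N < p" using nthp_ge[of "Suc (Suc n)"] n unfolding p_def by simp
    moreover have "prime p" unfolding p_def by (rule prime_nthp)
    moreover have "c / 4 * (ln (real p))\<^sup>2 \<le> \<bar>real q - real p\<bar>" if q: "prime q" "q \<noteq> p" for q
    proof -
      have E: "1 \<le> E" using C by (simp add: E_def)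
      have "real p \<le> E * real (nthp (Suc n))" unfolding p_def E_def using C by (intro nthp_Suc_le) auto
      also have "\<dots> \<le> E * (E * real (nthp n))" using E C unfolding E_def by (intro mult_left_mono nthp_Suc_le) auto
      also have "\<dots> = E\<^sup>2 * real (nthp n)" by (simp add: power2_eq_square)
      also have "\<dots> \<le> real (nthp n) * real (nthp n)"
      proof (rule mult_right_mono)
        have "E\<^sup>2 \<le> real n" using n(1) by linarith
        then show "E\<^sup>2 \<le> real (nthp n)" using nthp_ge[of n] by linarith
      qed simp
      finally have "ln (real p) \<le> ln (real (nthp n) * real (nthp n))"
        using nthp_ge2[of n] nthp_ge2[of "Suc (Suc n)"] by (subst ln_le_cancel_iff) (auto simp: p_def)
      also have "\<dots> = 2 * ln (real (nthp n))" using nthp_ge2[of n] by (subst ln_mult) auto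
      finally have "(ln (real p))\<^sup>2 \<le> (2 * ln (real (nthp n)))\<^sup>2"
        using ln_nthp_pos[of "Suc (Suc n)"] by (intro power_mono) (auto simp: p_def)
      then have "c / 4 * (ln (real p))\<^sup>2 \<le> c / 4 * (2 * ln (real (nthp n)))\<^sup>2"
        using c by (intro mult_left_mono) auto
      also have "\<dots> = c * (ln (real (nthp n)))\<^sup>2" by (simp add: power_mult_distrib)
      also have "\<dots> \<le> real (min (gap (Suc n)) (gap (Suc (Suc n))))" using n(2) by simp
      also have "\<dots> \<le> \<bar>real q - real p\<bar>"
      proof -
        obtain m where m: "nthp m = q" using nthp_surj q by blast
        then have "m \<noteq> Suc (Suc n)" using q by (auto simp: p_def)
        then consider "m \<le> Suc n" | "Suc (Suc (Suc n)) \<le> m" by linarith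
        then show ?thesis
        proof cases
          case 1
          then have "q \<le> nthp (Suc n)" using m strict_mono_less_eq[OF strict_mono_nthp, of m "Suc n"] by simp
          then show ?thesis using nthp_Suc[of "Suc n"] by (simp add: p_def)
        next
          case 2
          then have "nthp (Suc (Suc (Suc n))) \<le> q" using m strict_mono_less_eq[OF strict_mono_nthp, of "Suc (Suc (Suc n))" m] by simp
          then show ?thesis using nthp_Suc[of "Suc (Suc n)"] by (simp add: p_def)
        qed
      qed
      finally show ?thesis .
    qed
    ultimately show "\<exists>p>N. prime p \<and> (\<forall>q. prime q \<longrightarrow> q \<noteq> p \<longrightarrow> c / 4 * (ln (real p))\<^sup>2 \<le> \<bar>real q - real p\<bar>)"
      by blast
  qed
qed

subsection \<open>The conformal measure\<close>

lemma gauss_map_measurable [measurable]: "gauss_map \<in> borel_measurable borel"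
  unfolding gauss_map_def by measurable

lemma gauss_map_funpow_measurable [measurable]: "(gauss_map ^^ n) \<in> borel_measurable borel"
  by (induction n) auto

lemma digit_measurable [measurable]: "(\<lambda>x. digit x n) \<in> measurable borel (count_space UNIV)"
  unfolding digit_def cf_entry_def by measurable

lemma abs_deriv_phi:
  assumes "0 < real q + x"
  shows "\<bar>deriv (phi q) x\<bar> powr s = (real q + x) powr (-2 * s)"
proof -
  have "(phi q has_field_derivative - (1 / (real q + x)\<^sup>2)) (at x)"
    unfolding phi_def using assms by (auto intro!: derivative_eq_intros simp: power2_eq_square field_simps)
  then have "deriv (phi q) x = - (1 / (real q + x)\<^sup>2)" by (rule DERIV_imp_deriv)
  then have "\<bar>deriv (phi q) x\<bar> = 1 / (real q + x)\<^sup>2"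
    by (simp only: abs_minus_cancel abs_divide abs_one abs_power2)
  then have "\<bar>deriv (phi q) x\<bar> = (real q + x) powr (-2)"
    using assms by (simp add: powr_minus powr_numeral inverse_eq_divide)
  then show ?thesis by (simp add: powr_powr)
qed

locale prime_conformal =
  fixes \<delta> :: real and \<mu> :: "real measure"
  assumes conf: "conformal_measure \<delta> \<mu>"
begin

sublocale prob_space \<mu>
  using conf by (simp add: conformal_measure_def)

lemma sets_mu [simp, measurable_cong]: "sets \<mu> = sets borel"
  using conf by (simp add: conformal_measure_def)

lemma space_mu [simp]: "space \<mu> = UNIV"
  using sets_eq_imp_space_eq[OF sets_mu] by simp

lemma AE_Lambda: "AE x in \<mu>. x \<in> Lambda_P"
proof (rule AE_I')
  show "UNIV - Lambda_P \<in> null_sets \<mu>"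
    using conf by (auto simp: conformal_measure_def null_sets_def)
qed auto

lemma Lambda_P_measurable [measurable]: "Lambda_P \<in> sets borel"
proof -
  have "UNIV - (UNIV - Lambda_P) \<in> sets borel"
  proof (rule sets.Diff)
    show "UNIV - Lambda_P \<in> sets borel" using conf by (simp add: conformal_measure_def)
  qed simp
  moreover have "UNIV - (UNIV - Lambda_P) = Lambda_P" by blast
  ultimately show ?thesis by (simp only:)
qed

text \<open>The Jacobian factor of the conformality relation in the closed form of
  \<open>abs_deriv_phi\<close>, valid where \<open>q + x > 0\<close>.\<close>

definition wt :: "nat \<Rightarrow> real \<Rightarrow> ennreal" where
  "wt q x = ennreal ((real q + x) powr (-2 * \<delta>))"

lemma wt_measurable [measurable]: "wt q \<in> borel_measurable borel"
  unfolding wt_def by measurable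

text \<open>Extends conformality from sets to functions by the usual induction: \<open>\<mu>\<close>
  is a fixed point of the dual transfer operator. The sum over primes is written as a series over
  all naturals with zero terms, so that monotone convergence for series applies.\<close>

lemma nn_integral_conformal:
  assumes "f \<in> borel_measurable borel"
  shows "(\<integral>\<^sup>+x. f x \<partial>\<mu>) = (\<Sum>q. if prime q then \<integral>\<^sup>+x. f (1 / (real q + x)) * wt q x \<partial>\<mu> else 0)"
  using assms
proof (induction rule: borel_measurable_induct)
  case (cong f g)
  then have "f = g" by auto
  with cong show ?case by (simp only:)
next
  case (set A)
  then have A [measurable]: "A \<in> sets borel" by simp
  have "(\<integral>\<^sup>+x. indicator A x \<partial>\<mu>) = emeasure \<mu> A" by simp
  also have "\<dots> = (\<integral>\<^sup>+ q. (\<integral>\<^sup>+ x. indicator (phi q -` A) x * ennreal (\<bar>deriv (phi q) x\<bar> powr \<delta>) \<partial>\<mu>)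
          \<partial>count_space {q. prime q})"
    using conf A unfolding conformal_measure_def by blast
  also have "\<dots> = (\<integral>\<^sup>+ q. (\<integral>\<^sup>+ x. indicator A (1 / (real q + x)) * wt q x \<partial>\<mu>) \<partial>count_space {q. prime q})"
  proof (rule nn_integral_cong, rule nn_integral_cong_AE)
    fix q
    show "AE x in \<mu>. indicator (phi q -` A) x * ennreal (\<bar>deriv (phi q) x\<bar> powr \<delta>) =
      indicator A (1 / (real q + x)) * wt q x"
      using AE_Lambda
    proof eventually_elim
      case (elim x)
      then have "0 < real q + x" using Lambda_P_digit(4)[OF elim] by simp
      from abs_deriv_phi[OF this] show ?case by (simp add: wt_def phi_def indicator_def)
    qed
  qed
  also have "\<dots> = (\<Sum>q. if prime q then \<integral>\<^sup>+x. indicator A (1 / (real q + x)) * wt q x \<partial>\<mu> else 0)"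
    by (subst nn_integral_count_space_indicator, simp, subst nn_integral_count_space_nat)
      (auto intro!: suminf_cong simp: indicator_def)
  finally show ?case .
next
  case (mult u c)
  note [measurable] = \<open>u \<in> borel_measurable borel\<close>
  show ?case using mult
    by (simp add: nn_integral_cmult mult.assoc if_distrib[of "(*) c"] flip: ennreal_suminf_cmult cong: if_cong)
next
  case (add u v)
  note [measurable] = \<open>u \<in> borel_measurable borel\<close> \<open>v \<in> borel_measurable borel\<close>
  show ?case using add
    by (simp add: nn_integral_add suminf_add summableI)
      (intro suminf_cong, simp add: nn_integral_add distrib_right)
next
  case (seq U)
  note [measurable] = \<open>\<And>i. U i \<in> borel_measurable borel\<close>
  have inc: "U i x \<le> U j x" if "i \<le> j" for i j x
    using \<open>incseq U\<close> that by (auto simp: incseq_def le_fun_def)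
  have 1: "(\<integral>\<^sup>+x. (SUP i. U i) x \<partial>\<mu>) = (SUP i. \<integral>\<^sup>+x. U i x \<partial>\<mu>)"
    unfolding SUP_apply by (intro nn_integral_monotone_convergence_SUP) (auto simp: incseq_def le_fun_def inc)
  have 2: "(\<integral>\<^sup>+x. (SUP i. U i) (1 / (real q + x)) * wt q x \<partial>\<mu>) = (SUP i. \<integral>\<^sup>+x. U i (1 / (real q + x)) * wt q x \<partial>\<mu>)" for q
    unfolding SUP_apply SUP_mult_right_ennreal
    by (intro nn_integral_monotone_convergence_SUP) (auto simp: incseq_def le_fun_def inc intro!: mult_right_mono)
  have "(\<Sum>q. if prime q then \<integral>\<^sup>+x. (SUP i. U i) (1 / (real q + x)) * wt q x \<partial>\<mu> else 0)
      = (\<Sum>q. SUP i. if prime q then \<integral>\<^sup>+x. U i (1 / (real q + x)) * wt q x \<partial>\<mu> else 0)"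
    unfolding 2 by (intro suminf_cong) simp
  also have "\<dots> = (SUP i. \<Sum>q. if prime q then \<integral>\<^sup>+x. U i (1 / (real q + x)) * wt q x \<partial>\<mu> else 0)"
    by (intro ennreal_suminf_SUP_eq) (auto simp: incseq_def inc intro!: nn_integral_mono mult_right_mono)
  finally show ?case using 1 seq by simp
qed

text \<open>Only the branch \<open>q = p\<close> survives, because the first digit of
  \<open>1 / (q + x)\<close> is \<open>q\<close> for \<open>x\<close> in
  \<open>Lambda_P\<close>.\<close>

lemma nn_integral_first_digit:
  assumes [measurable]: "f \<in> borel_measurable borel" and p: "prime p"
  shows "(\<integral>\<^sup>+x. f x * indicator {x. digit x 0 = p} x \<partial>\<mu>) = (\<integral>\<^sup>+x. f (1 / (real p + x)) * wt p x \<partial>\<mu>)"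
proof -
  have "(\<integral>\<^sup>+x. f x * indicator {x. digit x 0 = p} x \<partial>\<mu>) =
    (\<Sum>q. if prime q then \<integral>\<^sup>+x. f (1 / (real q + x)) * indicator {x. digit x 0 = p} (1 / (real q + x)) * wt q x \<partial>\<mu> else 0)"
    by (intro nn_integral_conformal) measurable
  also have "\<dots> = (\<Sum>q. if q = p then \<integral>\<^sup>+x. f (1 / (real p + x)) * wt p x \<partial>\<mu> else 0)"
  proof (intro suminf_cong)
    fix q
    have "(\<integral>\<^sup>+x. f (1 / (real q + x)) * indicator {x. digit x 0 = p} (1 / (real q + x)) * wt q x \<partial>\<mu>)
      = (\<integral>\<^sup>+x. (if q = p then f (1 / (real p + x)) * wt p x else 0) \<partial>\<mu>)"
    proof (intro nn_integral_cong_AE)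
      show "AE x in \<mu>. f (1 / (real q + x)) * indicator {x. digit x 0 = p} (1 / (real q + x)) * wt q x
        = (if q = p then f (1 / (real p + x)) * wt p x else 0)"
        using AE_Lambda
      proof eventually_elim
        case (elim x)
        have "digit (1 / (real q + x)) 0 = q"
          using Lambda_P_digit(4,5)[OF elim] by (intro gauss_digit) auto
        then show ?case by (auto simp: indicator_def)
      qed
    qed
    then show "(if prime q then \<integral>\<^sup>+x. f (1 / (real q + x)) * indicator {x. digit x 0 = p} (1 / (real q + x)) * wt q x \<partial>\<mu> else 0)
      = (if q = p then \<integral>\<^sup>+x. f (1 / (real p + x)) * wt p x \<partial>\<mu> else 0)"
      using p by auto
  qed
  also have "\<dots> = (\<integral>\<^sup>+x. f (1 / (real p + x)) * wt p x \<partial>\<mu>)"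
    by (subst suminf_finite[of "{p}"]) auto
  finally show ?thesis .
qed

section \<open>Masses of cylinders and of sets of digits\<close>

lemma branch_measurable [measurable]: "branch a n \<in> borel_measurable borel"
proof (induction n)
  case (Suc n)
  then have [measurable]: "branch a n \<in> borel_measurable borel" .
  have "(\<lambda>x. branch a n (1 / (real (a n) + x))) \<in> borel_measurable borel" by measurable
  then show ?case by (simp add: fun_eq_iff cong: measurable_cong)
qed (simp add: measurable_ident_sets cong: measurable_cong)

lemma den_measurable [measurable]: "den a n \<in> borel_measurable borel"
proof (induction n)
  case (Suc n)
  then have [measurable]: "den a n \<in> borel_measurable borel" .
  have "(\<lambda>x. den a n (1 / (real (a n) + x)) * (real (a n) + x)) \<in> borel_measurable borel" by measurable
  then show ?case by (simp cong: measurable_cong)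
qed (simp cong: measurable_cong)

text \<open>Change of variables along a word. The induction peels off the last letter, where
  \<open>branch\<close> and \<open>den\<close> recurse: pulling back by the first \<open>n\<close>
  letters turns the condition on digit \<open>n\<close> into one on the first digit.\<close>

lemma nn_integral_cylinder:
  assumes "f \<in> borel_measurable borel" and "\<And>i. i < n \<Longrightarrow> prime (a i)"
  shows "(\<integral>\<^sup>+x. f x * indicator {x. \<forall>i<n. digit x i = a i} x \<partial>\<mu>) =
    (\<integral>\<^sup>+x. f (branch a n x) * ennreal (den a n x powr (-2 * \<delta>)) \<partial>\<mu>)"
  using assms
proof (induction n arbitrary: f)
  case (Suc n)
  note [measurable] = Suc.prems(1)
  have a1: "1 \<le> a i" if "i \<le> n" for i using Suc.prems(2)[of i] that prime_ge_1_nat by auto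
  have "(\<integral>\<^sup>+x. f x * indicator {x. \<forall>i<Suc n. digit x i = a i} x \<partial>\<mu>)
    = (\<integral>\<^sup>+x. (f x * indicator {x. digit x n = a n} x) * indicator {x. \<forall>i<n. digit x i = a i} x \<partial>\<mu>)"
    by (intro nn_integral_cong) (auto simp: indicator_def less_Suc_eq)
  also have "\<dots> = (\<integral>\<^sup>+x. f (branch a n x) * indicator {x. digit x n = a n} (branch a n x) * ennreal (den a n x powr (-2 * \<delta>)) \<partial>\<mu>)"
    using Suc.prems by (intro Suc.IH) (auto intro!: borel_measurable_times_ennreal)
  also have "\<dots> = (\<integral>\<^sup>+x. f (branch a n x) * ennreal (den a n x powr (-2 * \<delta>)) * indicator {x. digit x 0 = a n} x \<partial>\<mu>)"
  proof (intro nn_integral_cong_AE)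
    show "AE x in \<mu>. f (branch a n x) * indicator {x. digit x n = a n} (branch a n x) * ennreal (den a n x powr (-2 * \<delta>))
      = f (branch a n x) * ennreal (den a n x powr (-2 * \<delta>)) * indicator {x. digit x 0 = a n} x"
      using AE_Lambda
    proof eventually_elim
      case (elim x)
      have "(gauss_map ^^ n) (branch a n x) = x"
        using Lambda_P_digit(4,5)[OF elim] a1 by (intro digit_branch) auto
      then have "digit (branch a n x) n = digit x 0"
        using digit_funpow[of n "branch a n x" 0] by simp
      then show ?case by (auto simp: indicator_def)
    qed
  qed
  also have "\<dots> = (\<integral>\<^sup>+x. f (branch a n (1 / (real (a n) + x))) *
      ennreal (den a n (1 / (real (a n) + x)) powr (-2 * \<delta>)) * wt (a n) x \<partial>\<mu>)"
    using Suc.prems(2) by (intro nn_integral_first_digit) auto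
  also have "\<dots> = (\<integral>\<^sup>+x. f (branch a (Suc n) x) * ennreal (den a (Suc n) x powr (-2 * \<delta>)) \<partial>\<mu>)"
  proof (intro nn_integral_cong_AE)
    show "AE x in \<mu>. f (branch a n (1 / (real (a n) + x))) *
      ennreal (den a n (1 / (real (a n) + x)) powr (-2 * \<delta>)) * wt (a n) x
      = f (branch a (Suc n) x) * ennreal (den a (Suc n) x powr (-2 * \<delta>))"
      using AE_Lambda
    proof eventually_elim
      case (elim x)
      have x: "0 < x" "x \<le> 1/2" using Lambda_P_digit(4,5)[OF elim] by auto
      have "1 \<le> den a n (1 / (real (a n) + x))"
        using den_bounds[of n a "1 / (real (a n) + x)"] inv_shift_unit[of "a n" x] x a1[of n] a1 by fastforce
      then show ?case using x a1[of n]
        by (simp add: wt_def powr_mult ennreal_mult' mult.assoc)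
    qed
  qed
  finally show ?case .
qed simp

lemma emeasure_cylinder_le:
  assumes "\<And>i. i < n \<Longrightarrow> prime (a i)" "0 \<le> \<delta>"
  shows "emeasure \<mu> {x. \<forall>i<n. digit x i = a i} \<le> ennreal (den a n 0 powr (-2 * \<delta>))"
proof -
  have a1: "1 \<le> a i" if "i < n" for i using assms(1)[of i] that prime_ge_1_nat by auto
  have "emeasure \<mu> {x. \<forall>i<n. digit x i = a i} = (\<integral>\<^sup>+x. 1 * indicator {x. \<forall>i<n. digit x i = a i} x \<partial>\<mu>)"
    by simp
  also have "\<dots> = (\<integral>\<^sup>+x. 1 * ennreal (den a n x powr (-2 * \<delta>)) \<partial>\<mu>)"
    using assms(1) by (intro nn_integral_cylinder) auto
  also have "\<dots> \<le> (\<integral>\<^sup>+x. ennreal (den a n 0 powr (-2 * \<delta>)) \<partial>\<mu>)"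
  proof (intro nn_integral_mono_AE)
    show "AE x in \<mu>. 1 * ennreal (den a n x powr (-2 * \<delta>)) \<le> ennreal (den a n 0 powr (-2 * \<delta>))"
      using AE_Lambda
    proof eventually_elim
      case (elim x)
      have "den a n 0 \<le> den a n x" "1 \<le> den a n 0"
        using den_bounds[of n a x] Lambda_P_digit(4,5)[OF elim] a1 by auto
      then show ?case using assms(2) by (auto intro!: ennreal_leI powr_mono2')
    qed
  qed
  also have "\<dots> = ennreal (den a n 0 powr (-2 * \<delta>))" by (simp add: emeasure_space_1[simplified])
  finally show ?thesis .
qed

lemma emeasure_digit_ge:
  assumes "prime p" "0 \<le> \<delta>"
  shows "ennreal ((real p + 1) powr (-2 * \<delta>)) \<le> emeasure \<mu> {x. digit x 0 = p}"
proof -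
  have "ennreal ((real p + 1) powr (-2 * \<delta>)) = (\<integral>\<^sup>+x. ennreal ((real p + 1) powr (-2 * \<delta>)) \<partial>\<mu>)"
    by (simp add: emeasure_space_1[simplified])
  also have "\<dots> \<le> (\<integral>\<^sup>+x. 1 * wt p x \<partial>\<mu>)"
  proof (intro nn_integral_mono_AE)
    show "AE x in \<mu>. ennreal ((real p + 1) powr (-2 * \<delta>)) \<le> 1 * wt p x"
      using AE_Lambda
    proof eventually_elim
      case (elim x)
      have "0 < real p + x" "real p + x \<le> real p + 1" using Lambda_P_digit(4,5)[OF elim] by auto
      then show ?case using assms(2) by (auto intro!: ennreal_leI powr_mono2' simp: wt_def)
    qed
  qed
  also have "\<dots> = (\<integral>\<^sup>+x. 1 * indicator {x. digit x 0 = p} x \<partial>\<mu>)"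
    using nn_integral_first_digit[of "\<lambda>_. 1" p] assms by simp
  finally show ?thesis by simp
qed

text \<open>Quasi-independence from below: along the word the Jacobian is at least
  \<open>2 * den a n 0\<close> to the power \<open>-2 * \<delta>\<close>, so prescribing the next
  digit contributes its mass as a first digit, up to that factor.\<close>

lemma emeasure_cylinder_ge:
  assumes "\<And>i. i < n \<Longrightarrow> prime (a i)" "0 \<le> \<delta>" "finite B" "\<And>b. b \<in> B \<Longrightarrow> prime b \<and> real b + 1 \<le> M"
  shows "ennreal ((2 * den a n 0) powr (-2 * \<delta>) * (real (card B) * M powr (-2 * \<delta>)))
    \<le> emeasure \<mu> {x. (\<forall>i<n. digit x i = a i) \<and> digit x n \<in> B}"
proof -
  have a1: "1 \<le> a i" if "i < n" for i using assms(1)[of i] that prime_ge_1_nat by auto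
  have D: "1 \<le> den a n 0" using den_bounds(3)[of n a 0] a1 by auto
  have "ennreal (real (card B) * M powr (-2 * \<delta>)) = (\<Sum>b\<in>B. ennreal (M powr (-2 * \<delta>)))"
    by (simp add: ennreal_mult' ennreal_of_nat_eq_real_of_nat)
  also have "\<dots> \<le> (\<Sum>b\<in>B. ennreal ((real b + 1) powr (-2 * \<delta>)))"
    using assms(2,4) by (intro sum_mono ennreal_leI powr_mono2') auto
  also have "\<dots> \<le> (\<Sum>b\<in>B. emeasure \<mu> {x. digit x 0 = b})"
    using assms(2,4) by (intro sum_mono emeasure_digit_ge) auto
  also have "\<dots> = emeasure \<mu> (\<Union>b\<in>B. {x. digit x 0 = b})"
    using assms(3) by (intro sum_emeasure) (auto simp: disjoint_family_on_def)
  also have "(\<Union>b\<in>B. {x. digit x 0 = b}) = {x. digit x 0 \<in> B}" by auto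
  finally have B: "ennreal (real (card B) * M powr (-2 * \<delta>)) \<le> emeasure \<mu> {x. digit x 0 \<in> B}" .
  have "ennreal ((2 * den a n 0) powr (-2 * \<delta>) * (real (card B) * M powr (-2 * \<delta>)))
    \<le> ennreal ((2 * den a n 0) powr (-2 * \<delta>)) * emeasure \<mu> {x. digit x 0 \<in> B}"
    using B by (subst ennreal_mult) (auto intro!: mult_left_mono)
  also have "\<dots> = (\<integral>\<^sup>+x. ennreal ((2 * den a n 0) powr (-2 * \<delta>)) * indicator {x. digit x 0 \<in> B} x \<partial>\<mu>)"
    by (simp add: nn_integral_cmult)
  also have "\<dots> \<le> (\<integral>\<^sup>+x. indicator {x. digit x n \<in> B} (branch a n x) * ennreal (den a n x powr (-2 * \<delta>)) \<partial>\<mu>)"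
  proof (intro nn_integral_mono_AE)
    show "AE x in \<mu>. ennreal ((2 * den a n 0) powr (-2 * \<delta>)) * indicator {x. digit x 0 \<in> B} x
      \<le> indicator {x. digit x n \<in> B} (branch a n x) * ennreal (den a n x powr (-2 * \<delta>))"
      using AE_Lambda
    proof eventually_elim
      case (elim x)
      have x: "0 < x" "x \<le> 1/2" using Lambda_P_digit(4,5)[OF elim] by auto
      have "(gauss_map ^^ n) (branch a n x) = x" using x a1 by (intro digit_branch) auto
      then have d: "digit (branch a n x) n = digit x 0"
        using digit_funpow[of n "branch a n x" 0] by simp
      have "den a n 0 \<le> den a n x" "den a n x \<le> 2 * den a n 0"
        using den_bounds[of n a x] x a1 by auto
      then have "ennreal ((2 * den a n 0) powr (-2 * \<delta>)) \<le> ennreal (den a n x powr (-2 * \<delta>))"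
        using assms(2) D by (intro ennreal_leI powr_mono2') auto
      then show ?case by (auto simp: indicator_def d)
    qed
  qed
  also have "\<dots> = (\<integral>\<^sup>+x. indicator {x. digit x n \<in> B} x * indicator {x. \<forall>i<n. digit x i = a i} x \<partial>\<mu>)"
    using assms(1) by (intro nn_integral_cylinder[symmetric]) auto
  also have "\<dots> = (\<integral>\<^sup>+x. indicator {x. (\<forall>i<n. digit x i = a i) \<and> digit x n \<in> B} x \<partial>\<mu>)"
    by (intro nn_integral_cong) (auto simp: indicator_def)
  also have "\<dots> = emeasure \<mu> {x. (\<forall>i<n. digit x i = a i) \<and> digit x n \<in> B}" by simp
  finally show ?thesis .
qed


text \<open>If \<open>\<delta> \<le> 1/2\<close>, the branch of \<open>q\<close> carries mass at
  least \<open>1 / (q + 1/2)\<close>, thanks to \<open>x \<le> 1/2\<close> on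
  \<open>Lambda_P\<close>. The primes 2, 3, 5, 7 alone then give \<open>1156/1155\<close>, more than
  the total mass \<open>1\<close>.\<close>

lemma delta_gt_half: "1/2 < \<delta>"
proof (rule ccontr)
  assume "\<not> ?thesis"
  then have d: "-1 \<le> -2 * \<delta>" by simp
  have "ennreal (1 / (real q + 1/2)) \<le> (\<integral>\<^sup>+x. wt q x \<partial>\<mu>)" if "2 \<le> q" for q
  proof -
    have "ennreal (1 / (real q + 1/2)) = (\<integral>\<^sup>+x. ennreal (1 / (real q + 1/2)) \<partial>\<mu>)"
      by (simp add: emeasure_space_1[simplified])
    also have "\<dots> \<le> (\<integral>\<^sup>+x. wt q x \<partial>\<mu>)"
    proof (intro nn_integral_mono_AE)
      show "AE x in \<mu>. ennreal (1 / (real q + 1/2)) \<le> wt q x"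
        using AE_Lambda
      proof eventually_elim
        case (elim x)
        have x: "0 < x" "x \<le> 1/2" using Lambda_P_digit(4,5)[OF elim] by auto
        have "1 / (real q + 1/2) \<le> 1 / (real q + x)" using x by (intro divide_left_mono mult_pos_pos) auto
        also have "\<dots> = (real q + x) powr (-1)" using x that by (simp add: powr_minus_divide)
        also have "\<dots> \<le> (real q + x) powr (-2 * \<delta>)" using x that d by (intro powr_mono) auto
        finally show ?case by (simp add: wt_def ennreal_leI)
      qed
    qed
    finally show ?thesis .
  qed
  note wt_ge = this
  have "ennreal (1/(2+1/2) + 1/(3+1/2) + 1/(5+1/2) + 1/(7+1/2))
      = (\<Sum>q\<in>{2,3,5,7::nat}. ennreal (1 / (real q + 1/2)))"
    by (simp flip: ennreal_plus)
  also have "\<dots> \<le> (\<Sum>q\<in>{2,3,5,7}. \<integral>\<^sup>+x. wt q x \<partial>\<mu>)"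
    by (intro sum_mono wt_ge) auto
  also have "\<dots> = (\<Sum>q\<in>{2,3,5,7}. if prime q then \<integral>\<^sup>+x. 1 * wt q x \<partial>\<mu> else 0)"
  proof (intro sum.cong refl)
    fix q :: nat assume "q \<in> {2,3,5,7}"
    moreover have "prime (2::nat)" "prime (3::nat)" "prime (5::nat)" "prime (7::nat)" by simp_all
    ultimately show "(\<integral>\<^sup>+x. wt q x \<partial>\<mu>) = (if prime q then \<integral>\<^sup>+x. 1 * wt q x \<partial>\<mu> else 0)" by auto
  qed
  also have "\<dots> \<le> (\<Sum>q. if prime q then \<integral>\<^sup>+x. 1 * wt q x \<partial>\<mu> else 0)"
    by (intro sum_le_suminf summableI) auto
  also have "\<dots> = (\<integral>\<^sup>+x. 1 \<partial>\<mu>)" by (intro nn_integral_conformal[symmetric]) auto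
  also have "\<dots> = ennreal 1" by (simp add: emeasure_space_1[simplified])
  finally show False by (subst (asm) ennreal_le_iff) auto
qed

text \<open>\<open>q\<^sup>-\<^sup>2 \<le> 1/(q - 1/2) - 1/(q + 1/2)\<close> telescopes from \<open>q = 2\<close> to \<open>2/3 < 1\<close>.\<close>

lemma delta_le_1: "\<delta> \<le> 1"
proof (rule ccontr)
  assume d: "\<not> ?thesis"
  \<comment> \<open>The \<open>max\<close> freezes \<open>F\<close> up to \<open>2\<close>, so the
    terms \<open>q = 0\<close> and \<open>q = 1\<close> vanish and the series telescopes to
    \<open>- F 0\<close>, which is \<open>2/3\<close>.\<close>
  define F where "F n = - (1 / (max (real n) 2 - 1/2))" for n :: nat
  have F0: "F \<longlonglongrightarrow> 0"
  proof -
    have "(\<lambda>n. - (1 / (real n - 1/2))) \<longlonglongrightarrow> 0"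
      by real_asymp
    moreover have "eventually (\<lambda>n. - (1 / (real n - 1/2)) = F n) sequentially"
      using eventually_ge_at_top[of 2] by eventually_elim (auto simp: F_def max_def)
    ultimately show ?thesis by (rule Lim_transform_eventually)
  qed
  have Fpos: "0 \<le> F (Suc n) - F n" for n
  proof -
    have "2 \<le> max (real n) 2" "max (real n) 2 \<le> max (real (Suc n)) 2" by auto
    then have "1 / (max (real (Suc n)) 2 - 1/2) \<le> 1 / (max (real n) 2 - 1/2)"
      by (intro divide_left_mono mult_pos_pos; linarith)
    then show ?thesis by (simp add: F_def)
  qed
  have "ennreal 1 = (\<integral>\<^sup>+x. 1 \<partial>\<mu>)" by (simp add: emeasure_space_1[simplified])
  also have "\<dots> = (\<Sum>q. if prime q then \<integral>\<^sup>+x. 1 * wt q x \<partial>\<mu> else 0)"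
    by (intro nn_integral_conformal) auto
  also have "\<dots> \<le> (\<Sum>q. ennreal (F (Suc q) - F q))"
  proof (intro suminf_le summableI)
    fix q
    show "(if prime q then \<integral>\<^sup>+x. 1 * wt q x \<partial>\<mu> else 0) \<le> ennreal (F (Suc q) - F q)"
    proof (cases "prime q")
      case True
      then have q: "2 \<le> q" by (rule prime_ge_2_nat)
      have "(\<integral>\<^sup>+x. 1 * wt q x \<partial>\<mu>) \<le> (\<integral>\<^sup>+x. ennreal (F (Suc q) - F q) \<partial>\<mu>)"
      proof (intro nn_integral_mono_AE)
        show "AE x in \<mu>. 1 * wt q x \<le> ennreal (F (Suc q) - F q)"
          using AE_Lambda
        proof eventually_elim
          case (elim x)
          have x: "0 < x" "x \<le> 1/2" using Lambda_P_digit(4,5)[OF elim] by auto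
          have "(real q + x) powr (-2 * \<delta>) \<le> (real q + x) powr (-2)"
            using x q d by (intro powr_mono) auto
          also have "\<dots> \<le> real q powr (-2)" using x q by (intro powr_mono2') auto
          also have "\<dots> = 1 / (real q)\<^sup>2" using q by (simp add: powr_minus_divide powr_numeral)
          also have "\<dots> \<le> 1 / ((real q - 1/2) * (real q + 1/2))"
          proof (rule divide_left_mono)
            show "(real q - 1/2) * (real q + 1/2) \<le> (real q)\<^sup>2" by (simp add: power2_eq_square algebra_simps)
            show "0 < (real q)\<^sup>2 * ((real q - 1/2) * (real q + 1/2))" using q by (intro mult_pos_pos) auto
          qed simp
          also have "\<dots> = F (Suc q) - F q" using q by (simp add: F_def max_def field_simps)
          finally show ?case by (simp add: wt_def ennreal_leI)
        qed
      qed
      then show ?thesis using True by (simp add: emeasure_space_1[simplified])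
    qed simp
  qed
  also have "\<dots> = ennreal (0 - F 0)"
    using Fpos telescope_sums[OF F0] by (rule suminf_ennreal_eq)
  finally show False by (subst (asm) ennreal_le_iff) (auto simp: F_def)
qed

lemma delta_pos: "0 < \<delta>"
  using delta_gt_half by simp

text \<open>The transfer operator restricted to digits in \<open>S\<close>, iterated on the constant
  \<open>1\<close>. By \<open>nn_integral_itinerary\<close> this is the density with respect to
  \<open>\<mu>\<close> of the image, under the \<open>n\<close>-th Gauss iterate, of
  \<open>\<mu>\<close> restricted to the points whose first \<open>n\<close> digits lie in
  \<open>S\<close>. Taking all primes for \<open>S\<close> gives the law of the \<open>n\<close>-th
  tail; leaving out one prime describes avoiding it.\<close>

primrec trans_iter :: "nat set \<Rightarrow> nat \<Rightarrow> real \<Rightarrow> ennreal" where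
  "trans_iter S 0 x = 1"
| "trans_iter S (Suc n) x = (\<Sum>q. if q \<in> S then trans_iter S n (1 / (real q + x)) * wt q x else 0)"

lemma trans_iter_measurable [measurable]: "trans_iter S n \<in> borel_measurable borel"
proof (induction n)
  case (Suc n)
  then have [measurable]: "trans_iter S n \<in> borel_measurable borel" .
  have "(\<lambda>x. \<Sum>q. if q \<in> S then trans_iter S n (1 / (real q + x)) * wt q x else 0) \<in> borel_measurable borel"
    by measurable
  then show ?case by (simp cong: measurable_cong)
qed (simp cong: measurable_cong)

text \<open>Duality: composition with the Gauss map on one factor becomes the transfer operator on
  the other, because \<open>gauss_map\<close> undoes each branch and the first digit names the
  branch.\<close>

lemma nn_integral_transfer:
  assumes S: "S \<subseteq> {q. prime q}"
    and [measurable]: "f \<in> borel_measurable borel" "g \<in> borel_measurable borel"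
  shows "(\<integral>\<^sup>+x. f (gauss_map x) * g x * indicator {x. digit x 0 \<in> S} x \<partial>\<mu>) =
    (\<integral>\<^sup>+x. f x * (\<Sum>q. if q \<in> S then g (1 / (real q + x)) * wt q x else 0) \<partial>\<mu>)"
proof -
  have "(\<integral>\<^sup>+x. f (gauss_map x) * g x * indicator {x. digit x 0 \<in> S} x \<partial>\<mu>) =
    (\<Sum>q. if prime q then \<integral>\<^sup>+x. f (gauss_map (1 / (real q + x))) * g (1 / (real q + x)) *
      indicator {x. digit x 0 \<in> S} (1 / (real q + x)) * wt q x \<partial>\<mu> else 0)"
    by (intro nn_integral_conformal) measurable
  also have "\<dots> = (\<Sum>q. \<integral>\<^sup>+x. f x * (if q \<in> S then g (1 / (real q + x)) * wt q x else 0) \<partial>\<mu>)"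
  proof (intro suminf_cong)
    fix q
    have "(\<integral>\<^sup>+x. f (gauss_map (1 / (real q + x))) * g (1 / (real q + x)) *
      indicator {x. digit x 0 \<in> S} (1 / (real q + x)) * wt q x \<partial>\<mu>)
      = (\<integral>\<^sup>+x. f x * (if q \<in> S then g (1 / (real q + x)) * wt q x else 0) \<partial>\<mu>)"
    proof (intro nn_integral_cong_AE)
      show "AE x in \<mu>. f (gauss_map (1 / (real q + x))) * g (1 / (real q + x)) *
          indicator {x. digit x 0 \<in> S} (1 / (real q + x)) * wt q x
        = f x * (if q \<in> S then g (1 / (real q + x)) * wt q x else 0)"
        using AE_Lambda
      proof eventually_elim
        case (elim x)
        then show ?case using Lambda_P_digit(4,5)[OF elim] gauss_digit[of x q]
          by (auto simp: indicator_def mult.assoc)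
      qed
    qed
    then show "(if prime q then \<integral>\<^sup>+x. f (gauss_map (1 / (real q + x))) * g (1 / (real q + x)) *
      indicator {x. digit x 0 \<in> S} (1 / (real q + x)) * wt q x \<partial>\<mu> else 0)
      = (\<integral>\<^sup>+x. f x * (if q \<in> S then g (1 / (real q + x)) * wt q x else 0) \<partial>\<mu>)"
      using S by (cases "q \<in> S") auto
  qed
  also have "\<dots> = (\<integral>\<^sup>+x. (\<Sum>q. f x * (if q \<in> S then g (1 / (real q + x)) * wt q x else 0)) \<partial>\<mu>)"
    by (intro nn_integral_suminf[symmetric]) measurable
  also have "\<dots> = (\<integral>\<^sup>+x. f x * (\<Sum>q. if q \<in> S then g (1 / (real q + x)) * wt q x else 0) \<partial>\<mu>)"
    by (simp only: ennreal_suminf_cmult)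
  finally show ?thesis .
qed

lemma nn_integral_itinerary:
  assumes S: "S \<subseteq> {q. prime q}" and "f \<in> borel_measurable borel"
  shows "(\<integral>\<^sup>+x. f ((gauss_map ^^ n) x) * indicator {x. \<forall>i<n. digit x i \<in> S} x \<partial>\<mu>) =
    (\<integral>\<^sup>+x. f x * trans_iter S n x \<partial>\<mu>)"
  using assms(2)
proof (induction n arbitrary: f)
  case (Suc n)
  note [measurable] = Suc.prems
  define h where "h x = f (gauss_map x) * indicator {x. digit x 0 \<in> S} x" for x
  have [measurable]: "h \<in> borel_measurable borel" unfolding h_def by measurable
  have "(\<integral>\<^sup>+x. f ((gauss_map ^^ Suc n) x) * indicator {x. \<forall>i<Suc n. digit x i \<in> S} x \<partial>\<mu>)
    = (\<integral>\<^sup>+x. h ((gauss_map ^^ n) x) * indicator {x. \<forall>i<n. digit x i \<in> S} x \<partial>\<mu>)"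
    using digit_funpow[of n _ 0]
    by (intro nn_integral_cong) (auto simp: indicator_def less_Suc_eq h_def)
  also have "\<dots> = (\<integral>\<^sup>+x. h x * trans_iter S n x \<partial>\<mu>)" by (rule Suc.IH) measurable
  also have "\<dots> = (\<integral>\<^sup>+x. f (gauss_map x) * trans_iter S n x * indicator {x. digit x 0 \<in> S} x \<partial>\<mu>)"
    by (simp add: h_def mult_ac)
  also have "\<dots> = (\<integral>\<^sup>+x. f x * trans_iter S (Suc n) x \<partial>\<mu>)"
    unfolding trans_iter.simps by (intro nn_integral_transfer S) measurable
  finally show ?case .
qed simp

text \<open>The transfer operator preserves the cone of functions \<open>g\<close> such that \<open>g\<close> is decreasing and
  \<open>(1 + x) powr (2 * \<delta>) * g x\<close> is increasing; such functions satisfy a Harnack inequality on the unit interval.\<close>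

lemma trans_iter_cone:
  assumes S: "S \<subseteq> {q. prime q}" and "0 \<le> x" "x \<le> y" "y \<le> 1"
  shows "trans_iter S n y \<le> trans_iter S n x \<and>
    ennreal ((1 + x) powr (2 * \<delta>)) * trans_iter S n x \<le> ennreal ((1 + y) powr (2 * \<delta>)) * trans_iter S n y"
  using assms(2-)
proof (induction n arbitrary: x y)
  case 0
  then have "(1 + x) powr (2 * \<delta>) \<le> (1 + y) powr (2 * \<delta>)"
    using delta_pos by (intro powr_mono2) auto
  then show ?case by (simp add: ennreal_leI)
next
  case (Suc n)
  have *: "trans_iter S n (1 / (real q + y)) * wt q y \<le> trans_iter S n (1 / (real q + x)) * wt q x"
    "ennreal ((1 + x) powr (2 * \<delta>)) * (trans_iter S n (1 / (real q + x)) * wt q x)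
      \<le> ennreal ((1 + y) powr (2 * \<delta>)) * (trans_iter S n (1 / (real q + y)) * wt q y)"
    if "q \<in> S" for q
  proof -
    have "prime q" using that S by auto
    then have q: "2 \<le> real q" using prime_ge_2_nat[of q] by simp
    \<comment> \<open>Inversion reverses the order, so each of the two cone conditions at stage
      \<open>n\<close> yields the other one at stage \<open>Suc n\<close>.\<close>
    define u v where "u = 1 / (real q + x)" and "v = 1 / (real q + y)"
    have uv: "0 < v" "v \<le> u" "u \<le> 1"
      unfolding u_def v_def using Suc.prems q by (auto intro!: divide_left_mono mult_pos_pos)
    note IH = Suc.IH[of v u]
    \<comment> \<open>Splits off the power of \<open>1 + 1 / (q + z)\<close> that the weighted
      condition at the inverted point asks for; the remaining factor decreases in
      \<open>z\<close>.\<close>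
    have w: "wt q z = ennreal ((1 + 1 / (real q + z)) powr (2 * \<delta>)) * ennreal ((real q + z + 1) powr (-2 * \<delta>))"
      if "0 \<le> z" for z
    proof -
      have "(real q + z) powr (-2 * \<delta>) = ((1 + 1 / (real q + z)) / (real q + z + 1)) powr (2 * \<delta>)"
      proof -
        have t: "0 < real q + z" using q that by simp
        then have "1 + 1 / (real q + z) = (real q + z + 1) / (real q + z)"
          by (simp add: add_divide_distrib)
        then have "(1 + 1 / (real q + z)) / (real q + z + 1) = inverse (real q + z)"
          using t by (simp add: inverse_eq_divide)
        moreover have "inverse (real q + z) powr (2 * \<delta>) = (real q + z) powr - (2 * \<delta>)"
          using t by (simp add: powr_minus inverse_powr)
        ultimately show ?thesis by simp
      qed
      also have "\<dots> = (1 + 1 / (real q + z)) powr (2 * \<delta>) * (real q + z + 1) powr (-2 * \<delta>)"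
        using q that by (simp add: powr_divide powr_minus_divide)
      finally show ?thesis unfolding wt_def by (simp add: ennreal_mult')
    qed
    show "trans_iter S n (1 / (real q + y)) * wt q y \<le> trans_iter S n (1 / (real q + x)) * wt q x"
    proof -
      have "trans_iter S n v * wt q y = (ennreal ((1 + v) powr (2 * \<delta>)) * trans_iter S n v) * ennreal ((real q + y + 1) powr (-2 * \<delta>))"
        using Suc.prems by (subst w) (auto simp: v_def mult_ac)
      also have "\<dots> \<le> (ennreal ((1 + u) powr (2 * \<delta>)) * trans_iter S n u) * ennreal ((real q + x + 1) powr (-2 * \<delta>))"
      proof (rule mult_mono)
        show "ennreal ((real q + y + 1) powr (-2 * \<delta>)) \<le> ennreal ((real q + x + 1) powr (-2 * \<delta>))"
          using Suc.prems delta_pos by (intro ennreal_leI powr_mono2') auto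
      qed (use IH uv in auto)
      also have "\<dots> = trans_iter S n u * wt q x"
        using Suc.prems by (subst w) (auto simp: u_def mult_ac)
      finally show ?thesis by (simp add: u_def v_def)
    qed
    show "ennreal ((1 + x) powr (2 * \<delta>)) * (trans_iter S n (1 / (real q + x)) * wt q x)
      \<le> ennreal ((1 + y) powr (2 * \<delta>)) * (trans_iter S n (1 / (real q + y)) * wt q y)"
    proof -
      have r: "ennreal ((1 + z) powr (2 * \<delta>)) * wt q z = ennreal (((1 + z) / (real q + z)) powr (2 * \<delta>))"
        if "0 \<le> z" for z
        unfolding wt_def using q that by (simp add: powr_divide powr_minus_divide flip: ennreal_mult')
      have "(1 + x) / (real q + x) \<le> (1 + y) / (real q + y)"
      proof -
        have "(y - x) * 1 \<le> (y - x) * real q" using Suc.prems q by (intro mult_left_mono) auto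
        then have "(1 + x) * (real q + y) \<le> (1 + y) * (real q + x)" by (simp add: algebra_simps)
        then show ?thesis using Suc.prems q by (simp add: divide_simps)
      qed
      then have "trans_iter S n u * ennreal (((1 + x) / (real q + x)) powr (2 * \<delta>)) \<le>
        trans_iter S n v * ennreal (((1 + y) / (real q + y)) powr (2 * \<delta>))"
      proof (intro mult_mono ennreal_leI powr_mono2)
        show "trans_iter S n u \<le> trans_iter S n v" using IH uv by auto
      qed (use Suc.prems delta_pos q in auto)
      moreover have "0 \<le> x" "0 \<le> y" using Suc.prems by auto
      ultimately have "trans_iter S n u * (ennreal ((1 + x) powr (2 * \<delta>)) * wt q x) \<le>
        trans_iter S n v * (ennreal ((1 + y) powr (2 * \<delta>)) * wt q y)"
        by (simp only: r)
      then show ?thesis by (simp only: u_def v_def mult_ac)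
    qed
  qed
  show ?case
    unfolding trans_iter.simps ennreal_suminf_cmult[symmetric]
    using * by (intro conjI suminf_le summableI) simp_all
qed

text \<open>The two points are compared through \<open>0\<close>, where functions of the cone are
  largest; the weight changes by at most \<open>2 powr (2 * \<delta>)\<close> over the
  interval.\<close>

lemma trans_iter_harnack:
  assumes S: "S \<subseteq> {q. prime q}" and "0 \<le> x" "x \<le> 1" "0 \<le> y" "y \<le> 1"
  shows "trans_iter S n x \<le> ennreal (4 powr \<delta>) * trans_iter S n y"
proof -
  have "trans_iter S n x \<le> trans_iter S n 0" using trans_iter_cone[of S 0 x n] assms by auto
  also have "\<dots> \<le> ennreal ((1 + y) powr (2 * \<delta>)) * trans_iter S n y"
    using trans_iter_cone[of S 0 y n] assms by auto
  also have "\<dots> \<le> ennreal (2 powr (2 * \<delta>)) * trans_iter S n y"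
    using assms delta_pos by (intro mult_right_mono ennreal_leI powr_mono2) auto
  also have "(2::real) powr (2 * \<delta>) = 4 powr \<delta>" by (simp add: powr_numeral flip: powr_powr)
  finally show ?thesis .
qed

lemma emeasure_itinerary:
  assumes "S \<subseteq> {q. prime q}"
  shows "emeasure \<mu> {x. \<forall>i<n. digit x i \<in> S} = (\<integral>\<^sup>+x. trans_iter S n x \<partial>\<mu>)"
  using nn_integral_itinerary[OF assms, of "\<lambda>_. 1" n] by simp

text \<open>Stand-in for invariance. The density of the \<open>n\<close>-th tail has integral at
  most \<open>1\<close>, so the Harnack inequality bounds it by \<open>4 powr \<delta>\<close> on
  \<open>Lambda_P\<close>.\<close>

lemma emeasure_digit_le:
  "emeasure \<mu> {x. digit x n \<in> B} \<le> ennreal (4 powr \<delta>) * emeasure \<mu> {x. digit x 0 \<in> B}"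
proof -
  let ?S = "{q::nat. prime q}"
  have le: "trans_iter ?S n x \<le> ennreal (4 powr \<delta>)" if x: "x \<in> Lambda_P" for x
  proof -
    have "trans_iter ?S n x = (\<integral>\<^sup>+y. trans_iter ?S n x \<partial>\<mu>)" by (simp add: emeasure_space_1[simplified])
    also have "\<dots> \<le> (\<integral>\<^sup>+y. ennreal (4 powr \<delta>) * trans_iter ?S n y \<partial>\<mu>)"
    proof (intro nn_integral_mono_AE)
      show "AE y in \<mu>. trans_iter ?S n x \<le> ennreal (4 powr \<delta>) * trans_iter ?S n y"
        using AE_Lambda
      proof eventually_elim
        case (elim y)
        show ?case using Lambda_P_digit(4,5)[OF elim] Lambda_P_digit(4,5)[OF x]
          by (intro trans_iter_harnack) auto
      qed
    qed
    also have "\<dots> = ennreal (4 powr \<delta>) * emeasure \<mu> {x. \<forall>i<n. digit x i \<in> ?S}"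
      using emeasure_itinerary[of ?S n] by (simp add: nn_integral_cmult)
    also have "\<dots> \<le> ennreal (4 powr \<delta>) * 1" by (intro mult_left_mono emeasure_le_1) auto
    finally show ?thesis by simp
  qed
  have "emeasure \<mu> {x. digit x n \<in> B} = (\<integral>\<^sup>+x. indicator {x. digit x n \<in> B} x \<partial>\<mu>)" by simp
  also have "\<dots> = (\<integral>\<^sup>+x. indicator {x. digit x 0 \<in> B} ((gauss_map ^^ n) x) * indicator {x. \<forall>i<n. digit x i \<in> ?S} x \<partial>\<mu>)"
  proof (intro nn_integral_cong_AE)
    show "AE x in \<mu>. indicator {x. digit x n \<in> B} x =
      (indicator {x. digit x 0 \<in> B} ((gauss_map ^^ n) x) * indicator {x. \<forall>i<n. digit x i \<in> ?S} x :: ennreal)"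
      using AE_Lambda
    proof eventually_elim
      case (elim x)
      then show ?case using digit_funpow[of n x 0] Lambda_P_digit(1)[OF elim] by (auto simp: indicator_def)
    qed
  qed
  also have "\<dots> = (\<integral>\<^sup>+x. indicator {x. digit x 0 \<in> B} x * trans_iter ?S n x \<partial>\<mu>)"
    by (intro nn_integral_itinerary) auto
  also have "\<dots> \<le> (\<integral>\<^sup>+x. ennreal (4 powr \<delta>) * indicator {x. digit x 0 \<in> B} x \<partial>\<mu>)"
  proof (intro nn_integral_mono_AE)
    show "AE x in \<mu>. indicator {x. digit x 0 \<in> B} x * trans_iter ?S n x \<le> ennreal (4 powr \<delta>) * indicator {x. digit x 0 \<in> B} x"
      using AE_Lambda by eventually_elim (auto simp: indicator_def le)
  qed
  also have "\<dots> = ennreal (4 powr \<delta>) * emeasure \<mu> {x. digit x 0 \<in> B}" by (simp add: nn_integral_cmult)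
  finally show ?thesis .
qed

text \<open>Stand-in for independence. By the Harnack inequality the density of the mass that has
  avoided \<open>p\<close> is everywhere on \<open>Lambda_P\<close> at least
  \<open>4 powr - \<delta>\<close> times its integral, so a fraction of at least \<open>c\<close> of
  that mass meets \<open>p\<close> next. Iterating with \<open>1 - c \<le> exp (- c)\<close> gives
  the exponential.\<close>

lemma measure_digit_avoid_le:
  assumes p: "prime p"
  shows "measure \<mu> {x. \<forall>i<n. digit x i \<in> {q. prime q \<and> q \<noteq> p}}
    \<le> exp (- (4 powr - \<delta> * (real p + 1) powr (-2 * \<delta>)) * real n)"
proof -
  let ?S = "{q. prime q \<and> q \<noteq> p}"
  define m where "m n = emeasure \<mu> {x. \<forall>i<n. digit x i \<in> ?S}" for n
  define M where "M n = measure \<mu> {x. \<forall>i<n. digit x i \<in> ?S}" for n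
  define c where "c = 4 powr - \<delta> * (real p + 1) powr (-2 * \<delta>)"
  have c0: "0 \<le> c" unfolding c_def by simp
  have m: "m n = (\<integral>\<^sup>+x. trans_iter ?S n x \<partial>\<mu>)" for n unfolding m_def by (intro emeasure_itinerary) auto
  have mM: "m n = ennreal (M n)" for n unfolding m_def M_def by (rule emeasure_eq_measure)
  have M0: "0 \<le> M n" for n unfolding M_def by simp
  have low: "ennreal (4 powr - \<delta>) * m n \<le> trans_iter ?S n x" if x: "x \<in> Lambda_P" for x n
  proof -
    have "m n \<le> (\<integral>\<^sup>+y. ennreal (4 powr \<delta>) * trans_iter ?S n x \<partial>\<mu>)"
      unfolding m
    proof (intro nn_integral_mono_AE)
      show "AE y in \<mu>. trans_iter ?S n y \<le> ennreal (4 powr \<delta>) * trans_iter ?S n x"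
        using AE_Lambda
      proof eventually_elim
        case (elim y)
        show ?case using Lambda_P_digit(4,5)[OF elim] Lambda_P_digit(4,5)[OF x]
          by (intro trans_iter_harnack) auto
      qed
    qed
    also have "\<dots> = ennreal (4 powr \<delta>) * trans_iter ?S n x" by (simp add: emeasure_space_1[simplified])
    finally have "ennreal (4 powr - \<delta>) * m n \<le> ennreal (4 powr - \<delta>) * (ennreal (4 powr \<delta>) * trans_iter ?S n x)"
      by (intro mult_left_mono) auto
    also have "\<dots> = trans_iter ?S n x"
      by (simp add: mult.assoc[symmetric] powr_minus field_simps flip: ennreal_mult')
    finally show ?thesis .
  qed
  have step: "M (Suc n) + c * M n \<le> M n" for n
  proof -
    have "m (Suc n) = (\<integral>\<^sup>+x. indicator {x. digit x 0 \<in> ?S} ((gauss_map ^^ n) x) * indicator {x. \<forall>i<n. digit x i \<in> ?S} x \<partial>\<mu>)"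
    proof -
      have "m (Suc n) = (\<integral>\<^sup>+x. indicator {x. \<forall>i<Suc n. digit x i \<in> ?S} x \<partial>\<mu>)" by (simp add: m_def)
      also have "\<dots> = (\<integral>\<^sup>+x. indicator {x. digit x 0 \<in> ?S} ((gauss_map ^^ n) x) * indicator {x. \<forall>i<n. digit x i \<in> ?S} x \<partial>\<mu>)"
        using digit_funpow[of n _ 0] by (intro nn_integral_cong) (auto simp: indicator_def less_Suc_eq)
      finally show ?thesis .
    qed
    also have "\<dots> = (\<integral>\<^sup>+x. indicator {x. digit x 0 \<in> ?S} x * trans_iter ?S n x \<partial>\<mu>)"
      by (intro nn_integral_itinerary) auto
    finally have 1: "m (Suc n) = (\<integral>\<^sup>+x. indicator {x. digit x 0 \<in> ?S} x * trans_iter ?S n x \<partial>\<mu>)" .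
    have "ennreal c * m n \<le> ennreal (4 powr - \<delta>) * m n * emeasure \<mu> {x. digit x 0 = p}"
    proof -
      have "ennreal c * m n = ennreal (4 powr - \<delta>) * m n * ennreal ((real p + 1) powr (-2 * \<delta>))"
        unfolding c_def by (simp add: ennreal_mult' mult_ac)
      also have "\<dots> \<le> ennreal (4 powr - \<delta>) * m n * emeasure \<mu> {x. digit x 0 = p}"
        using delta_pos p by (intro mult_left_mono emeasure_digit_ge) auto
      finally show ?thesis .
    qed
    also have "\<dots> = (\<integral>\<^sup>+x. ennreal (4 powr - \<delta>) * m n * indicator {x. digit x 0 = p} x \<partial>\<mu>)"
      by (simp add: nn_integral_cmult)
    also have "\<dots> \<le> (\<integral>\<^sup>+x. indicator {x. digit x 0 = p} x * trans_iter ?S n x \<partial>\<mu>)"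
    proof (intro nn_integral_mono_AE)
      show "AE x in \<mu>. ennreal (4 powr - \<delta>) * m n * indicator {x. digit x 0 = p} x
        \<le> indicator {x. digit x 0 = p} x * trans_iter ?S n x"
        using AE_Lambda by eventually_elim (auto simp: indicator_def low)
    qed
    finally have "m (Suc n) + ennreal c * m n \<le> (\<integral>\<^sup>+x. indicator {x. digit x 0 \<in> ?S} x * trans_iter ?S n x
        + indicator {x. digit x 0 = p} x * trans_iter ?S n x \<partial>\<mu>)"
      unfolding 1 by (subst nn_integral_add) (auto intro!: add_left_mono)
    also have "\<dots> \<le> (\<integral>\<^sup>+x. trans_iter ?S n x \<partial>\<mu>)"
      by (intro nn_integral_mono) (auto simp: indicator_def)
    finally have "ennreal (M (Suc n) + c * M n) \<le> ennreal (M n)"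
      using c0 M0 by (simp add: mM m[symmetric] ennreal_mult)
    then show ?thesis using M0 by (subst (asm) ennreal_le_iff) auto
  qed
  have "M n \<le> exp (- c * real n)" for n
  proof (induction n)
    case 0
    then show ?case by (simp add: M_def)
  next
    case (Suc n)
    have "M (Suc n) \<le> (1 - c) * M n" using step[of n] by (simp add: algebra_simps)
    also have "\<dots> \<le> exp (- c) * M n" using exp_ge_add_one_self[of "-c"] M0 by (intro mult_right_mono) auto
    also have "\<dots> \<le> exp (- c) * exp (- c * real n)" using Suc by (intro mult_left_mono) auto
    also have "\<dots> = exp (- c * real (Suc n))" by (simp add: exp_add[symmetric] algebra_simps)
    finally show ?case .
  qed
  then show ?thesis unfolding M_def c_def .
qed

text \<open>The exponent splits as \<open>2 * \<delta> = \<eta> + (1 + \<eta>)\<close> with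
  \<open>\<eta> = \<delta> - 1/2\<close>: the first part gives the decay in \<open>N\<close>, the
  second makes the series over all integers converge.\<close>

lemma emeasure_first_digit_tail:
  "\<exists>C\<ge>0. \<forall>N\<ge>1. emeasure \<mu> {x. digit x 0 > N} \<le> ennreal (C * real N powr - (\<delta> - 1/2))"
proof -
  define \<eta> where "\<eta> = \<delta> - 1/2"
  have eta: "0 < \<eta>" using delta_gt_half by (simp add: \<eta>_def)
  define C where "C = (\<Sum>q. real q powr (-(1 + \<eta>)))"
  have sm: "summable (\<lambda>q. real q powr (-(1 + \<eta>)))" using eta by (simp add: summable_real_powr_iff)
  have C0: "0 \<le> C" unfolding C_def using sm by (intro suminf_nonneg) auto
  have "emeasure \<mu> {x. digit x 0 > N} \<le> ennreal (C * real N powr - \<eta>)" if N: "N \<ge> 1" for N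
  proof -
    have "emeasure \<mu> {x. digit x 0 > N} = (\<integral>\<^sup>+x. indicator {x. digit x 0 > N} x \<partial>\<mu>)" by simp
    also have "\<dots> = (\<Sum>q. if prime q then \<integral>\<^sup>+x. indicator {x. digit x 0 > N} (1 / (real q + x)) * wt q x \<partial>\<mu> else 0)"
      by (intro nn_integral_conformal) auto
    also have "\<dots> \<le> (\<Sum>q. ennreal (real N powr - \<eta>) * ennreal (real q powr (-(1 + \<eta>))))"
    proof (intro suminf_le summableI)
      fix q
      show "(if prime q then \<integral>\<^sup>+x. indicator {x. digit x 0 > N} (1 / (real q + x)) * wt q x \<partial>\<mu> else 0)
        \<le> ennreal (real N powr - \<eta>) * ennreal (real q powr (-(1 + \<eta>)))"
      proof (cases "prime q")
        case True
        then have q: "2 \<le> q" by (rule prime_ge_2_nat)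
        have "(\<integral>\<^sup>+x. indicator {x. digit x 0 > N} (1 / (real q + x)) * wt q x \<partial>\<mu>)
          \<le> (\<integral>\<^sup>+x. ennreal (real N powr - \<eta>) * ennreal (real q powr (-(1 + \<eta>))) \<partial>\<mu>)"
        proof (intro nn_integral_mono_AE)
          show "AE x in \<mu>. indicator {x. digit x 0 > N} (1 / (real q + x)) * wt q x
            \<le> ennreal (real N powr - \<eta>) * ennreal (real q powr (-(1 + \<eta>)))"
            using AE_Lambda
          proof eventually_elim
            case (elim x)
            have x: "0 < x" "x \<le> 1/2" using Lambda_P_digit(4,5)[OF elim] by auto
            then have dq: "digit (1 / (real q + x)) 0 = q" by (intro gauss_digit) auto
            show ?case
            proof (cases "q > N")
              case True
              have "(real q + x) powr (-2 * \<delta>) \<le> real q powr (-2 * \<delta>)"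
                using x q delta_pos by (intro powr_mono2') auto
              also have "\<dots> = real q powr -\<eta> * real q powr (-(1 + \<eta>))"
                by (simp add: \<eta>_def flip: powr_add)
              also have "\<dots> \<le> real N powr -\<eta> * real q powr (-(1 + \<eta>))"
                using True N eta by (intro mult_right_mono powr_mono2') auto
              finally show ?thesis
                using True by (simp add: dq wt_def ennreal_leI flip: ennreal_mult')
            qed (simp add: dq)
          qed
        qed
        then show ?thesis using True by (simp add: emeasure_space_1[simplified])
      qed simp
    qed
    also have "\<dots> = ennreal (real N powr - \<eta>) * ennreal C"
      unfolding ennreal_suminf_cmult C_def using sm by (subst suminf_ennreal2) auto
    finally show ?thesis using C0 by (simp add: ennreal_mult' mult.commute)
  qed
  then show ?thesis using C0 unfolding \<eta>_def by blast
qed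

text \<open>Choosing \<open>K * \<eta> \<ge> 2\<close> turns the tail bound into inverse squares.
  Summability serves twice: for Borel-Cantelli, and for the total mass of the pieces in
  \<open>packing_measure_finite\<close>.\<close>

lemma digit_growth:
  "\<exists>K\<ge>1. summable (\<lambda>n. measure \<mu> {x. digit x n > (n + 1) ^ K})"
proof -
  define \<eta> where "\<eta> = \<delta> - 1/2"
  have eta: "0 < \<eta>" using delta_gt_half by (simp add: \<eta>_def)
  obtain C where C: "0 \<le> C" "\<And>N. N \<ge> 1 \<Longrightarrow> emeasure \<mu> {x. digit x 0 > N} \<le> ennreal (C * real N powr - \<eta>)"
    using emeasure_first_digit_tail unfolding \<eta>_def by blast
  define K where "K = nat \<lceil>2 / \<eta>\<rceil>"
  have "2 / \<eta> \<le> real K" unfolding K_def by linarith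
  then have K: "2 \<le> real K * \<eta>" using eta by (simp add: field_simps)
  have K1: "K \<ge> 1" using K by (cases K) auto
  have "summable (\<lambda>n. measure \<mu> {x. digit x n > (n + 1) ^ K})"
  proof (rule summable_comparison_test)
    show "summable (\<lambda>n. 4 powr \<delta> * C * (1 / real (Suc n) ^ 2))"
      using inverse_power_summable[of 2, where ?'a = real]
      by (intro summable_mult) (subst summable_Suc_iff, simp add: field_simps)
    show "\<exists>N. \<forall>n\<ge>N. norm (measure \<mu> {x. digit x n > (n + 1) ^ K}) \<le> 4 powr \<delta> * C * (1 / real (Suc n) ^ 2)"
    proof (intro exI allI impI)
      fix n :: nat
      have "emeasure \<mu> {x. digit x n > (n + 1) ^ K} \<le> ennreal (4 powr \<delta>) * emeasure \<mu> {x. digit x 0 > (n + 1) ^ K}"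
        using emeasure_digit_le[of n "{(n + 1) ^ K<..}"] by simp
      also have "\<dots> \<le> ennreal (4 powr \<delta>) * ennreal (C * real ((n + 1) ^ K) powr - \<eta>)"
        by (intro mult_left_mono C) auto
      also have "\<dots> = ennreal (4 powr \<delta> * C * real ((n + 1) ^ K) powr - \<eta>)"
        using C by (simp add: ennreal_mult' mult.assoc)
      also have "real ((n + 1) ^ K) powr - \<eta> = real (Suc n) powr (- (real K * \<eta>))"
        by (simp add: powr_powr flip: powr_realpow)
      finally have "measure \<mu> {x. digit x n > (n + 1) ^ K} \<le> 4 powr \<delta> * C * real (Suc n) powr (- (real K * \<eta>))"
        using C by (simp add: emeasure_eq_measure)
      also have "\<dots> \<le> 4 powr \<delta> * C * real (Suc n) powr (- 2)"
        using K C by (intro mult_left_mono powr_mono) auto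
      also have "real (Suc n) powr (- 2) = 1 / real (Suc n) ^ 2"
        by (simp add: powr_minus_divide powr_numeral)
      finally show "norm (measure \<mu> {x. digit x n > (n + 1) ^ K}) \<le> 4 powr \<delta> * C * (1 / real (Suc n) ^ 2)"
        by simp
    qed
  qed
  then show ?thesis using K1 by blast
qed

end

subsection \<open>Measures of small balls\<close>

text \<open>The digits confine \<open>y\<close> and \<open>y'\<close> to intervals whose nearest
  ends are \<open>1 / (p + 1)\<close> and \<open>1 / p'\<close>, or \<open>1 / p\<close> and
  \<open>1 / (p' + 1)\<close>. This loses one unit of the gap, and \<open>h - 1 \<ge> h / 2\<close>;
  in the first case \<open>p + 1 \<le> 2 * p\<close> and \<open>p + h \<le> 2 * p\<close> complete
  the factor \<open>8\<close>.\<close>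

lemma inverse_gap:
  fixes y y' h p p' :: real
  assumes "1 / (p + 1) < y" "y < 1 / p" "1 / (p' + 1) < y'" "y' < 1 / p'" "2 \<le> h" "h \<le> p" "1 \<le> p'"
    "h \<le> \<bar>p' - p\<bar>"
  shows "h / (8 * p\<^sup>2) \<le> \<bar>y - y'\<bar>"
proof (cases "p \<le> p'")
  case True
  have "h / (8 * p\<^sup>2) = (h / 2) / ((2 * p) * (2 * p))" by (simp add: power2_eq_square)
  also have "\<dots> \<le> (h - 1) / ((p + 1) * (p + h))"
    using assms by (intro frac_le mult_mono mult_pos_pos) auto
  also have "\<dots> = 1 / (p + 1) - 1 / (p + h)" using assms by (simp add: divide_simps)
  also have "\<dots> \<le> 1 / (p + 1) - 1 / p'" using assms True by (intro diff_left_mono divide_left_mono mult_pos_pos) auto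
  finally show ?thesis using assms by linarith
next
  case False
  have "h / (8 * p\<^sup>2) \<le> (h / 2) / (p * p)" using assms by (simp add: power2_eq_square divide_simps)
  also have "\<dots> \<le> (h - 1) / (p * (p - h + 1))"
    using assms by (intro frac_le mult_mono mult_pos_pos) auto
  also have "\<dots> = 1 / (p - h + 1) - 1 / p" using assms by (simp add: divide_simps)
  also have "\<dots> \<le> 1 / (p' + 1) - 1 / p" using assms False by (intro diff_right_mono divide_left_mono mult_pos_pos) auto
  finally show ?thesis using assms by linarith
qed

text \<open>The condition on \<open>r\<close> makes \<open>ln (1 / (2 * r))\<close> at least
  \<open>l - 1/2\<close>, whose square is at least \<open>l + 1\<close> once
  \<open>l \<ge> 3\<close>; the square accounts for the factor \<open>1/2\<close>.\<close>

lemma ln_ln_ge: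
  fixes l :: nat
  assumes "3 \<le> l" "0 < r" "r < 1 / (2 ^ l)\<^sup>2"
  shows "ln (real (l + 1)) / 2 \<le> ln (ln (1 / (2 * r)))"
proof -
  have l: "3 \<le> real l" using assms by simp
  have "2 powr (2 * real l - 1) = 2 powr real (2 * l) / 2" by (simp add: powr_diff)
  also have "2 powr real (2 * l) = (2::real) ^ (2 * l)" by (rule powr_realpow) simp
  also have "\<dots> = (2 ^ l)\<^sup>2" by (rule power_even_eq)
  also have "(2 ^ l)\<^sup>2 / 2 < 1 / (2 * r)" using assms by (simp add: field_simps)
  finally have "ln (2 powr (2 * real l - 1)) < ln (1 / (2 * r))"
    using assms by (subst ln_less_cancel_iff) auto
  then have "(2 * real l - 1) * ln 2 < ln (1 / (2 * r))" by (simp add: ln_powr)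
  moreover have "(2 * real l - 1) * (1/2) \<le> (2 * real l - 1) * ln 2"
    using half_lt_ln2 l by (intro mult_left_mono) auto
  ultimately have 1: "real l - 1/2 \<le> ln (1 / (2 * r))" by (simp add: algebra_simps)
  have "3 * real l \<le> real l * real l" using l by (intro mult_right_mono) auto
  moreover have "(real l - 1/2)\<^sup>2 = real l * real l - real l + 1/4"
    by (simp add: power2_eq_square algebra_simps)
  ultimately have "real (l + 1) \<le> (real l - 1/2)\<^sup>2" using l unfolding of_nat_add of_nat_1 by linarith
  then have "ln (real (l + 1)) \<le> ln ((real l - 1/2)\<^sup>2)" using l by (subst ln_le_cancel_iff) auto
  also have "\<dots> = 2 * ln (real l - 1/2)" using l by (simp add: ln_realpow)
  also have "\<dots> \<le> 2 * ln (ln (1 / (2 * r)))" using 1 l by (subst mult_le_cancel_left_pos) auto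
  finally show ?thesis by simp
qed

context prime_conformal begin

text \<open>The radius lies between the scales of two successive cylinders around \<open>x\<close>.
  Its lower bound puts all points of \<open>Lambda_P\<close> that also share the digit
  \<open>a\<close> into the ball. For other digits the ball is rescaled to radius
  \<open>\<rho>\<close> around \<open>y\<close>: if \<open>\<rho> \<le> 1 / a\<close>, the digits
  just above \<open>a\<close> are counted; otherwise the rescaled ball reaches \<open>0\<close> and
  contains all large digits.\<close>

lemma measure_ball_ge:
  assumes "Rk 1 < \<infinity>"
  shows "\<exists>c>0. \<forall>x\<in>Lambda_P. \<forall>l r. 1 / (den (digit x) (Suc l) 0)\<^sup>2 \<le> r \<longrightarrow> r < 1 / (den (digit x) l 0)\<^sup>2 \<longrightarrow>
    c * r powr \<delta> * ln (real (digit x l)) powr (-2 * \<delta>) \<le> measure \<mu> (cball x r)"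
proof -
  obtain c1 where c1: "c1 > 0" and count: "\<And>a t. prime a \<Longrightarrow> 0 \<le> t \<Longrightarrow> t \<le> real a \<Longrightarrow>
    \<exists>B. finite B \<and> (\<forall>b\<in>B. prime b \<and> a \<le> b \<and> b \<le> 2 * a \<and> (b = a \<or> real b - real a + 1 \<le> t)) \<and>
      c1 * (t / (ln (real a))\<^sup>2) powr \<delta> \<le> real (card B)"
    using prime_count[OF assms, of \<delta>] delta_pos delta_le_1 by fastforce
  obtain C2 where C2: "C2 \<ge> 1" and nxt: "\<And>M. M \<ge> 1 \<Longrightarrow>
    \<exists>b. prime b \<and> M \<le> real b \<and> real b \<le> C2 * M \<and> (\<forall>q. prime q \<longrightarrow> M \<le> real q \<longrightarrow> b \<le> q)"
    using next_prime[OF assms] by blast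
  \<comment> \<open>\<open>36\<close> is the square of \<open>2 * 3\<close>: distortion doubles
    \<open>Q\<close>, and digits up to \<open>2 * b\<close> satisfy
    \<open>q + 1 \<le> 3 * b\<close>. The constant \<open>C2\<close> pays for the overshoot of the
    next prime when \<open>\<rho> > 1 / a\<close>.\<close>
  define c where "c = 36 powr - \<delta> * c1 * C2 powr - \<delta>"
  have "c * r powr \<delta> * ln (real (digit x l)) powr (-2 * \<delta>) \<le> measure \<mu> (cball x r)"
    if x: "x \<in> Lambda_P" and r1: "1 / (den (digit x) (Suc l) 0)\<^sup>2 \<le> r" and r2: "r < 1 / (den (digit x) l 0)\<^sup>2"
    for x l r
  proof -
    define a where "a = digit x l"
    define Q where "Q = den (digit x) l 0"
    define y where "y = (gauss_map ^^ l) x"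
    define \<rho> where "\<rho> = r * Q\<^sup>2"
    have pa: "prime (digit x i)" for i using Lambda_P_digit(1)[OF x] .
    have d1: "1 \<le> digit x i" for i using pa prime_ge_1_nat by blast
    have a2: "2 \<le> a" unfolding a_def using pa prime_ge_2_nat by blast
    have Q: "1 \<le> Q" unfolding Q_def using den_bounds(3)[of l "digit x" 0] d1 by simp
    have Q': "1 \<le> den (digit x) (Suc l) 0" by (rule den_bounds(3)[of "Suc l" "digit x" 0]) (use d1 in auto)
    have r0: "0 < r" using r1 Q' by (smt (verit) divide_pos_pos zero_less_power)
    have rho: "0 < \<rho>" "\<rho> < 1" using r2 Q r0 by (auto simp: \<rho>_def Q_def field_simps)
    have y: "1 / (real a + 1) < y" "y < 1 / real a"
      using Lambda_P_bounds[OF Lambda_P_funpow[OF x, of l]] digit_funpow[of l x 0] by (auto simp: y_def a_def)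
    have lna: "0 < ln (real a)" using a2 by (intro ln_gt_zero) simp
    \<comment> \<open>Shared by both regimes. Closeness is asked only for digits other than
      \<open>a\<close>, because the digit \<open>a\<close> is handled by \<open>r1\<close>.\<close>
    have key: "c1 * (6 * Q * real b) powr (-2 * \<delta>) * (t / (ln (real b))\<^sup>2) powr \<delta> \<le> measure \<mu> (cball x r)"
      if b: "prime b" and t: "0 \<le> t" "t \<le> real b"
        and sub: "\<And>q y'. prime q \<Longrightarrow> b \<le> q \<Longrightarrow> q \<le> 2 * b \<Longrightarrow> q \<noteq> a \<Longrightarrow> q = b \<or> real q - real b + 1 \<le> t
          \<Longrightarrow> 1 / (real q + 1) < y' \<Longrightarrow> y' < 1 / real q \<Longrightarrow> \<bar>y - y'\<bar> \<le> \<rho>" for b t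
    proof -
      obtain B where B: "finite B" "\<And>q. q \<in> B \<Longrightarrow> prime q \<and> b \<le> q \<and> q \<le> 2 * b \<and> (q = b \<or> real q - real b + 1 \<le> t)"
        "c1 * (t / (ln (real b))\<^sup>2) powr \<delta> \<le> real (card B)"
        using count[OF b t] by blast
      have b2: "2 \<le> b" using b by (rule prime_ge_2_nat)
      have "c1 * (6 * Q * real b) powr (-2 * \<delta>) * (t / (ln (real b))\<^sup>2) powr \<delta>
        = (2 * Q) powr (-2 * \<delta>) * (c1 * (t / (ln (real b))\<^sup>2) powr \<delta> * (3 * real b) powr (-2 * \<delta>))"
      proof -
        have "6 * Q * real b = (2 * Q) * (3 * real b)" by simp
        then have "(6 * Q * real b) powr (-2 * \<delta>) = (2 * Q) powr (-2 * \<delta>) * (3 * real b) powr (-2 * \<delta>)"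
          by (simp only: powr_mult)
        then show ?thesis by (simp only: mult_ac)
      qed
      also have "\<dots> \<le> (2 * Q) powr (-2 * \<delta>) * (real (card B) * (3 * real b) powr (-2 * \<delta>))"
        using B(3) by (intro mult_left_mono mult_right_mono) auto
      finally have "ennreal (c1 * (6 * Q * real b) powr (-2 * \<delta>) * (t / (ln (real b))\<^sup>2) powr \<delta>)
        \<le> ennreal ((2 * Q) powr (-2 * \<delta>) * (real (card B) * (3 * real b) powr (-2 * \<delta>)))"
        by (rule ennreal_leI)
      also have "\<dots> \<le> emeasure \<mu> {x'. (\<forall>i<l. digit x' i = digit x i) \<and> digit x' l \<in> B}"
        unfolding Q_def
      proof (rule emeasure_cylinder_ge[OF _ _ B(1)])
        fix q assume "q \<in> B"
        then have q: "prime q" "q \<le> 2 * b" using B(2) by blast+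
        then have "q + 1 \<le> 3 * b" using b2 by linarith
        then have "real (q + 1) \<le> real (3 * b)" by (simp only: of_nat_le_iff)
        then show "prime q \<and> real q + 1 \<le> 3 * real b" using q by simp
      qed (use pa delta_pos in auto)
      also have "\<dots> \<le> emeasure \<mu> (cball x r)"
      proof (rule emeasure_mono_AE)
        show "AE x' in \<mu>. x' \<in> {x'. (\<forall>i<l. digit x' i = digit x i) \<and> digit x' l \<in> B} \<longrightarrow> x' \<in> cball x r"
          using AE_Lambda
        proof eventually_elim
          case (elim x')
          show ?case
          proof
            assume "x' \<in> {x'. (\<forall>i<l. digit x' i = digit x i) \<and> digit x' l \<in> B}"
            then have same: "\<forall>i<l. digit x' i = digit x i" and qB: "digit x' l \<in> B" by auto
            have agree: "branch (digit x) m z = branch (digit x') m z" if "\<forall>i<m. digit x' i = digit x i" for m z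
              using that by (induction m arbitrary: z) auto
            have T: "0 < (gauss_map ^^ m) z \<and> (gauss_map ^^ m) z \<le> 1/2" if "z \<in> Lambda_P" for m z
              using Lambda_P_digit(4,5)[OF Lambda_P_funpow[OF that]] by auto
            have dist: "\<bar>x - x'\<bar> \<le> \<bar>(gauss_map ^^ m) x - (gauss_map ^^ m) x'\<bar> / (den (digit x) m 0)\<^sup>2"
              if m: "\<forall>i<m. digit x' i = digit x i" for m
              using branch_diff_bounds(1)[of m "digit x" "(gauss_map ^^ m) x" "(gauss_map ^^ m) x'"] d1
                T[OF x, of m] T[OF elim, of m] branch_digit[OF x, of m] branch_digit[OF elim, of m] agree[OF m] by simp
            show "x' \<in> cball x r"
            proof (cases "digit x' l = a")
              case True
              then have m: "\<forall>i<Suc l. digit x' i = digit x i" using same by (auto simp: less_Suc_eq a_def)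
              have "\<bar>x - x'\<bar> \<le> \<bar>(gauss_map ^^ Suc l) x - (gauss_map ^^ Suc l) x'\<bar> / (den (digit x) (Suc l) 0)\<^sup>2"
                by (rule dist[OF m])
              also have "\<dots> \<le> 1 / (den (digit x) (Suc l) 0)\<^sup>2"
                using T[OF x, of "Suc l"] T[OF elim, of "Suc l"] by (intro divide_right_mono) auto
              also have "\<dots> \<le> r" by (rule r1)
              finally show ?thesis by (simp add: dist_real_def)
            next
              case False
              define q where "q = digit x' l"
              have "1 / (real q + 1) < (gauss_map ^^ l) x'" "(gauss_map ^^ l) x' < 1 / real q"
                using Lambda_P_bounds[OF Lambda_P_funpow[OF elim, of l]] digit_funpow[of l x' 0] by (auto simp: q_def)
              then have "\<bar>y - (gauss_map ^^ l) x'\<bar> \<le> \<rho>"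
                using B(2)[OF qB] False by (intro sub[of q]) (auto simp: q_def)
              then have "\<bar>x - x'\<bar> \<le> \<rho> / Q\<^sup>2"
                using dist[OF same] Q unfolding y_def Q_def
                by (meson divide_right_mono order.trans zero_le_power2)
              then show ?thesis using Q by (simp add: dist_real_def \<rho>_def)
            qed
          qed
        qed
      qed simp
      finally show ?thesis by (simp add: emeasure_eq_measure)
    qed
    have scale: "36 powr - \<delta> * z powr \<delta> * Q powr (-2 * \<delta>) * w powr (-2 * \<delta>) * (ln (real b)) powr (-2 * \<delta>)
        = (6 * Q * w) powr (-2 * \<delta>) * (z / (ln (real b))\<^sup>2) powr \<delta>"
      if "0 < z" "0 < w" "2 \<le> b" for z w and b :: nat
    proof -
      have "0 < ln (real b)" using that by (intro ln_gt_zero) simp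
      then have 1: "(z / (ln (real b))\<^sup>2) powr \<delta> = z powr \<delta> * (ln (real b)) powr (-2 * \<delta>)"
        using that by (simp add: powr_divide powr_minus_divide powr_powr flip: powr_numeral)
      have "(6::real) powr (-2 * \<delta>) = (6 powr 2) powr - \<delta>" unfolding powr_powr by simp
      then have "(6::real) powr (-2 * \<delta>) = 36 powr - \<delta>" by (simp add: powr_numeral)
      then have "(6 * Q * w) powr (-2 * \<delta>) = 36 powr - \<delta> * Q powr (-2 * \<delta>) * w powr (-2 * \<delta>)"
        by (simp only: powr_mult)
      then show ?thesis unfolding 1 by (simp only: mult_ac)
    qed
    have rrho: "\<rho> powr \<delta> * Q powr (-2 * \<delta>) = r powr \<delta>"
    proof -
      have "\<rho> powr \<delta> = r powr \<delta> * Q powr (2 * \<delta>)"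
        using r0 Q by (simp add: \<rho>_def powr_mult powr_powr flip: powr_numeral)
      then show ?thesis using Q by (simp add: mult.assoc flip: powr_add)
    qed
    have C2': "C2 powr - \<delta> \<le> 1" using powr_mono2'[of "-\<delta>" 1 C2] C2 delta_pos by simp
    show ?thesis
    proof (cases "\<rho> \<le> 1 / real a")
      case True
      \<comment> \<open>Near \<open>1 / a\<close> a displacement by \<open>\<rho>\<close> shifts the
        digit by about \<open>a\<^sup>2 * \<rho>\<close>. This may be below \<open>1\<close>, and
        then \<open>a\<close> alone is counted.\<close>
      define t where "t = (real a)\<^sup>2 * \<rho>"
      have t: "0 \<le> t" "t \<le> real a"
      proof -
        show "0 \<le> t" using rho by (simp add: t_def)
        have "t \<le> (real a)\<^sup>2 * (1 / real a)" unfolding t_def using True by (intro mult_left_mono) auto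
        then show "t \<le> real a" using a2 by (simp add: power2_eq_square)
      qed
      have "c * r powr \<delta> * ln (real a) powr (-2 * \<delta>) \<le> c1 * (36 powr - \<delta> * r powr \<delta> * ln (real a) powr (-2 * \<delta>))"
      proof -
        have "36 powr - \<delta> * c1 * C2 powr - \<delta> \<le> 36 powr - \<delta> * c1 * 1"
          using C2' c1 by (intro mult_left_mono) auto
        then have "c * (r powr \<delta> * ln (real a) powr (-2 * \<delta>)) \<le> 36 powr - \<delta> * c1 * (r powr \<delta> * ln (real a) powr (-2 * \<delta>))"
          unfolding c_def by (intro mult_right_mono) auto
        then show ?thesis by (simp only: mult_ac)
      qed
      also have "36 powr - \<delta> * r powr \<delta> * ln (real a) powr (-2 * \<delta>)
        = 36 powr - \<delta> * t powr \<delta> * Q powr (-2 * \<delta>) * (real a) powr (-2 * \<delta>) * ln (real a) powr (-2 * \<delta>)"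
      proof -
        have "t powr \<delta> = \<rho> powr \<delta> * real a powr (2 * \<delta>)"
          using a2 rho by (simp add: t_def powr_mult powr_powr flip: powr_numeral)
        then have "\<rho> powr \<delta> = t powr \<delta> * real a powr (-2 * \<delta>)"
          using a2 by (simp add: mult.assoc flip: powr_add)
        then show ?thesis unfolding rrho[symmetric] by (simp only: mult_ac)
      qed
      also have "\<dots> = (6 * Q * real a) powr (-2 * \<delta>) * (t / (ln (real a))\<^sup>2) powr \<delta>"
        using a2 rho by (intro scale) (auto simp: t_def)
      also have "c1 * \<dots> = c1 * (6 * Q * real a) powr (-2 * \<delta>) * (t / (ln (real a))\<^sup>2) powr \<delta>"
        by (simp only: mult.assoc)
      also have "\<dots> \<le> measure \<mu> (cball x r)"
      proof (rule key[OF _ t])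
        show "prime a" unfolding a_def by (rule pa)
        fix q y' assume q: "prime q" "a \<le> q" "q \<le> 2 * a" "q \<noteq> a" "q = a \<or> real q - real a + 1 \<le> t"
          and y': "1 / (real q + 1) < y'" "y' < 1 / real q"
        have "1 / real q \<le> 1 / (real a + 1)" using q a2 by (intro divide_left_mono mult_pos_pos) auto
        then have lt: "y' < y" using y y' by linarith
        have "y - y' \<le> 1 / real a - 1 / (real q + 1)" using y y' by linarith
        also have "\<dots> = (real q - real a + 1) / (real a * (real q + 1))" using a2 q by (simp add: divide_simps)
        also have "\<dots> \<le> t / (real a * real a)"
          using q a2 t by (intro frac_le mult_mono mult_pos_pos) auto
        also have "\<dots> = \<rho>" using a2 by (simp add: t_def power2_eq_square)
        finally show "\<bar>y - y'\<bar> \<le> \<rho>" using lt by simp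
      qed
      finally show ?thesis unfolding a_def .
    next
      case False
      have "1 \<le> 1 / \<rho>" using rho by (simp add: field_simps)
      \<comment> \<open>The interval of every digit from \<open>b\<close> on lies between
        \<open>0\<close> and \<open>\<rho>\<close>. Minimality gives \<open>b \<le> a\<close>, so
        that \<open>ln b\<close> can be replaced by \<open>ln a\<close> at the end.\<close>
      then obtain b where b: "prime b" "1 / \<rho> \<le> real b" "real b \<le> C2 * (1 / \<rho>)"
        "\<And>q. prime q \<Longrightarrow> 1 / \<rho> \<le> real q \<Longrightarrow> b \<le> q" using nxt by blast
      have b2: "2 \<le> b" using b(1) by (rule prime_ge_2_nat)
      have "1 / \<rho> \<le> real a" using False rho a2 by (simp add: field_simps)
      then have ba: "b \<le> a" using b(4)[of a] pa by (simp add: a_def)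
      have lnb: "0 < ln (real b)" "ln (real b) \<le> ln (real a)" using b2 ba by (auto intro: ln_gt_zero)
      have b1: "1 / real b \<le> \<rho>" using b(2) rho b2 by (simp add: field_simps)
      have bd: "real b powr \<delta> * real b powr (-2 * \<delta>) = real b powr - \<delta>"
        by (simp flip: powr_add)
      have "c * r powr \<delta> * ln (real a) powr (-2 * \<delta>)
        = c1 * (36 powr - \<delta> * (C2 powr - \<delta> * \<rho> powr \<delta>) * Q powr (-2 * \<delta>) * ln (real a) powr (-2 * \<delta>))"
        unfolding c_def rrho[symmetric] by (simp only: mult_ac)
      also have "C2 powr - \<delta> * \<rho> powr \<delta> = (C2 * (1 / \<rho>)) powr - \<delta>"
        using C2 rho by (simp add: powr_divide powr_minus_divide)
      also have "c1 * (36 powr - \<delta> * (C2 * (1 / \<rho>)) powr - \<delta> * Q powr (-2 * \<delta>) * ln (real a) powr (-2 * \<delta>))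
        \<le> c1 * (36 powr - \<delta> * real b powr - \<delta> * Q powr (-2 * \<delta>) * ln (real b) powr (-2 * \<delta>))"
      proof -
        have i1: "(C2 * (1 / \<rho>)) powr - \<delta> \<le> real b powr - \<delta>"
          using b(3) b2 delta_pos by (intro powr_mono2') auto
        have i2: "ln (real a) powr (-2 * \<delta>) \<le> ln (real b) powr (-2 * \<delta>)"
          using lnb delta_pos by (intro powr_mono2') auto
        show ?thesis using c1 by (intro mult_left_mono mult_mono i1 i2) auto
      qed
      also have "36 powr - \<delta> * real b powr - \<delta> * Q powr (-2 * \<delta>) * ln (real b) powr (-2 * \<delta>)
        = 36 powr - \<delta> * real b powr \<delta> * Q powr (-2 * \<delta>) * real b powr (-2 * \<delta>) * ln (real b) powr (-2 * \<delta>)"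
        unfolding bd[symmetric] by (simp only: mult_ac)
      also have "\<dots> = (6 * Q * real b) powr (-2 * \<delta>) * (real b / (ln (real b))\<^sup>2) powr \<delta>"
        using b2 by (intro scale) auto
      also have "c1 * \<dots> = c1 * (6 * Q * real b) powr (-2 * \<delta>) * (real b / (ln (real b))\<^sup>2) powr \<delta>"
        by (simp only: mult.assoc)
      also have "\<dots> \<le> measure \<mu> (cball x r)"
      proof (rule key[OF b(1)])
        fix q y' assume q: "prime q" "b \<le> q" and y': "1 / (real q + 1) < y'" "y' < 1 / real q"
        have "1 / real q \<le> 1 / real b" using q b2 by (intro divide_left_mono mult_pos_pos) auto
        then have "y' < \<rho>" using y' b1 by linarith
        moreover have "0 < y'" using y' by (smt (verit) divide_nonneg_nonneg of_nat_0_le_iff)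
        moreover have "y < \<rho>" using y False by linarith
        moreover have "0 < y" using y by (smt (verit) divide_nonneg_nonneg of_nat_0_le_iff)
        ultimately show "\<bar>y - y'\<bar> \<le> \<rho>" by linarith
      qed auto
      finally show ?thesis unfolding a_def .
    qed
  qed
  moreover have "0 < c" unfolding c_def using c1 C2 by simp
  ultimately show ?thesis by blast
qed

text \<open>The threshold \<open>r0\<close> must not depend on the point. Fixing the sum
  \<open>k\<close> bounds each of the first \<open>n\<close> digits by \<open>k\<close>, and the
  growth condition bounds the later ones, so denominators of a given length are uniformly bounded
  and a small \<open>r\<close> forces a large scale \<open>l\<close>. Then
  \<open>ln (digit x l) \<le> K * ln (l + 1)\<close>, which \<open>ln_ln_ge\<close> compares with
  the iterated logarithm.\<close>

lemma psi_le_measure_ball: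
  assumes "Rk 1 < \<infinity>" "1 \<le> K"
  shows "\<exists>C>0. \<forall>n k. \<exists>r0>0. \<forall>x\<in>Lambda_P. (\<forall>j\<ge>n. digit x j \<le> (j + 1) ^ K) \<longrightarrow> (\<Sum>i<n. digit x i) = k \<longrightarrow>
    (\<forall>r. 0 < r \<longrightarrow> r < r0 \<longrightarrow> psi_loglog \<delta> (2 * r) \<le> C * measure \<mu> (cball x r))"
proof -
  obtain c where c: "c > 0" and ball: "\<And>x l r. x \<in> Lambda_P \<Longrightarrow> 1 / (den (digit x) (Suc l) 0)\<^sup>2 \<le> r \<Longrightarrow>
    r < 1 / (den (digit x) l 0)\<^sup>2 \<Longrightarrow>
    c * r powr \<delta> * ln (real (digit x l)) powr (-2 * \<delta>) \<le> measure \<mu> (cball x r)"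
    using measure_ball_ge[OF assms(1)] by blast
  define C where "C = 2 powr \<delta> * (2 * real K) powr (2 * \<delta>) / c"
  have "\<exists>r0>0. \<forall>x\<in>Lambda_P. (\<forall>j\<ge>n. digit x j \<le> (j + 1) ^ K) \<longrightarrow> (\<Sum>i<n. digit x i) = k \<longrightarrow>
    (\<forall>r. 0 < r \<longrightarrow> r < r0 \<longrightarrow> psi_loglog \<delta> (2 * r) \<le> C * measure \<mu> (cball x r))" for n k
  proof -
    \<comment> \<open>At least \<open>n\<close>, so that the growth condition covers the digit at
      place \<open>l\<close>; at least \<open>2\<close>, so that \<open>l \<ge> 3\<close> as
      \<open>ln_ln_ge\<close> asks.\<close>
    define l0 where "l0 = max n 2"
    define b where "b = max k ((l0 + 1) ^ K)"
    define r0 where "r0 = 1 / ((real b + 1) ^ Suc l0)\<^sup>2"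
    have "psi_loglog \<delta> (2 * r) \<le> C * measure \<mu> (cball x r)"
      if x: "x \<in> Lambda_P" and grow: "\<And>j. j \<ge> n \<Longrightarrow> digit x j \<le> (j + 1) ^ K"
        and sum: "(\<Sum>i<n. digit x i) = k" and r: "0 < r" "r < r0" for x r
    proof -
      define Q where "Q l = den (digit x) l 0" for l
      have d2: "2 \<le> digit x i" for i using Lambda_P_digit(1)[OF x] prime_ge_2_nat by blast
      have d1: "1 \<le> digit x i" for i using d2[of i] by linarith
      have Q2: "2 ^ l \<le> Q l" for l unfolding Q_def using d2 by (intro den_ge_power)
      have Qpos: "1 \<le> Q l" for l unfolding Q_def using den_bounds(3)[of l "digit x" 0] d1 by simp
      obtain m where m: "1 / r < 2 ^ m" using real_arch_pow[of 2 "1 / r"] by auto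
      have "1 / (Q (Suc m))\<^sup>2 \<le> r"
      proof -
        have "(2::real) ^ m \<le> 2 ^ Suc m" by simp
        then have "1 / r \<le> 2 ^ Suc m" using m by linarith
        also have "\<dots> \<le> Q (Suc m)" by (rule Q2)
        also have "\<dots> \<le> (Q (Suc m))\<^sup>2" using Qpos[of "Suc m"] by (simp add: power2_eq_square)
        finally show ?thesis using r Qpos[of "Suc m"] by (simp add: field_simps)
      qed
      then have ex: "\<exists>l. 1 / (Q (Suc l))\<^sup>2 \<le> r" by blast
      \<comment> \<open>The scale containing \<open>r\<close>: once \<open>l\<close> is known to be
        positive, minimality also gives \<open>r < 1 / (Q l)\<^sup>2\<close>.\<close>
      define l where "l = (LEAST l. 1 / (Q (Suc l))\<^sup>2 \<le> r)"
      have l1: "1 / (Q (Suc l))\<^sup>2 \<le> r" unfolding l_def using ex by (rule LeastI_ex)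
      have ll0: "l0 < l"
      proof (rule ccontr)
        assume "\<not> l0 < l"
        then have le: "l \<le> l0" by simp
        have db: "digit x i \<le> b" if "i \<le> l0" for i
        proof (cases "i < n")
          case True
          then have "digit x i \<le> (\<Sum>i<n. digit x i)" by (intro member_le_sum) auto
          then show ?thesis using sum by (simp add: b_def)
        next
          case False
          then have "digit x i \<le> (i + 1) ^ K" by (intro grow) simp
          also have "\<dots> \<le> (l0 + 1) ^ K" using that by (intro power_mono) auto
          finally show ?thesis by (simp add: b_def)
        qed
        have "Q (Suc l) \<le> (real b + 1) ^ Suc l"
          unfolding Q_def using db le d1 by (intro den_le_power) auto
        also have "\<dots> \<le> (real b + 1) ^ Suc l0" using le by (intro power_increasing) auto
        finally have "(Q (Suc l))\<^sup>2 \<le> ((real b + 1) ^ Suc l0)\<^sup>2"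
          using Qpos[of "Suc l"] by (intro power_mono) auto
        then have "r0 \<le> 1 / (Q (Suc l))\<^sup>2" unfolding r0_def using Qpos[of "Suc l"]
          by (intro divide_left_mono mult_pos_pos) auto
        then show False using l1 r by simp
      qed
      then obtain l' where l': "l = Suc l'" by (cases l) auto
      have l2: "r < 1 / (Q l)\<^sup>2"
        using not_less_Least[of l' "\<lambda>l. 1 / (Q (Suc l))\<^sup>2 \<le> r"] l' unfolding l_def[symmetric] by simp
      have l3: "3 \<le> l" using ll0 by (simp add: l0_def)
      define a where "a = digit x l"
      have a2: "2 \<le> a" unfolding a_def by (rule d2)
      have lna: "0 < ln (real a)" using a2 by (intro ln_gt_zero) simp
      have "a \<le> (l + 1) ^ K" unfolding a_def using ll0 by (intro grow) (simp add: l0_def)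
      then have "real a \<le> real ((l + 1) ^ K)" by (simp only: of_nat_le_iff)
      then have "ln (real a) \<le> ln (real ((l + 1) ^ K))" using a2 by (intro ln_mono) auto
      also have "\<dots> = real K * ln (real (l + 1))" by (simp add: ln_realpow)
      finally have "ln (real a) / (2 * real K) \<le> ln (real (l + 1)) / 2" using assms(2) by (simp add: field_simps)
      also have "\<dots> \<le> ln (ln (1 / (2 * r)))"
      proof (rule ln_ln_ge[OF l3 r(1)])
        have "(2 ^ l)\<^sup>2 \<le> (Q l)\<^sup>2" using Q2[of l] by (intro power_mono) auto
        then have "1 / (Q l)\<^sup>2 \<le> 1 / (2 ^ l)\<^sup>2" using Qpos[of l] by (intro divide_left_mono mult_pos_pos) auto
        then show "r < 1 / (2 ^ l)\<^sup>2" using l2 by linarith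
      qed
      finally have LL: "ln (real a) / (2 * real K) \<le> ln (ln (1 / (2 * r)))" .
      have "psi_loglog \<delta> (2 * r) \<le> (2 * r) powr \<delta> * (ln (real a) / (2 * real K)) powr (-2 * \<delta>)"
        unfolding psi_loglog_def using LL lna assms(2) delta_pos
        by (intro mult_left_mono) (auto intro!: powr_mono2')
      also have "\<dots> = C * (c * r powr \<delta> * ln (real a) powr (-2 * \<delta>))"
        using r lna assms(2) c by (simp add: C_def powr_mult powr_divide powr_minus_divide)
      also have "\<dots> \<le> C * measure \<mu> (cball x r)"
        using ball[OF x l1[unfolded Q_def] l2[unfolded Q_def]] c
        unfolding a_def by (intro mult_left_mono) (auto simp: C_def)
      finally show ?thesis .
    qed
    moreover have "0 < r0" by (simp add: r0_def add_pos_nonneg)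
    ultimately show ?thesis by blast
  qed
  moreover have "0 < C" using c assms(2) by (simp add: C_def)
  ultimately show ?thesis by blast
qed

text \<open>As \<open>\<delta> \<le> 1\<close>, each trial hits the digit \<open>p\<close> with
  conditional mass at least of order \<open>p\<close> to the power \<open>-2\<close>, so
  \<open>p\<^sup>3\<close> trials all fail with probability at most \<open>exp (- (p / 16))\<close>.
  The points missing every prime of \<open>I\<close> beyond \<open>N\<close> lie in each of these
  failure events, hence form a null set.\<close>

lemma AE_infinitely_often_digit:
  assumes I: "\<And>p. p \<in> I \<Longrightarrow> prime p" "\<And>N. \<exists>p\<in>I. p > N"
  shows "AE x in \<mu>. \<forall>N. \<exists>p\<in>I. N < p \<and> (\<exists>n<p^3. digit x n = p)"
proof (subst AE_all_countable, rule allI)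
  fix N :: nat
  define Z where "Z = {x. \<forall>p. p \<in> I \<longrightarrow> N < p \<longrightarrow> (\<forall>n<p^3. digit x n \<noteq> p)} \<inter> Lambda_P"
  have Z [measurable]: "Z \<in> sets borel" unfolding Z_def by measurable
  have bound: "measure \<mu> Z \<le> exp (- (real p / 16))" if p: "p \<in> I" "N < p" for p
  proof -
    have pp: "prime p" using I p by blast
    then have p2: "2 \<le> p" by (rule prime_ge_2_nat)
    have "Z \<subseteq> {x. \<forall>i<p^3. digit x i \<in> {q. prime q \<and> q \<noteq> p}}"
      using p Lambda_P_digit(1) by (auto simp: Z_def)
    then have "measure \<mu> Z \<le> measure \<mu> {x. \<forall>i<p^3. digit x i \<in> {q. prime q \<and> q \<noteq> p}}"
      by (intro finite_measure_mono) auto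
    also have "\<dots> \<le> exp (- (4 powr - \<delta> * (real p + 1) powr (-2 * \<delta>)) * real (p^3))"
      by (rule measure_digit_avoid_le[OF pp])
    also have "\<dots> \<le> exp (- (real p / 16))"
    proof -
      have "1/4 * (1 / (2 * real p)\<^sup>2) \<le> 4 powr - \<delta> * (real p + 1) powr (-2 * \<delta>)"
      proof (rule mult_mono)
        have "(4::real) powr - 1 \<le> 4 powr - \<delta>" using delta_le_1 by (intro powr_mono) auto
        then show "1/4 \<le> (4::real) powr - \<delta>" by (simp add: powr_minus_divide)
        have "1 / (2 * real p)\<^sup>2 = (2 * real p) powr - 2" using p2 by (simp add: powr_minus_divide powr_numeral)
        also have "\<dots> \<le> (real p + 1) powr - 2" using p2 by (intro powr_mono2') auto
        also have "\<dots> \<le> (real p + 1) powr (-2 * \<delta>)" using delta_le_1 by (intro powr_mono) auto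
        finally show "1 / (2 * real p)\<^sup>2 \<le> (real p + 1) powr (-2 * \<delta>)" .
      qed auto
      then have "1/4 * (1 / (2 * real p)\<^sup>2) * real (p^3) \<le> 4 powr - \<delta> * (real p + 1) powr (-2 * \<delta>) * real (p^3)"
        by (intro mult_right_mono) auto
      moreover have "1/4 * (1 / (2 * real p)\<^sup>2) * real (p^3) = real p / 16"
        using p2 by (simp add: power2_eq_square power3_eq_cube)
      ultimately show ?thesis by simp
    qed
    finally show ?thesis .
  qed
  have "measure \<mu> Z = 0"
  proof (rule ccontr)
    assume "measure \<mu> Z \<noteq> 0"
    then have pos: "0 < measure \<mu> Z" using measure_nonneg[of \<mu> Z] by linarith
    obtain p where p: "p \<in> I" "p > max N (nat \<lceil>- 16 * ln (measure \<mu> Z)\<rceil>)" using I(2) by blast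
    then have "- 16 * ln (measure \<mu> Z) < real p" by linarith
    then have "- (real p / 16) < ln (measure \<mu> Z)" by simp
    then have "exp (- (real p / 16)) < exp (ln (measure \<mu> Z))" by simp
    then show False using bound[of p] p pos by simp
  qed
  then have "Z \<in> null_sets \<mu>" by (auto simp: null_sets_def emeasure_eq_measure)
  then have "AE x in \<mu>. x \<notin> Z" by (rule AE_not_in)
  then show "AE x in \<mu>. \<exists>p\<in>I. N < p \<and> (\<exists>n<p^3. digit x n = p)"
    using AE_Lambda by eventually_elim (auto simp: Z_def)
qed


text \<open>Isolation separates the interval of the digit \<open>p\<close> from those of all other
  prime digits, so up to a null set the ball meets a single cylinder. The place
  \<open>n < p^3\<close> and the digit growth bound the denominator, which keeps the iterated
  logarithm of \<open>1 / (2 * r)\<close> below a multiple of \<open>ln p\<close>. The radius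
  \<open>5 * r\<close> prepares for Vitali's lemma.\<close>

lemma measure_ball_le:
  assumes "0 < c" and c4: "c \<le> 1/4" and A: "1 \<le> A" and x: "x \<in> Lambda_P"
    and grow: "\<And>i. real (digit x i) + 1 \<le> A * real (i + 1) ^ K"
  shows "\<exists>p0. \<forall>p\<ge>p0. \<forall>n<p^3. digit x n = p \<longrightarrow>
      (\<forall>q. prime q \<longrightarrow> q \<noteq> p \<longrightarrow> c * (ln (real p))\<^sup>2 \<le> \<bar>real q - real p\<bar>) \<longrightarrow>
      (\<exists>r>0. r \<le> 1 / real p \<and> measure \<mu> (cball x (5 * r)) \<le> (100 * (3 * real K + 4)\<^sup>2 / c) powr \<delta> * psi_loglog \<delta> (2 * r))"
proof -
  \<comment> \<open>\<open>exp (2 / c)\<close> makes \<open>h \<ge> 2\<close>, as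
    \<open>inverse_gap\<close> asks; \<open>2 * A + 20\<close> is the constant that one spare power
    of \<open>p\<close> absorbs in \<open>ln1\<close>.\<close>
  define p0 where "p0 = max (nat \<lceil>exp (2 / c)\<rceil>) (nat \<lceil>2 * A + 20\<rceil>)"
  have "\<exists>r>0. r \<le> 1 / real p \<and> measure \<mu> (cball x (5 * r)) \<le> (100 * (3 * real K + 4)\<^sup>2 / c) powr \<delta> * psi_loglog \<delta> (2 * r)"
    if p0: "p0 \<le> p" and iso: "\<And>q. prime q \<Longrightarrow> q \<noteq> p \<Longrightarrow> c * (ln (real p))\<^sup>2 \<le> \<bar>real q - real p\<bar>"
      and dn: "digit x n = p" and n: "n < p^3" for p n
  proof -
    define Q where "Q = den (digit x) n 0"
    define h where "h = c * (ln (real p))\<^sup>2"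
    \<comment> \<open>Rescaling expands \<open>5 * r\<close> by at most
      \<open>4 * Q\<^sup>2\<close>, to \<open>h / (10 * p\<^sup>2)\<close>, just below the
      separation \<open>h / (8 * p\<^sup>2)\<close> of \<open>inverse_gap\<close>.\<close>
    define r where "r = h / (200 * Q\<^sup>2 * (real p)\<^sup>2)"
    \<comment> \<open>From \<open>n < p^3\<close>, \<open>n ^ (K + 1)\<close> is at most
      \<open>p ^ (3 * K + 3)\<close>; the remaining unit is the spare power.\<close>
    define J where "J = 3 * K + 4"
    have pa: "prime (digit x i)" for i using Lambda_P_digit(1)[OF x] .
    have d1: "1 \<le> digit x i" for i using pa prime_ge_1_nat by blast
    have Q: "1 \<le> Q" unfolding Q_def using den_bounds(3)[of n "digit x" 0] d1 by simp
    have pexp: "exp (2 / c) \<le> real p" using p0 unfolding p0_def by linarith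
    have pA: "2 * A + 20 \<le> real p" using p0 unfolding p0_def by linarith
    have p2: "22 \<le> real p" using pA A by linarith
    have lnp: "2 / c \<le> ln (real p)" using pexp p2 by (subst ln_ge_iff) auto
    then have lnp0: "0 < ln (real p)" using assms(1) by (smt (verit) divide_pos_pos)
    have h2: "2 \<le> h"
    proof -
      have "2 * 2 \<le> 2 * (2 / c)" using c4 assms(1) by (simp add: field_simps)
      also have "2 * (2 / c) = c * (2 / c)\<^sup>2" using assms(1) by (simp add: power2_eq_square)
      also have "\<dots> \<le> h" unfolding h_def using lnp assms(1) by (intro mult_left_mono power_mono) auto
      finally show ?thesis by simp
    qed
    \<comment> \<open>The bound \<open>c \<le> 1/4\<close> is matched to the constant
      \<open>4\<close> of \<open>ln_sq_le\<close>.\<close>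
    have hp: "h \<le> real p"
    proof -
      have "h \<le> 1/4 * (4 * real p)" unfolding h_def using ln_sq_le[of "real p"] p2 c4 assms(1)
        by (intro mult_mono) auto
      then show ?thesis by simp
    qed
    have r0: "0 < r" unfolding r_def using h2 Q p2 by simp
    have Qp: "1 \<le> Q\<^sup>2" using Q by (simp add: one_le_power)
    have rp: "r \<le> 1 / (200 * real p)"
    proof -
      have "r \<le> real p / (200 * 1 * (real p)\<^sup>2)" unfolding r_def
        using hp Qp p2 by (intro frac_le mult_mono mult_right_mono) auto
      also have "\<dots> = 1 / (200 * real p)" using p2 by (simp add: power2_eq_square)
      finally show ?thesis .
    qed
    define y where "y = (gauss_map ^^ n) x"
    have y: "1 / (real p + 1) < y" "y < 1 / real p"
      using Lambda_P_bounds[OF Lambda_P_funpow[OF x, of n]] digit_funpow[of n x 0] dn by (auto simp: y_def)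
    have near: "\<forall>i<Suc n. digit x' i = digit x i" if x': "x' \<in> Lambda_P" and d: "\<bar>x - x'\<bar> \<le> 5 * r" for x'
    proof -
      have "5 * r = (h / real p) * (1 / (40 * Q\<^sup>2 * real p))"
        using p2 by (simp add: r_def power2_eq_square)
      also have "\<dots> \<le> 1 * (1 / (40 * Q\<^sup>2 * real p))"
        using hp p2 Q by (intro mult_right_mono) auto
      also have "\<dots> < 1 / (8 * Q\<^sup>2 * real p)"
      proof -
        define X where "X = Q\<^sup>2 * real p"
        have "0 < X" unfolding X_def using Q p2 by (intro mult_pos_pos) auto
        then show ?thesis unfolding mult.assoc mult_1 X_def[symmetric] by (intro divide_strict_left_mono) auto
      qed
      also have "\<dots> = 1 / (2 * real p) / (4 * Q\<^sup>2)" using p2 by simp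
      also have "\<dots> \<le> y / (4 * Q\<^sup>2)"
      proof (rule divide_right_mono)
        have "1 / (2 * real p) \<le> 1 / (real p + 1)" using p2 by (intro divide_left_mono mult_pos_pos) auto
        then show "1 / (2 * real p) \<le> y" using y by linarith
      qed simp
      finally have close: "\<bar>x - x'\<bar> < (gauss_map ^^ n) x / (4 * (den (digit x) n 0)\<^sup>2)"
        using d by (simp add: y_def Q_def)
      have same: "\<forall>i<n. digit x' i = digit x i" by (rule same_digits(1)[OF x x' close])
      define y' where "y' = (gauss_map ^^ n) x'"
      define q where "q = digit x' n"
      have q: "prime q" unfolding q_def by (rule Lambda_P_digit(1)[OF x'])
      have y': "1 / (real q + 1) < y'" "y' < 1 / real q"
        using Lambda_P_bounds[OF Lambda_P_funpow[OF x', of n]] digit_funpow[of n x' 0] by (auto simp: y'_def q_def)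
      have "\<bar>y - y'\<bar> \<le> 4 * Q\<^sup>2 * \<bar>x - x'\<bar>"
        using same_digits(2)[OF x x' close] by (simp add: y_def y'_def Q_def)
      also have "\<dots> \<le> 4 * Q\<^sup>2 * (5 * r)" using d by (intro mult_left_mono) auto
      also have "\<dots> = h / (10 * (real p)\<^sup>2)" using Q by (simp add: r_def)
      also have "\<dots> < h / (8 * (real p)\<^sup>2)" using h2 p2 by (simp add: divide_simps)
      finally have "\<bar>y - y'\<bar> < h / (8 * (real p)\<^sup>2)" .
      then have "q = p"
        using inverse_gap[OF y y' h2 hp] iso[OF q] prime_ge_1_nat[OF q] by (fastforce simp: h_def)
      then show ?thesis using same dn by (auto simp: less_Suc_eq q_def)
    qed
    have "emeasure \<mu> (cball x (5 * r)) \<le> emeasure \<mu> {x'. \<forall>i<Suc n. digit x' i = digit x i}"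
    proof (rule emeasure_mono_AE)
      show "AE x' in \<mu>. x' \<in> cball x (5 * r) \<longrightarrow> x' \<in> {x'. \<forall>i<Suc n. digit x' i = digit x i}"
        using AE_Lambda by eventually_elim (use near in \<open>auto simp: dist_real_def\<close>)
    qed simp
    also have "\<dots> \<le> ennreal (den (digit x) (Suc n) 0 powr (-2 * \<delta>))"
      using pa delta_pos by (intro emeasure_cylinder_le) auto
    also have "\<dots> \<le> ennreal ((Q * real p) powr (-2 * \<delta>))"
    proof (intro ennreal_leI powr_mono2')
      show "Q * real p \<le> den (digit x) (Suc n) 0"
        using den_Suc_bounds(1)[of n "digit x"] d1 dn by (simp add: Q_def del: den.simps)
    qed (use Q p2 delta_pos in auto)
    finally have m: "measure \<mu> (cball x (5 * r)) \<le> (Q * real p) powr (-2 * \<delta>)"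
      by (simp add: emeasure_eq_measure)
    have lnQ: "ln Q \<le> A * real p ^ (3 * K + 3)"
    proof -
      define b where "b = A * real n ^ K"
      have b0: "0 \<le> b" using A by (simp add: b_def)
      have "Q \<le> b ^ n"
        unfolding Q_def
      proof (rule den_le_power)
        fix i assume i: "i < n"
        have "real (digit x i) + 1 \<le> A * real (i + 1) ^ K" by (rule grow)
        also have "\<dots> \<le> b" unfolding b_def using i A by (intro mult_left_mono power_mono) auto
        finally show "real (digit x i) + 1 \<le> b" .
      qed (use d1 b0 in auto)
      have "ln Q \<le> real n * b"
      proof (cases "n = 0")
        case True
        then show ?thesis by (simp add: Q_def)
      next
        case False
        then have "1 \<le> real n ^ K" by (simp add: one_le_power)
        then have b1: "1 \<le> b" unfolding b_def using A mult_mono[of 1 A 1 "real n ^ K"] by simp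
        have "ln Q \<le> ln (b ^ n)" using \<open>Q \<le> b ^ n\<close> Q b1 by (subst ln_le_cancel_iff) auto
        also have "\<dots> = real n * ln b" using b1 by (simp add: ln_realpow)
        also have "\<dots> \<le> real n * b" using ln_le_minus_one[of b] b1 by (intro mult_left_mono) auto
        finally show ?thesis .
      qed
      also have "\<dots> = A * (real n) ^ (K + 1)" by (simp add: b_def)
      also have "\<dots> \<le> A * (real p ^ 3) ^ (K + 1)"
      proof (intro mult_left_mono power_mono)
        show "real n \<le> real p ^ 3" using n by (metis less_imp_le of_nat_le_iff of_nat_power)
      qed (use A in auto)
      also have "(real p ^ 3) ^ (K + 1) = real p ^ (3 * K + 3)"
        by (simp only: power_mult[symmetric]) (simp add: algebra_simps)
      finally show ?thesis .
    qed
    have inv: "1 / (2 * r) = (10 * Q * real p)\<^sup>2 / h" using h2 Q p2 by (simp add: r_def power_mult_distrib)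
    have ln1: "ln (1 / (2 * r)) \<le> real p ^ J"
    proof -
      have "ln (1 / (2 * r)) = 2 * ln Q + 2 * ln (10 * real p) - ln h"
        unfolding inv using h2 Q p2 by (simp add: ln_div ln_mult ln_realpow)
      also have "\<dots> \<le> 2 * (A * real p ^ (3 * K + 3)) + 2 * (10 * real p)"
        using lnQ ln_le_minus_one[of "10 * real p"] p2 h2 ln_ge_zero[of h] by linarith
      also have "\<dots> \<le> 2 * (A * real p ^ (3 * K + 3)) + 2 * (10 * real p ^ (3 * K + 3))"
        using p2 power_increasing[of 1 "3 * K + 3" "real p"] by simp
      also have "\<dots> = (2 * A + 20) * real p ^ (3 * K + 3)" by (simp add: algebra_simps)
      also have "\<dots> \<le> real p * real p ^ (3 * K + 3)" using pA by (intro mult_right_mono) auto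
      also have "\<dots> = real p ^ J" by (simp only: power_Suc[symmetric]) (simp add: J_def add.commute)
      finally show ?thesis .
    qed
    have ln0: "1 < ln (1 / (2 * r))"
    proof -
      have "2 * r \<le> 1 / 3"
      proof -
        have "1 / (200 * real p) \<le> 1 / 6" using p2 by (intro divide_left_mono) auto
        then show ?thesis using rp by linarith
      qed
      then have "3 \<le> 1 / (2 * r)" using r0 by (simp add: field_simps)
      then have "exp 1 < 1 / (2 * r)" using e_less_272 by linarith
      then have "ln (exp 1) < ln (1 / (2 * r))" using r0 by (subst ln_less_cancel_iff) auto
      then show ?thesis by simp
    qed
    have "ln (ln (1 / (2 * r))) \<le> ln (real p ^ J)" using ln1 ln0 p2 by (subst ln_le_cancel_iff) auto
    also have "\<dots> = real J * ln (real p)" using p2 by (simp add: ln_realpow)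
    finally have ll: "ln (ln (1 / (2 * r))) \<le> real J * ln (real p)" .
    have ll0: "0 < ln (ln (1 / (2 * r)))" using ln0 by simp
    have J0: "0 < real J" by (simp add: J_def)
    \<comment> \<open>By the choice of \<open>r\<close>,
      \<open>2 * r = h / (10 * Q * p)\<^sup>2\<close>. The factor \<open>J\<close> is inserted and
      compensated so that \<open>ll\<close> applies next.\<close>
    have "(Q * real p) powr (-2 * \<delta>) = (100 * (real J)\<^sup>2 / c) powr \<delta> * ((2 * r) powr \<delta> * (real J * ln (real p)) powr (-2 * \<delta>))"
    proof -
      have sq: "(z\<^sup>2) powr \<delta> = z powr (2 * \<delta>)" if "0 < z" for z :: real
        using that by (simp add: powr_powr flip: powr_numeral)
      have "100 * (real J)\<^sup>2 / c * (2 * r) = (real J * ln (real p))\<^sup>2 / (Q * real p)\<^sup>2"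
        using assms(1) Q p2 by (simp add: r_def h_def power_mult_distrib)
      then have "(100 * (real J)\<^sup>2 / c) powr \<delta> * (2 * r) powr \<delta> = (real J * ln (real p)) powr (2 * \<delta>) / (Q * real p) powr (2 * \<delta>)"
        using Q p2 J0 lnp0 by (subst powr_mult[symmetric]) (simp add: powr_divide sq)
      then show ?thesis using Q p2 J0 lnp0
        by (simp add: mult.assoc[symmetric] powr_minus_divide)
    qed
    also have "\<dots> \<le> (100 * (real J)\<^sup>2 / c) powr \<delta> * psi_loglog \<delta> (2 * r)"
      unfolding psi_loglog_def using ll ll0 delta_pos
      by (intro mult_left_mono) (auto intro!: powr_mono2')
    finally have "measure \<mu> (cball x (5 * r)) \<le> (100 * (3 * real K + 4)\<^sup>2 / c) powr \<delta> * psi_loglog \<delta> (2 * r)"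
      using m by (simp add: J_def)
    moreover have "r \<le> 1 / real p"
    proof -
      have "1 / (200 * real p) \<le> 1 / real p" using p2 by (intro divide_left_mono) auto
      then show ?thesis using rp by linarith
    qed
    ultimately show ?thesis using r0 by blast
  qed
  then show ?thesis by blast
qed

lemma AE_digit_growth:
  assumes "summable (\<lambda>n. measure \<mu> {x. digit x n > (n + 1) ^ K})"
  shows "AE x in \<mu>. \<exists>N. \<forall>n\<ge>N. digit x n \<le> (n + 1) ^ K"
proof -
  have "AE x in \<mu>. eventually (\<lambda>n. x \<in> space \<mu> - {x. digit x n > (n + 1) ^ K}) sequentially"
    using assms by (intro borel_cantelli_AE1) (auto simp: emeasure_eq_measure)
  then show ?thesis
    by eventually_elim (auto simp: eventually_sequentially not_less)
qed

lemma AE_measure_ball_le: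
  assumes "Rk 1 < \<infinity>" "0 < Rk 2"
  shows "\<exists>C>0. AE x in \<mu>. \<forall>\<epsilon>>0. \<exists>r>0. r < \<epsilon> \<and> measure \<mu> (cball x (5 * r)) \<le> C * psi_loglog \<delta> (2 * r)"
proof -
  obtain c' where c': "0 < c'" "\<And>N. \<exists>p>N. prime p \<and> (\<forall>q. prime q \<longrightarrow> q \<noteq> p \<longrightarrow> c' * (ln (real p))\<^sup>2 \<le> \<bar>real q - real p\<bar>)"
    using isolated_primes[OF assms] by blast
  define c where "c = min c' (1/4)"
  have c: "0 < c" "c \<le> 1/4" using c' by (auto simp: c_def)
  define I where "I = {p. prime p \<and> (\<forall>q. prime q \<longrightarrow> q \<noteq> p \<longrightarrow> c * (ln (real p))\<^sup>2 \<le> \<bar>real q - real p\<bar>)}"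
  have I: "\<exists>p\<in>I. p > N" for N
  proof -
    obtain p where p: "p > N" "prime p" "\<And>q. prime q \<Longrightarrow> q \<noteq> p \<Longrightarrow> c' * (ln (real p))\<^sup>2 \<le> \<bar>real q - real p\<bar>"
      using c'(2) by blast
    have "c * (ln (real p))\<^sup>2 \<le> c' * (ln (real p))\<^sup>2" by (intro mult_right_mono) (auto simp: c_def)
    then have "p \<in> I" using p unfolding I_def by (auto intro: order.trans)
    then show ?thesis using p by blast
  qed
  obtain K where K: "K \<ge> 1" and sm: "summable (\<lambda>n. measure \<mu> {x. digit x n > (n + 1) ^ K})"
    using digit_growth by blast
  define C where "C = (100 * (3 * real K + 4)\<^sup>2 / c) powr \<delta>"
  have "AE x in \<mu>. \<forall>N. \<exists>p\<in>I. N < p \<and> (\<exists>n<p^3. digit x n = p)"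
    using I by (intro AE_infinitely_often_digit) (auto simp: I_def)
  then have "AE x in \<mu>. \<forall>\<epsilon>>0. \<exists>r>0. r < \<epsilon> \<and> measure \<mu> (cball x (5 * r)) \<le> C * psi_loglog \<delta> (2 * r)"
    using AE_digit_growth[OF sm] AE_Lambda
  proof eventually_elim
    case (elim x)
    obtain N where N: "\<And>n. n \<ge> N \<Longrightarrow> digit x n \<le> (n + 1) ^ K" using elim(2) by blast
    \<comment> \<open>Makes the growth bound valid from the first digit on: the sum covers the
      finitely many exceptional digits, and the \<open>2\<close> covers the added \<open>1\<close>
      at the others.\<close>
    define A where "A = 2 + (\<Sum>i<N. real (digit x i) + 1)"
    have sum0: "0 \<le> (\<Sum>i<N. real (digit x i) + 1)" by (intro sum_nonneg) auto
    have A: "1 \<le> A" using sum0 by (simp add: A_def)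
    have grow: "real (digit x i) + 1 \<le> A * real (i + 1) ^ K" for i
    proof -
      have one: "1 \<le> real (i + 1) ^ K" by (intro one_le_power) simp
      show ?thesis
      proof (cases "i < N")
        case True
        then have "real (digit x i) + 1 \<le> (\<Sum>i<N. real (digit x i) + 1)" by (intro member_le_sum) auto
        then have "real (digit x i) + 1 \<le> A * 1" by (simp add: A_def)
        also have "\<dots> \<le> A * real (i + 1) ^ K" using A one by (intro mult_left_mono) auto
        finally show ?thesis .
      next
        case False
        then have "real (digit x i) \<le> real ((i + 1) ^ K)" using N[of i] by (simp only: of_nat_le_iff not_less)
        then have "real (digit x i) \<le> real (i + 1) ^ K" by (simp only: of_nat_power)
        then have "real (digit x i) + 1 \<le> 2 * real (i + 1) ^ K" using one by linarith
        also have "\<dots> \<le> A * real (i + 1) ^ K" using sum0 by (intro mult_right_mono) (auto simp: A_def)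
        finally show ?thesis .
      qed
    qed
    obtain p0 where p0: "\<forall>p\<ge>p0. \<forall>n<p^3. digit x n = p \<longrightarrow>
      (\<forall>q. prime q \<longrightarrow> q \<noteq> p \<longrightarrow> c * (ln (real p))\<^sup>2 \<le> \<bar>real q - real p\<bar>) \<longrightarrow> (\<exists>r>0. r \<le> 1 / real p \<and> measure \<mu> (cball x (5 * r)) \<le> C * psi_loglog \<delta> (2 * r))"
      using measure_ball_le[OF c A elim(3) grow] unfolding C_def by blast
    show ?case
    proof (intro allI impI)
      fix \<epsilon> :: real assume e: "0 < \<epsilon>"
      obtain p n where p: "p \<in> I" "max p0 (nat \<lceil>1 / \<epsilon>\<rceil>) < p" "n < p^3" "digit x n = p"
        using elim(1) by blast
      have iso: "\<forall>q. prime q \<longrightarrow> q \<noteq> p \<longrightarrow> c * (ln (real p))\<^sup>2 \<le> \<bar>real q - real p\<bar>"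
        using p(1) by (simp add: I_def)
      have "p0 \<le> p" using p(2) by simp
      then obtain r where r: "r > 0" "r \<le> 1 / real p" "measure \<mu> (cball x (5 * r)) \<le> C * psi_loglog \<delta> (2 * r)"
        using p0 p(3,4) iso by blast
      have "1 / \<epsilon> < real p" using p(2) by linarith
      then have "1 / real p < \<epsilon>" using e p(2) by (simp add: field_simps)
      then show "\<exists>r>0. r < \<epsilon> \<and> measure \<mu> (cball x (5 * r)) \<le> C * psi_loglog \<delta> (2 * r)" using r by force
    qed
  qed
  moreover have "0 < C" unfolding C_def using c K by simp
  ultimately show ?thesis by blast
qed

end

subsection \<open>Density theorems for packing measures\<close>

lemma emeasure_UN_countable_le:
  assumes [measurable]: "\<And>i. i \<in> I \<Longrightarrow> X i \<in> sets M" and I [simp]: "countable I"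
  shows "emeasure M (\<Union>(X ` I)) \<le> (\<integral>\<^sup>+i. emeasure M (X i) \<partial>count_space I)"
proof -
  have [measurable]: "\<Union>(X ` I) \<in> sets M" by (intro sets.countable_UN') auto
  have "emeasure M (\<Union>(X ` I)) = (\<integral>\<^sup>+x. indicator (\<Union>(X ` I)) x \<partial>M)" by simp
  also have "\<dots> \<le> (\<integral>\<^sup>+x. \<integral>\<^sup>+i. indicator (X i) x \<partial>count_space I \<partial>M)"
  proof (intro nn_integral_mono)
    fix x
    show "indicator (\<Union>(X ` I)) x \<le> (\<integral>\<^sup>+i. indicator (X i) x \<partial>count_space I :: ennreal)"
    proof (cases "x \<in> \<Union>(X ` I)")
      case True
      then obtain j where j: "j \<in> I" "x \<in> X j" by blast
      have "(1::ennreal) = (\<integral>\<^sup>+i. indicator {j} i \<partial>count_space I)" using j by simp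
      also have "\<dots> \<le> (\<integral>\<^sup>+i. indicator (X i) x \<partial>count_space I)"
        using j by (intro nn_integral_mono) (auto simp: indicator_def)
      finally show ?thesis using True by simp
    qed simp
  qed
  also have "\<dots> = (\<integral>\<^sup>+i. \<integral>\<^sup>+x. indicator (X i) x \<partial>M \<partial>count_space I)"
    by (intro nn_integral_count_space_nn_integral) auto
  also have "\<dots> = (\<integral>\<^sup>+i. emeasure M (X i) \<partial>count_space I)"
    by (intro nn_integral_cong) simp
  finally show ?thesis .
qed

text \<open>The balls of a packing are disjoint, so their masses add up to the mass of their union.
  They stick out of \<open>A\<close>, whence the larger set \<open>V\<close>; containment almost
  everywhere suits the application, where only points of \<open>Lambda_P\<close> are
  controlled.\<close>

lemma packing_premeasure_le:
  assumes sets: "sets M = sets borel" and V: "V \<in> sets M" and r0: "0 < r0"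
    and le: "\<And>x r. x \<in> A \<Longrightarrow> 0 < r \<Longrightarrow> r < r0 \<Longrightarrow> ennreal (\<psi> (2 * r)) \<le> C * emeasure M (cball x r)"
    and sub: "\<And>x r. x \<in> A \<Longrightarrow> 0 < r \<Longrightarrow> r < r0 \<Longrightarrow> AE z in M. z \<in> cball x r \<longrightarrow> z \<in> V"
  shows "packing_premeasure \<psi> A \<le> C * emeasure M V"
proof -
  have "packing_premeasure \<psi> A \<le> (SUP B\<in>packings A r0.
      (\<integral>\<^sup>+ b. ennreal (\<psi> (diameter (cball (fst b) (snd b)))) \<partial>count_space B))"
    unfolding packing_premeasure_def using r0 by (intro INF_lower) auto
  also have "\<dots> \<le> C * emeasure M V"
  proof (rule SUP_least)
    fix B assume B: "B \<in> packings A r0"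
    then have cB: "countable B" by (simp add: packings_def)
    have b: "fst b \<in> A" "0 < snd b" "snd b < r0" if "b \<in> B" for b
      using B that r0 by (fastforce simp: packings_def)+
    have cb [measurable]: "cball x r \<in> sets M" for x r unfolding sets by simp
    have "(\<integral>\<^sup>+ b. ennreal (\<psi> (diameter (cball (fst b) (snd b)))) \<partial>count_space B)
      \<le> (\<integral>\<^sup>+ b. C * emeasure M (cball (fst b) (snd b)) \<partial>count_space B)"
    proof (rule nn_integral_mono)
      fix b assume "b \<in> space (count_space B)"
      then show "ennreal (\<psi> (diameter (cball (fst b) (snd b)))) \<le> C * emeasure M (cball (fst b) (snd b))"
        using b[of b] le[of "fst b" "snd b"] by simp
    qed
    also have "\<dots> = C * (\<integral>\<^sup>+ b. emeasure M (cball (fst b) (snd b)) \<partial>count_space B)"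
      by (intro nn_integral_cmult) simp
    also have "(\<integral>\<^sup>+ b. emeasure M (cball (fst b) (snd b)) \<partial>count_space B) = emeasure M (\<Union>b\<in>B. cball (fst b) (snd b))"
      using B by (intro emeasure_UN_countable[symmetric] cb cB) (auto simp: packings_def disjoint_family_on_def)
    also have "\<dots> \<le> emeasure M V"
    proof (rule emeasure_mono_AE)
      have "AE z in M. \<forall>b\<in>B. z \<in> cball (fst b) (snd b) \<longrightarrow> z \<in> V"
        using cB b sub by (subst AE_ball_countable) auto
      then show "AE z in M. z \<in> (\<Union>b\<in>B. cball (fst b) (snd b)) \<longrightarrow> z \<in> V"
        by eventually_elim blast
    qed (rule V)
    finally show "(\<integral>\<^sup>+ b. ennreal (\<psi> (diameter (cball (fst b) (snd b)))) \<partial>count_space B) \<le> C * emeasure M V"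
      by (simp add: mult_left_mono)
  qed
  finally show ?thesis .
qed

text \<open>The factor \<open>5\<close> is the one in Vitali's covering lemma; having it in the hypothesis makes a doubling
  property of \<open>M\<close> unnecessary.\<close>

lemma outer_measure_le_packing_premeasure:
  assumes sets: "sets M = sets borel" and G: "G \<subseteq> A" and C: "0 < C"
    and ex: "\<And>x \<epsilon>. x \<in> G \<Longrightarrow> 0 < \<epsilon> \<Longrightarrow> \<exists>r>0. r < \<epsilon> \<and> emeasure M (cball x (5 * r)) \<le> ennreal C * ennreal (\<psi> (2 * r))"
  shows "outer_measure_of M G \<le> ennreal C * packing_premeasure \<psi> A"
proof -
  have "ennreal (1 / C) * outer_measure_of M G \<le> packing_premeasure \<psi> A"
    unfolding packing_premeasure_def
  proof (rule INF_greatest)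
    fix \<epsilon> :: real assume "\<epsilon> \<in> {0<..}"
    then have e: "0 < \<epsilon>" by simp
    define K where "K = {(x, r). x \<in> G \<and> 0 < r \<and> 2 * r \<le> \<epsilon> \<and> emeasure M (cball x (5 * r)) \<le> ennreal C * ennreal (\<psi> (2 * r))}"
    have cov: "G \<subseteq> (\<Union>b\<in>K. cball (fst b) (snd b))"
    proof
      fix x assume x: "x \<in> G"
      obtain r where "r > 0" "r < \<epsilon> / 2" "emeasure M (cball x (5 * r)) \<le> ennreal C * ennreal (\<psi> (2 * r))"
        using ex[OF x, of "\<epsilon> / 2"] e by auto
      then have "(x, r) \<in> K" "x \<in> cball (fst (x, r)) (snd (x, r))" using x by (auto simp: K_def)
      then show "x \<in> (\<Union>b\<in>K. cball (fst b) (snd b))" by blast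
    qed
    have bd: "0 < snd b \<and> snd b \<le> \<epsilon> / 2" if "b \<in> K" for b using that by (auto simp: K_def)
    obtain B where B: "countable B" "B \<subseteq> K"
      "pairwise (\<lambda>i j. disjnt (cball (fst i) (snd i)) (cball (fst j) (snd j))) B"
      "G \<subseteq> (\<Union>b\<in>B. cball (fst b) (5 * snd b))"
      using Vitali_covering_lemma_cballs[where S = G and K = K and a = fst and r = snd and B = "\<epsilon> / 2", OF cov bd] by blast
    have pack: "B \<in> packings A \<epsilon>"
      unfolding packings_def
    proof (intro CollectI conjI ballI impI)
      show "countable B" by (rule B(1))
    next
      fix b assume "b \<in> B"
      then have "b \<in> K" using B(2) by blast
      then show "case b of (x, r) \<Rightarrow> x \<in> A \<and> 0 < r \<and> 2 * r \<le> \<epsilon>" using G by (auto simp: K_def)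
    next
      fix b b' assume "b \<in> B" "b' \<in> B" "b \<noteq> b'"
      then show "cball (fst b) (snd b) \<inter> cball (fst b') (snd b') = {}"
        using B(3) unfolding pairwise_def disjnt_def by blast
    qed
    have cb: "cball x r \<in> sets M" for x r unfolding sets by simp
    have S: "(\<Union>b\<in>B. cball (fst b) (5 * snd b)) \<in> sets M"
      using B(1) cb by (intro sets.countable_UN') auto
    \<comment> \<open>\<open>G\<close> may be non-measurable, because the covers in
      \<open>packing_measure\<close> consist of arbitrary sets; hence the outer measure.\<close>
    have "outer_measure_of M G \<le> outer_measure_of M (\<Union>b\<in>B. cball (fst b) (5 * snd b))"
      by (rule outer_measure_of_mono[OF B(4)])
    also have "\<dots> = emeasure M (\<Union>b\<in>B. cball (fst b) (5 * snd b))"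
      by (rule outer_measure_of_eq[OF S])
    also have "\<dots> \<le> (\<integral>\<^sup>+b. emeasure M (cball (fst b) (5 * snd b)) \<partial>count_space B)"
      by (intro emeasure_UN_countable_le cb B(1))
    also have "\<dots> \<le> (\<integral>\<^sup>+b. ennreal C * ennreal (\<psi> (diameter (cball (fst b) (snd b)))) \<partial>count_space B)"
    proof (rule nn_integral_mono)
      fix b assume "b \<in> space (count_space B)"
      then have "b \<in> K" using B(2) by auto
      then show "emeasure M (cball (fst b) (5 * snd b)) \<le> ennreal C * ennreal (\<psi> (diameter (cball (fst b) (snd b))))"
        by (auto simp: K_def)
    qed
    also have "\<dots> = ennreal C * (\<integral>\<^sup>+b. ennreal (\<psi> (diameter (cball (fst b) (snd b)))) \<partial>count_space B)"
      by (intro nn_integral_cmult) simp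
    finally have "ennreal (1 / C) * outer_measure_of M G \<le>
      ennreal (1 / C) * (ennreal C * (\<integral>\<^sup>+b. ennreal (\<psi> (diameter (cball (fst b) (snd b)))) \<partial>count_space B))"
      by (rule mult_left_mono) simp
    also have "\<dots> = (\<integral>\<^sup>+b. ennreal (\<psi> (diameter (cball (fst b) (snd b)))) \<partial>count_space B)"
      using C by (simp add: mult.assoc[symmetric] flip: ennreal_mult)
    also have "\<dots> \<le> (SUP B\<in>packings A \<epsilon>. \<integral>\<^sup>+b. ennreal (\<psi> (diameter (cball (fst b) (snd b)))) \<partial>count_space B)"
      by (rule SUP_upper[OF pack])
    finally show "ennreal (1 / C) * outer_measure_of M G \<le>
      (SUP B\<in>packings A \<epsilon>. \<integral>\<^sup>+b. ennreal (\<psi> (diameter (cball (fst b) (snd b)))) \<partial>count_space B)" .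
  qed
  then have "ennreal C * (ennreal (1 / C) * outer_measure_of M G) \<le> ennreal C * packing_premeasure \<psi> A"
    by (rule mult_left_mono) simp
  then show ?thesis using C by (simp add: mult.assoc[symmetric] flip: ennreal_mult)
qed

context prime_conformal begin

lemma packing_measure_pos:
  assumes "Rk 1 < \<infinity>" "0 < Rk 2"
  shows "0 < packing_measure_of (psi_loglog \<delta>) \<mu>"
proof -
  obtain C where C: "C > 0" and ae: "AE x in \<mu>. \<forall>\<epsilon>>0. \<exists>r>0. r < \<epsilon> \<and>
      measure \<mu> (cball x (5 * r)) \<le> C * psi_loglog \<delta> (2 * r)"
    using AE_measure_ball_le[OF assms] by blast
  define G where "G = {x. \<forall>\<epsilon>>0. \<exists>r>0. r < \<epsilon> \<and> measure \<mu> (cball x (5 * r)) \<le> C * psi_loglog \<delta> (2 * r)}"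
  have "ennreal (1 / C) \<le> packing_measure_of (psi_loglog \<delta>) \<mu>"
    unfolding packing_measure_of_def packing_measure_def
  proof (intro INF_greatest)
    fix A and F :: "nat \<Rightarrow> real set"
    assume A: "A \<in> {A. UNIV - A \<in> sets \<mu> \<and> emeasure \<mu> (UNIV - A) = 0}" and F: "F \<in> {F. A \<subseteq> (\<Union>i. F i)}"
    \<comment> \<open>Measurable hulls of the arbitrary sets \<open>F i \<inter> G\<close>. Their
      union has full mass, so countable subadditivity bounds the sum of their masses below by
      \<open>1\<close>.\<close>
    have "\<exists>E\<in>sets \<mu>. F i \<inter> G \<subseteq> E \<and> outer_measure_of \<mu> (F i \<inter> G) = emeasure \<mu> E" for i
      by (rule outer_measure_of_attain) simp
    then obtain E where E: "\<And>i. E i \<in> sets \<mu>" "\<And>i. F i \<inter> G \<subseteq> E i"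
      "\<And>i. outer_measure_of \<mu> (F i \<inter> G) = emeasure \<mu> (E i)" by metis
    have "AE x in \<mu>. x \<in> A"
      using A by (intro AE_I'[of "UNIV - A"]) (auto simp: null_sets_def)
    then have "AE x in \<mu>. x \<in> (\<Union>i. E i)"
      using ae
    proof eventually_elim
      case (elim x)
      then have "x \<in> G" by (simp add: G_def)
      moreover obtain i where "x \<in> F i" using elim(1) F by blast
      ultimately show ?case using E(2) by blast
    qed
    then have "emeasure \<mu> (\<Union>i. E i) = 1"
      using E(1) by (intro emeasure_eq_1_AE) auto
    then have "1 \<le> (\<Sum>i. emeasure \<mu> (E i))"
      using emeasure_subadditive_countably[of E \<mu>] E(1) by (metis image_subsetI)
    also have "\<dots> \<le> (\<Sum>i. ennreal C * packing_premeasure (psi_loglog \<delta>) (F i))"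
    proof (intro suminf_le summableI)
      fix i
      have "outer_measure_of \<mu> (F i \<inter> G) \<le> ennreal C * packing_premeasure (psi_loglog \<delta>) (F i)"
      proof (rule outer_measure_le_packing_premeasure[OF sets_mu _ C])
        fix x \<epsilon> assume "x \<in> F i \<inter> G" "(0::real) < \<epsilon>"
        then obtain r where r: "r > 0" "r < \<epsilon>" "measure \<mu> (cball x (5 * r)) \<le> C * psi_loglog \<delta> (2 * r)"
          by (auto simp: G_def)
        then show "\<exists>r>0. r < \<epsilon> \<and> emeasure \<mu> (cball x (5 * r)) \<le> ennreal C * ennreal (psi_loglog \<delta> (2 * r))"
          using C by (intro exI[of _ r]) (simp add: emeasure_eq_measure ennreal_leI flip: ennreal_mult')
      qed auto
      then show "emeasure \<mu> (E i) \<le> ennreal C * packing_premeasure (psi_loglog \<delta>) (F i)" by (simp add: E(3))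
    qed
    also have "\<dots> = ennreal C * (\<Sum>i. packing_premeasure (psi_loglog \<delta>) (F i))" by simp
    finally have "ennreal (1 / C) * 1 \<le> ennreal (1 / C) * (ennreal C * (\<Sum>i. packing_premeasure (psi_loglog \<delta>) (F i)))"
      by (rule mult_left_mono) simp
    then show "ennreal (1 / C) \<le> (\<Sum>i. packing_premeasure (psi_loglog \<delta>) (F i))"
      using C by (simp add: mult.assoc[symmetric] flip: ennreal_mult del: ennreal_suminf_cmult)
  qed
  moreover have "0 < ennreal (1 / C)" using C by simp
  ultimately show ?thesis by (rule order.strict_trans2[rotated])
qed

text \<open>The set of full measure is decomposed according to the last time \<open>n - 1\<close> at which the digit bound fails
  and the sum \<open>k\<close> of the digits up to that time; the pieces have uniformly small balls contained in sets
  of summable measure.\<close>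

lemma packing_measure_finite:
  assumes "Rk 1 < \<infinity>"
  shows "packing_measure_of (psi_loglog \<delta>) \<mu> < \<infinity>"
proof -
  obtain K where K: "K \<ge> 1" and sm: "summable (\<lambda>n. measure \<mu> {x. digit x n > (n + 1) ^ K})"
    using digit_growth by blast
  obtain C where C: "C > 0" and psi: "\<And>n k. \<exists>r0>0. \<forall>x\<in>Lambda_P. (\<forall>j\<ge>n. digit x j \<le> (j + 1) ^ K) \<longrightarrow>
    (\<Sum>i<n. digit x i) = k \<longrightarrow> (\<forall>r. 0 < r \<longrightarrow> r < r0 \<longrightarrow> psi_loglog \<delta> (2 * r) \<le> C * measure \<mu> (cball x r))"
    using psi_le_measure_ball[OF assms K] by blast
  \<comment> \<open>\<open>W\<close> and \<open>V\<close> omit the digit bound from time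
    \<open>n\<close> on, because a small ball controls only the first \<open>n\<close> digits of its
    points; \<open>J\<close> is the piece itself. For positive \<open>n\<close>, \<open>W n\<close>
    lies in an event of the summable family.\<close>
  define W where "W n = {x \<in> Lambda_P. n = 0 \<or> digit x (n - 1) > n ^ K}" for n
  define V where "V n k = {x \<in> W n. (\<Sum>i<n. digit x i) = k}" for n k
  define J where "J n k = {x \<in> V n k. \<forall>j\<ge>n. digit x j \<le> (j + 1) ^ K}" for n k
  define A where "A = {x \<in> Lambda_P. \<exists>n. \<forall>j\<ge>n. digit x j \<le> (j + 1) ^ K}"
  have [measurable]: "W n \<in> sets borel" for n unfolding W_def by measurable
  have [measurable]: "V n k \<in> sets borel" for n k unfolding V_def by measurable
  have [measurable]: "A \<in> sets borel" unfolding A_def by measurable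
  have "AE x in \<mu>. x \<in> A"
    using AE_Lambda AE_digit_growth[OF sm] by eventually_elim (auto simp: A_def)
  then have "emeasure \<mu> (UNIV - A) = 0"
    by (subst (asm) AE_iff_measurable[of "UNIV - A"]) auto
  then have Afull: "A \<in> {A. UNIV - A \<in> sets \<mu> \<and> emeasure \<mu> (UNIV - A) = 0}" by auto
  have cover: "A \<subseteq> (\<Union>i. case prod_decode i of (n, k) \<Rightarrow> J n k)"
  proof
    fix x assume x: "x \<in> A"
    define n where "n = (LEAST n. \<forall>j\<ge>n. digit x j \<le> (j + 1) ^ K)"
    have "\<exists>n. \<forall>j\<ge>n. digit x j \<le> (j + 1) ^ K" using x unfolding A_def by blast
    then have n: "\<forall>j\<ge>n. digit x j \<le> (j + 1) ^ K" unfolding n_def by (rule LeastI_ex)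
    have "n = 0 \<or> digit x (n - 1) > n ^ K"
    proof (rule ccontr)
      assume neg: "\<not> ?thesis"
      have "digit x j \<le> (j + 1) ^ K" if "n - 1 \<le> j" for j
      proof (cases "j = n - 1")
        case True
        then have "j + 1 = n" using neg by simp
        then show ?thesis using neg True by simp
      next
        case False
        then show ?thesis using that n by simp
      qed
      then have "\<forall>j\<ge>n - 1. digit x j \<le> (j + 1) ^ K" by blast
      then have "n \<le> n - 1" unfolding n_def by (rule Least_le)
      moreover have "0 < n" using neg by simp
      ultimately show False by linarith
    qed
    then have "x \<in> J n (\<Sum>i<n. digit x i)" using x n by (auto simp: J_def V_def W_def A_def)
    then have "x \<in> (case prod_decode (prod_encode (n, \<Sum>i<n. digit x i)) of (n, k) \<Rightarrow> J n k)" by simp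
    then show "x \<in> (\<Union>i. case prod_decode i of (n, k) \<Rightarrow> J n k)" by (rule UN_I[OF UNIV_I])
  qed
  have pm: "packing_premeasure (psi_loglog \<delta>) (J n k) \<le> ennreal C * emeasure \<mu> (V n k)" for n k
  proof -
    obtain r0 where r0: "r0 > 0" "\<And>x r. x \<in> Lambda_P \<Longrightarrow> (\<forall>j\<ge>n. digit x j \<le> (j + 1) ^ K) \<Longrightarrow>
      (\<Sum>i<n. digit x i) = k \<Longrightarrow> 0 < r \<Longrightarrow> r < r0 \<Longrightarrow> psi_loglog \<delta> (2 * r) \<le> C * measure \<mu> (cball x r)"
      using psi[of n k] by blast
    \<comment> \<open>Below this radius \<open>same_digits\<close> applies uniformly on
      \<open>J n k\<close>: the first \<open>n\<close> digits are at most \<open>k\<close>, and the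
      bound on digit \<open>n\<close> keeps the \<open>n\<close>-th tail away from
      \<open>0\<close>.\<close>
    define r1 where "r1 = 1 / (real ((n + 1) ^ K) + 1) / (4 * ((real k + 1) ^ n)\<^sup>2)"
    have r1: "0 < r1" by (simp add: r1_def add_nonneg_pos)
    show ?thesis
    proof (rule packing_premeasure_le[OF sets_mu, of _ "min r0 r1"])
      fix x r assume x: "x \<in> J n k" and r: "0 < r" "r < min r0 r1"
      have xL: "x \<in> Lambda_P" "\<forall>j\<ge>n. digit x j \<le> (j + 1) ^ K" "(\<Sum>i<n. digit x i) = k"
        using x by (auto simp: J_def V_def W_def)
      show "ennreal (psi_loglog \<delta> (2 * r)) \<le> ennreal C * emeasure \<mu> (cball x r)"
        using r0(2)[OF xL, of r] r C by (simp add: emeasure_eq_measure ennreal_leI flip: ennreal_mult')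
      have d1: "1 \<le> digit x i" for i using Lambda_P_digit(1)[OF xL(1)] prime_ge_1_nat by blast
      show "AE z in \<mu>. z \<in> cball x r \<longrightarrow> z \<in> V n k"
        using AE_Lambda
      proof eventually_elim
        case (elim z)
        show ?case
        proof
          assume z: "z \<in> cball x r"
          have "\<bar>x - z\<bar> < r1" using z r by (simp add: dist_real_def)
          also have "r1 \<le> (gauss_map ^^ n) x / (4 * (den (digit x) n 0)\<^sup>2)"
            unfolding r1_def
          proof (rule frac_le)
            have "digit x n \<le> (n + 1) ^ K" using xL(2) by blast
            then have "real (digit x n) \<le> real ((n + 1) ^ K)" by (simp only: of_nat_le_iff)
            then have "1 / (real ((n + 1) ^ K) + 1) \<le> 1 / (real (digit x n) + 1)"
              by (intro divide_left_mono mult_pos_pos add_nonneg_pos add_right_mono) auto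
            also have "\<dots> < (gauss_map ^^ n) x"
              using Lambda_P_bounds(1)[OF Lambda_P_funpow[OF xL(1), of n]] digit_funpow[of n x 0] by simp
            finally show "1 / (real ((n + 1) ^ K) + 1) \<le> (gauss_map ^^ n) x" by simp
            show "0 \<le> (gauss_map ^^ n) x"
              using Lambda_P_digit(4)[OF Lambda_P_funpow[OF xL(1), of n]] by simp
            have D: "1 \<le> den (digit x) n 0" using den_bounds(3)[of n "digit x" 0] d1 by simp
            then show "0 < 4 * (den (digit x) n 0)\<^sup>2" by simp
            have "den (digit x) n 0 \<le> (real k + 1) ^ n"
            proof (rule den_le_power)
              fix i assume "i < n"
              then have "digit x i \<le> (\<Sum>i<n. digit x i)" by (intro member_le_sum) auto
              then show "real (digit x i) + 1 \<le> real k + 1" using xL(3) by simp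
            qed (use d1 in auto)
            then show "4 * (den (digit x) n 0)\<^sup>2 \<le> 4 * ((real k + 1) ^ n)\<^sup>2"
              using D by (intro mult_left_mono power_mono) auto
          qed
          finally have same: "\<forall>i<n. digit z i = digit x i" by (rule same_digits(1)[OF xL(1) elim])
          have "(\<Sum>i<n. digit z i) = k" using same by (simp flip: xL(3))
          moreover have "n = 0 \<or> digit z (n - 1) > n ^ K"
            using same x by (cases n) (auto simp: J_def V_def W_def)
          ultimately show "z \<in> V n k" using elim by (simp add: V_def W_def)
        qed
      qed
    qed (use r0 r1 in auto)
  qed
  have sumV: "(\<Sum>k. emeasure \<mu> (V n k)) = emeasure \<mu> (W n)" for n
  proof -
    have "(\<Sum>k. emeasure \<mu> (V n k)) = emeasure \<mu> (\<Union>k. V n k)"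
      by (intro suminf_emeasure) (auto simp: V_def disjoint_family_on_def)
    also have "(\<Union>k. V n k) = W n" by (auto simp: V_def)
    finally show ?thesis .
  qed
  have "packing_measure_of (psi_loglog \<delta>) \<mu> \<le> packing_measure (psi_loglog \<delta>) A"
    unfolding packing_measure_of_def by (rule INF_lower[OF Afull])
  also have "\<dots> \<le> (\<Sum>i. packing_premeasure (psi_loglog \<delta>) (case prod_decode i of (n, k) \<Rightarrow> J n k))"
    unfolding packing_measure_def using cover by (intro INF_lower) auto
  also have "\<dots> \<le> (\<Sum>i. ennreal C * (case prod_decode i of (n, k) \<Rightarrow> emeasure \<mu> (V n k)))"
    using pm by (intro suminf_le summableI) (auto split: prod.split)
  also have "\<dots> = ennreal C * (\<Sum>i. case prod_decode i of (n, k) \<Rightarrow> emeasure \<mu> (V n k))" by simp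
  also have "(\<Sum>i. case prod_decode i of (n, k) \<Rightarrow> emeasure \<mu> (V n k)) = (\<Sum>n. emeasure \<mu> (W n))"
    by (intro suminf_ennreal_2dimen) (simp add: sumV)
  also have "ennreal C * (\<Sum>n. emeasure \<mu> (W n)) < \<infinity>"
  proof -
    have "(\<Sum>n. emeasure \<mu> (W n)) = emeasure \<mu> (W 0) + (\<Sum>n. emeasure \<mu> (W (Suc n)))"
      using suminf_offset[OF summableI, of "\<lambda>n. emeasure \<mu> (W n)" 1] by (simp add: add.commute)
    also have "\<dots> \<le> 1 + (\<Sum>n. ennreal (measure \<mu> {x. digit x n > (n + 1) ^ K}))"
    proof (intro add_mono suminf_le summableI)
      fix n
      have "emeasure \<mu> (W (Suc n)) \<le> emeasure \<mu> {x. digit x n > (n + 1) ^ K}"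
        by (intro emeasure_mono) (auto simp: W_def)
      then show "emeasure \<mu> (W (Suc n)) \<le> ennreal (measure \<mu> {x. digit x n > (n + 1) ^ K})"
        by (simp add: emeasure_eq_measure)
    qed (rule emeasure_le_1)
    also have "\<dots> < \<infinity>" using sm by (simp add: suminf_ennreal2 ennreal_add_less_top)
    finally show ?thesis by (simp add: ennreal_mult_less_top)
  qed
  finally show ?thesis .
qed

end

theorem theorem3:
  fixes \<delta> :: real and \<mu> :: "real measure"
  assumes "0 < Rk 1" and "Rk 1 < \<infinity>"
    and "0 < Rk 2" and "Rk 2 < \<infinity>"
    and "pressure_zero \<delta>"
    and "conformal_measure \<delta> \<mu>"
  shows "0 < packing_measure_of (psi_loglog \<delta>) \<mu> \<and> packing_measure_of (psi_loglog \<delta>) \<mu> < \<infinity>"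
proof -
  interpret prime_conformal \<delta> \<mu> by unfold_locales (rule assms)
  show ?thesis using packing_measure_pos packing_measure_finite assms by blast
qed

end
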